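(* Let $\mathbb{K}$ be a field and let $\Delta=\Delta(G)$ be the clique complex of a graph $G$. Then $\Delta$ is bi-initially Cohen--Macaulay (over $\mathbb{K}$) if and only if $G$ is chordal and $\Delta$ is weakly connected.
   Context: Graphs are finite and simple, with vertex set $X=\{x_1,\dots,x_n\}$. A graph is chordal if it has no induced cycle $C_k$ with $k\ge4$. The clique complex $\Delta(G)$ is the simplicial complex of all cliques of $G$. For a simplicial complex $\Delta$ on $X$ and $R=\mathbb{K}[x_1,\dots,x_n]$, $I_\Delta$ is generated by the squarefree monomials of the minimal non-faces and $\mathbb{K}[\Delta]=R/I_\Delta$. The Alexander dual is $\Delta^\vee=\{X\setminus F\mid F\subseteq X,\ F\notin\Delta\}$. The initial dimension of a module $N$ is $\mathrm{indim}\,N=\inf\{\dim R/P\mid P\in\mathrm{Ass}_R N\}$, and $\mathrm{indim}\,\Delta=\mathrm{indim}\,\mathbb{K}[\Delta]-1$, i.e. the minimum dimension of a facet (where $\dim F=|F|-1$). $\Delta$ is initially Cohen--Macaulay over $\mathbb{K}$ if $\mathrm{depth}\,\mathbb{K}[\Delta]=\mathrm{indim}\,\mathbb{K}[\Delta]$ (or $\mathbb{K}[\Delta]=0$), depth being with respect to $(x_1,\dots,x_n)$. A graded ideal $I$ has a degree resolution if its Castelnuovo--Mumford regularity equals the maximum degree of a minimal generator of $I$. A graded ideal $I$ is bi-initially Cohen--Macaulay if $R/I$ is initially Cohen--Macaulay and $I$ has a degree resolution; a simplicial complex $\Delta$ is bi-initially Cohen--Macaulay if both $\Delta$ and $\Delta^\vee$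 are initially Cohen--Macaulay (i.e. $I_\Delta$ is bi-initially Cohen--Macaulay). The $i$-skeleton $\Delta^i$ consists of all faces of dimension at most $i$. A simplicial complex $\Gamma$ is strongly connected if for any two facets $F,F'$ there is a sequence of facets $F=F_0,\dots,F_t=F'$ with $|F_i\cap F_{i+1}|=\dim\Gamma$ for all $i=0,\dots,t-1$. $\Delta$ is weakly connected if $\Delta^{\mathrm{indim}\,\Delta}$ is strongly connected. *)

theory Defs
  imports "HOL-Library.Poly_Mapping" "HOL-Library.Extended_Nat"
begin

section \<open>Depth and initial dimension of a cyclic module \<open>R/I\<close>\<close>

interpretation ideal: module "(*) :: 'r::comm_ring_1 \<Rightarrow> 'r \<Rightarrow> 'r"
  by unfold_locales (simp_all add: algebra_simps)

text \<open>
  Ideals of \<open>R\<close> are the submodules \<open>ideal.subspace I\<close> of \<open>R\<close>, and \<open>ideal.span S\<close> is the ideal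
  generated by \<open>S\<close>.  The quotient \<open>R/I\<close> depends on the term \<open>I\<close> and is therefore not a type; the
  invariants of \<open>R/I\<close> below are functions of \<open>I\<close>, with \<open>a + I = 0\<close> written as \<open>a \<in> I\<close>.
\<close>

definition prime_ideal :: "'r::comm_ring_1 set \<Rightarrow> bool" where
  "prime_ideal P \<longleftrightarrow> ideal.subspace P \<and> 1 \<notin> P \<and> (\<forall>a b. a * b \<in> P \<longrightarrow> a \<in> P \<or> b \<in> P)"

text \<open>\<open>Ass\<^sub>R (R/I)\<close>: the primes of the form \<open>Ann (a + I)\<close>.\<close>

definition assoc_primes :: "'r::comm_ring_1 set \<Rightarrow> 'r set set" where
  "assoc_primes I = {P. prime_ideal P \<and> (\<exists>a. P = {r. r * a \<in> I})}"

text \<open>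
  Krull dimension of \<open>R/I\<close> for a proper ideal \<open>I\<close>: the primes of \<open>R/I\<close> are those of \<open>R\<close> containing
  \<open>I\<close>, and a chain \<open>P\<^sub>0 \<subset> \<dots> \<subset> P\<^sub>d\<close>, given as the list \<open>Ps\<close> of its \<open>d + 1\<close> members, has length \<open>d\<close>.
\<close>

definition krull_dim :: "'r::comm_ring_1 set \<Rightarrow> enat" where
  "krull_dim I = Sup {enat (length Ps - 1) | Ps.
     Ps \<noteq> [] \<and> sorted_wrt (\<subset>) Ps \<and> (\<forall>P\<in>set Ps. prime_ideal P \<and> I \<subseteq> P)}"

definition indim_quot :: "'r::comm_ring_1 set \<Rightarrow> enat" where
  "indim_quot I = (INF P\<in>assoc_primes I. krull_dim P)"

text \<open>
  \<open>fs\<close> is regular on \<open>R/I\<close>: each \<open>f\<^sub>i\<close> is a non-zero-divisor on \<open>R/(I, f\<^sub>0, \<dots>, f\<^sub>i\<^sub>-\<^sub>1)\<close>, and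
  \<open>R/(I, fs) \<noteq> 0\<close>.
\<close>

definition regular_seq :: "'r::comm_ring_1 set \<Rightarrow> 'r list \<Rightarrow> bool" where
  "regular_seq I fs \<longleftrightarrow>
     (\<forall>i<length fs. \<forall>g. fs ! i * g \<in> ideal.span (I \<union> set (take i fs))
        \<longrightarrow> g \<in> ideal.span (I \<union> set (take i fs))) \<and>
     1 \<notin> ideal.span (I \<union> set fs)"

definition depth_quot :: "'r::comm_ring_1 set \<Rightarrow> 'r set \<Rightarrow> enat" where
  "depth_quot J I = Sup {enat (length fs) | fs. set fs \<subseteq> J \<and> regular_seq I fs}"

section \<open>Stanley--Reisner ideals\<close>

text \<open>
  \<open>\<bbbK>[x\<^sub>1, \<dots>, x\<^sub>n]\<close>, with the finite type \<open>'x\<close> indexing the variables.  The vertex set \<open>X\<close> is the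
  whole of \<open>'x\<close>, so \<open>n = CARD('x)\<close>.
\<close>

type_synonym ('x, 'k) mpoly = "('x \<Rightarrow>\<^sub>0 nat) \<Rightarrow>\<^sub>0 'k"

definition var :: "'x \<Rightarrow> ('x, 'k::field) mpoly" where
  "var i = Poly_Mapping.single (Poly_Mapping.single i 1) 1"

definition irrelevant_ideal :: "('x::finite, 'k::field) mpoly set" where
  "irrelevant_ideal = ideal.span (range var)"

definition initially_CM_ideal :: "('x::finite, 'k::field) mpoly set \<Rightarrow> bool" where
  "initially_CM_ideal I \<longleftrightarrow> I = UNIV \<or> depth_quot irrelevant_ideal I = indim_quot I"

text \<open>
  A simplicial complex may have non-faces of size one, and it may be void: \<open>{}\<close> (no faces) is
  distinct from \<open>{{}}\<close>.
\<close>

definition simplicial_complex :: "'x set set \<Rightarrow> bool" where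
  "simplicial_complex \<Delta> \<longleftrightarrow> (\<forall>F\<in>\<Delta>. \<forall>H. H \<subseteq> F \<longrightarrow> H \<in> \<Delta>)"

definition minimal_nonfaces :: "'x set set \<Rightarrow> 'x set set" where
  "minimal_nonfaces \<Delta> = {F. F \<notin> \<Delta> \<and> (\<forall>H. H \<subset> F \<longrightarrow> H \<in> \<Delta>)}"

definition stanley_reisner_ideal :: "'x::finite set set \<Rightarrow> ('x, 'k::field) mpoly set" where
  "stanley_reisner_ideal \<Delta> = ideal.span ((\<lambda>F. \<Prod>i\<in>F. var i) ` minimal_nonfaces \<Delta>)"

definition initially_CM :: "'k::field itself \<Rightarrow> 'x::finite set set \<Rightarrow> bool" where
  "initially_CM _ \<Delta> \<longleftrightarrow>
     initially_CM_ideal (stanley_reisner_ideal \<Delta> :: ('x, 'k) mpoly set)"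

definition alexander_dual :: "'x set set \<Rightarrow> 'x set set" where
  "alexander_dual \<Delta> = {UNIV - F | F. F \<notin> \<Delta>}"

definition bi_initially_CM :: "'k::field itself \<Rightarrow> 'x::finite set set \<Rightarrow> bool" where
  "bi_initially_CM K \<Delta> \<longleftrightarrow> initially_CM K \<Delta> \<and> initially_CM K (alexander_dual \<Delta>)"

section \<open>Weak connectedness\<close>

text \<open>Dimensions are integers because \<open>dim {} = -1\<close>.\<close>

definition face_dim :: "'x set \<Rightarrow> int" where
  "face_dim F = int (card F) - 1"

definition facets :: "'x set set \<Rightarrow> 'x set set" where
  "facets \<Delta> = {F\<in>\<Delta>. \<forall>H\<in>\<Delta>. F \<subseteq> H \<longrightarrow> H = F}"

definition complex_dim :: "'x::finite set set \<Rightarrow> int" where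
  "complex_dim \<Delta> = Max (face_dim ` \<Delta>)"

definition complex_indim :: "'x::finite set set \<Rightarrow> int" where
  "complex_indim \<Delta> = Min (face_dim ` facets \<Delta>)"

definition skeleton :: "int \<Rightarrow> 'x set set \<Rightarrow> 'x set set" where
  "skeleton i \<Delta> = {F\<in>\<Delta>. face_dim F \<le> i}"

definition strongly_connected :: "'x::finite set set \<Rightarrow> bool" where
  "strongly_connected \<Gamma> \<longleftrightarrow>
     (\<forall>F\<in>facets \<Gamma>. \<forall>F'\<in>facets \<Gamma>. \<exists>Fs. Fs \<noteq> [] \<and> hd Fs = F \<and> last Fs = F' \<and>
        set Fs \<subseteq> facets \<Gamma> \<and>
        (\<forall>i. Suc i < length Fs \<longrightarrow> int (card (Fs ! i \<inter> Fs ! Suc i)) = complex_dim \<Gamma>))"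

definition weakly_connected :: "'x::finite set set \<Rightarrow> bool" where
  "weakly_connected \<Delta> \<longleftrightarrow> strongly_connected (skeleton (complex_indim \<Delta>) \<Delta>)"

section \<open>Graphs\<close>

text \<open>A graph on the vertex set \<open>UNIV :: 'x set\<close> is given by its adjacency relation.\<close>

definition simple_graph :: "('x \<Rightarrow> 'x \<Rightarrow> bool) \<Rightarrow> bool" where
  "simple_graph adj \<longleftrightarrow> symp adj \<and> irreflp adj"

definition induced_cycle :: "('x \<Rightarrow> 'x \<Rightarrow> bool) \<Rightarrow> 'x list \<Rightarrow> bool" where
  "induced_cycle adj vs \<longleftrightarrow> 3 \<le> length vs \<and> distinct vs \<and>
     (\<forall>i<length vs. \<forall>j<length vs. adj (vs ! i) (vs ! j) \<longleftrightarrow>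
        j = Suc i mod length vs \<or> i = Suc j mod length vs)"

definition chordal :: "('x \<Rightarrow> 'x \<Rightarrow> bool) \<Rightarrow> bool" where
  "chordal adj \<longleftrightarrow> \<not> (\<exists>vs. 4 \<le> length vs \<and> induced_cycle adj vs)"

definition clique_complex :: "('x \<Rightarrow> 'x \<Rightarrow> bool) \<Rightarrow> 'x set set" where
  "clique_complex adj = {F. \<forall>u\<in>F. \<forall>v\<in>F. u \<noteq> v \<longrightarrow> adj u v}"

lemma simplicial_complex_clique_complex: "simplicial_complex (clique_complex adj)"
  by (auto simp: simplicial_complex_def clique_complex_def)

lemma simplicial_complex_alexander_dual:
  assumes "simplicial_complex \<Delta>"
  shows "simplicial_complex (alexander_dual \<Delta>)"
  unfolding simplicial_complex_def
proof (intro ballI allI impI)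
  fix F H assume "F \<in> alexander_dual \<Delta>" "H \<subseteq> F"
  then obtain F' where "F' \<notin> \<Delta>" "F' \<subseteq> UNIV - H"
    by (auto simp: alexander_dual_def)
  then have "UNIV - H \<notin> \<Delta>"
    using assms unfolding simplicial_complex_def by blast
  moreover have "H = UNIV - (UNIV - H)" by auto
  ultimately show "H \<in> alexander_dual \<Delta>"
    unfolding alexander_dual_def by blast
qed

end

theory Submission
  imports Defs "HOL-Library.FuncSet"
begin

text \<open>
  Let \<open>d\<close> be the minimal size of a facet of \<open>\<Delta>\<close>.  The associated primes of a face ideal are the
  coordinate primes of its facets, so \<open>indim \<bbbK>[\<Delta>] = d\<close>, and being initially Cohen--Macaulay means
  having a regular sequence of length \<open>d\<close>.

  For the existence of regular sequences, the elementary symmetric polynomials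
  \<open>e\<^sub>1, e\<^sub>2, \<dots>\<close> in all variables serve for all complexes at once.  They are regular on simplices, and
  regularity on two complexes (up to \<open>k\<close>) and on their intersection (up to \<open>k - 1\<close>) passes to the
  union.  A chordal graph is built up by adding simplicial vertices; weak connectedness forces every
  separator to have at least \<open>d - 1\<close> vertices, so each clique is glued on along at least \<open>d - 1\<close>
  vertices.  The same elimination handles the Alexander dual, whose facets all have \<open>n - 2\<close> vertices.

  Conversely, a regular sequence of length \<open>r\<close> kills the Koszul cohomology of \<open>\<bbbK>[\<Delta>]\<close> with respect
  to \<open>x\<^sub>1\<^sup>2, \<dots>, x\<^sub>n\<^sup>2\<close> below degree \<open>r\<close>.  Explicit cocycles supported on a facet, on a component of a
  disconnected link, and (for the dual) on a fan triangulating an induced cycle give the upper bounds.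
\<close>

text \<open>The gluing argument dictates one common sequence: the depth count along
  \<open>I \<inter> J\<close>, \<open>I\<close>, \<open>J\<close> and \<open>I + J\<close> stays
  elementary only if the same elements are tested on all quotients. Generic linear forms would need
  a large field; elementary symmetric polynomials have coefficients in every field. The induction
  gets started because modulo the ideal of a simplex \<open>F\<close> the polynomial
  \<open>esym (card F)\<close> is the single monomial of \<open>F\<close>, so adjoining it leaves
  the boundary of the simplex.

  Squares of variables enter because exponents must carry information. In the multidegree that is -1
  on a face \<open>T\<close> and 0 elsewhere, a Koszul cochain on the variables themselves has
  exponent 0 along \<open>T\<close>, and its monomial forgets \<open>T\<close>. On the squares that
  exponent is 1, the support of the monomial is the whole set, and the strand computes the
  cohomology of the link of \<open>T\<close>, as in Hochster's formula for local cohomology. For the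
  dual of a graph with an induced cycle, \<open>T\<close> is the complement of the cycle.\<close>

abbreviation "keys \<equiv> Poly_Mapping.keys"
abbreviation "lookup \<equiv> Poly_Mapping.lookup"
abbreviation "single \<equiv> Poly_Mapping.single"

text \<open>Interpreted for multiplication, this simp rule loops together with associativity.\<close>

declare ideal.scale_scale [simp del]

section \<open>Monomials and face ideals\<close>

lemma sum_single_lookup:
  fixes p :: "'a \<Rightarrow>\<^sub>0 'b::comm_monoid_add"
  shows "(\<Sum>m\<in>keys p. single m (lookup p m)) = p"
  by (rule poly_mapping_eqI) (simp add: lookup_sum lookup_single when_def in_keys_iff)

lemma keys_add_nat: "keys (m + m' :: 'x \<Rightarrow>\<^sub>0 nat) = keys m \<union> keys m'"
  by (auto simp: in_keys_iff lookup_add)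

lemma lookup_mult_sum_keys:
  fixes p q :: "('x, 'k::field) mpoly"
  shows "lookup (p * q) m =
    (\<Sum>a\<in>keys p. \<Sum>b\<in>keys q. if a + b = m then lookup p a * lookup q b else 0)"
proof -
  have "p * q = (\<Sum>a\<in>keys p. single a (lookup p a)) * (\<Sum>b\<in>keys q. single b (lookup q b))"
    by (simp add: sum_single_lookup)
  also have "\<dots> = (\<Sum>a\<in>keys p. \<Sum>b\<in>keys q. single (a + b) (lookup p a * lookup q b))"
    by (simp add: sum_product mult_single)
  finally show ?thesis
    by (simp add: lookup_sum lookup_single when_def)
qed

lemma lookup_single_mult:
  fixes p :: "('x, 'k::field) mpoly"
  shows "lookup (single k c * p) (k + m) = c * lookup p m"
proof -
  have "lookup (single k c * p) (k + m)
      = (\<Sum>b\<in>keys p. if b = m then c * lookup p b else 0)"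
    by (cases "c = 0") (simp_all add: lookup_mult_sum_keys cong: if_cong)
  then show ?thesis
    by (simp add: in_keys_iff)
qed

lemma keys_single_mult:
  fixes p :: "('x, 'k::field) mpoly"
  assumes "c \<noteq> 0"
  shows "keys (single k c * p) = (+) k ` keys p"
proof
  show "keys (single k c * p) \<subseteq> (+) k ` keys p"
    using keys_mult[of "single k c" p] assms by auto
  show "(+) k ` keys p \<subseteq> keys (single k c * p)"
    using assms by (auto simp: in_keys_iff lookup_single_mult)
qed

lemma lookup_single_mult_eq_0:
  fixes p :: "('x, 'k::field) mpoly"
  assumes "\<And>n. m \<noteq> k + n"
  shows "lookup (single k c * p) m = 0"
proof (cases "c = 0")
  case False
  then show ?thesis
    using keys_single_mult[OF False, of k p] assms
    by (metis (no_types, lifting) imageE not_in_keys_iff_lookup_eq_zero)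
qed auto

definition sq_monom :: "'x set \<Rightarrow> 'x \<Rightarrow>\<^sub>0 nat" where
  "sq_monom S = (\<Sum>i\<in>S. single i 1)"

lemma lookup_sq_monom [simp]:
  fixes S :: "'x::finite set"
  shows "lookup (sq_monom S) i = (if i \<in> S then 1 else 0)"
  by (simp add: sq_monom_def lookup_sum lookup_single when_def)

lemma keys_sq_monom [simp]:
  fixes S :: "'x::finite set"
  shows "keys (sq_monom S) = S"
  by (auto simp: in_keys_iff split: if_splits)

lemma prod_var:
  fixes S :: "'x::finite set"
  shows "(\<Prod>i\<in>S. var i :: ('x, 'k::field) mpoly) = single (sq_monom S) 1"
proof -
  have "finite S" by simp
  then show ?thesis
    by (induction S rule: finite_induct) (simp_all add: sq_monom_def var_def mult_single)
qed

text \<open>The Stanley-Reisner ideal through its monomials: membership is a condition on each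
  coefficient separately. Unions of complexes become intersections of ideals, and the void complex
  gives the unit ideal.\<close>

definition face_ideal :: "'x set set \<Rightarrow> ('x, 'k::field) mpoly set" where
  "face_ideal \<Gamma> = {p. \<forall>m\<in>keys p. keys m \<notin> \<Gamma>}"

lemma face_ideal_iff_lookup:
  "p \<in> face_ideal \<Gamma> \<longleftrightarrow> (\<forall>m. keys m \<in> \<Gamma> \<longrightarrow> lookup p m = 0)"
  by (auto simp: face_ideal_def in_keys_iff)

lemma lookup_face_ideal:
  "p \<in> face_ideal \<Gamma> \<Longrightarrow> keys m \<in> \<Gamma> \<Longrightarrow> lookup p m = 0"
  by (simp add: face_ideal_iff_lookup)

lemma single_in_face_ideal: "keys m \<notin> \<Gamma> \<Longrightarrow> single m c \<in> face_ideal \<Gamma>"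
  by (auto simp: face_ideal_def)

lemma subspace_face_ideal:
  assumes "simplicial_complex \<Gamma>"
  shows "ideal.subspace (face_ideal \<Gamma> :: ('x, 'k::field) mpoly set)"
proof (rule ideal.subspaceI)
  fix x c :: "('x, 'k) mpoly"
  assume x: "x \<in> face_ideal \<Gamma>"
  show "c * x \<in> face_ideal \<Gamma>"
    unfolding face_ideal_def
  proof (intro CollectI ballI)
    fix m assume "m \<in> keys (c * x)"
    then obtain a b where ab: "m = a + b" "b \<in> keys x"
      using keys_mult[of c x] by blast
    then have "keys b \<notin> \<Gamma>" using x by (simp add: face_ideal_def)
    moreover have "keys b \<subseteq> keys m" by (simp add: ab keys_add_nat)
    ultimately show "keys m \<notin> \<Gamma>"
      using assms by (auto simp: simplicial_complex_def)
  qed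
qed (simp_all add: face_ideal_iff_lookup lookup_add)

lemma face_ideal_Un: "face_ideal (\<Gamma> \<union> \<Gamma>') = face_ideal \<Gamma> \<inter> face_ideal \<Gamma>'"
  by (auto simp: face_ideal_def)

lemma face_ideal_empty [simp]: "face_ideal {} = UNIV"
  by (auto simp: face_ideal_def)

lemma face_ideal_eq_UNIV_iff:
  assumes "simplicial_complex \<Gamma>"
  shows "(face_ideal \<Gamma> :: ('x::finite, 'k::field) mpoly set) = UNIV \<longleftrightarrow> \<Gamma> = {}"
proof
  assume eq: "(face_ideal \<Gamma> :: ('x, 'k) mpoly set) = UNIV"
  show "\<Gamma> = {}"
  proof (rule ccontr)
    assume "\<Gamma> \<noteq> {}"
    then have "{} \<in> \<Gamma>" using assms by (auto simp: simplicial_complex_def)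
    then have "(1 :: ('x, 'k) mpoly) \<notin> face_ideal \<Gamma>" by (simp add: face_ideal_def)
    then show False using eq by auto
  qed
qed auto

text \<open>Every monomial of \<open>p\<close> has its support outside one of the two complexes, so
  its terms can be sorted. This keeps the sum ideal in the gluing argument among the face
  ideals.\<close>

lemma face_ideal_Int_split:
  assumes "(p :: ('x, 'k::field) mpoly) \<in> face_ideal (\<Gamma> \<inter> \<Gamma>')"
  obtains q r where "p = q + r" "q \<in> face_ideal \<Gamma>" "r \<in> face_ideal \<Gamma>'"
proof
  let ?K = "{m\<in>keys p. keys m \<notin> \<Gamma>}"
  let ?q = "\<Sum>m\<in>?K. single m (lookup p m)"
  let ?r = "\<Sum>m\<in>keys p - ?K. single m (lookup p m)"
  have "finite ?K" "?K \<subseteq> keys p" by auto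
  then have "(\<Sum>m\<in>keys p. single m (lookup p m)) = ?r + ?q"
    by (intro sum.subset_diff) auto
  then show "p = ?q + ?r" by (simp add: sum_single_lookup add.commute)
  show "?q \<in> face_ideal \<Gamma>"
    by (auto simp: face_ideal_iff_lookup lookup_sum lookup_single when_def intro!: sum.neutral)
  show "?r \<in> face_ideal \<Gamma>'"
    using assms by (auto simp: face_ideal_iff_lookup lookup_sum lookup_single when_def
        intro!: sum.neutral)
qed

lemma minimal_nonface_subset:
  fixes F :: "'x::finite set"
  assumes "F \<notin> \<Gamma>"
  obtains H where "H \<subseteq> F" "H \<in> minimal_nonfaces \<Gamma>"
proof -
  have "finite {H. H \<subseteq> F \<and> H \<notin> \<Gamma>}" "{H. H \<subseteq> F \<and> H \<notin> \<Gamma>} \<noteq> {}"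
    using assms by auto
  then obtain H where H: "H \<in> {H. H \<subseteq> F \<and> H \<notin> \<Gamma>}"
    and min: "\<And>H'. H' \<in> {H. H \<subseteq> F \<and> H \<notin> \<Gamma>} \<Longrightarrow> H' \<subseteq> H \<Longrightarrow> H = H'"
    by (metis (no_types, lifting) finite_has_minimal)
  have "H \<in> minimal_nonfaces \<Gamma>"
    unfolding minimal_nonfaces_def using H min by blast
  with H that show thesis by auto
qed

lemma stanley_reisner_ideal_eq:
  assumes "simplicial_complex \<Gamma>"
  shows "stanley_reisner_ideal \<Gamma> = (face_ideal \<Gamma> :: ('x::finite, 'k::field) mpoly set)"
proof
  have "(\<Prod>i\<in>F. var i) \<in> (face_ideal \<Gamma> :: ('x, 'k) mpoly set)"
    if "F \<in> minimal_nonfaces \<Gamma>" for F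
    using that by (auto simp: prod_var minimal_nonfaces_def intro!: single_in_face_ideal)
  then show "stanley_reisner_ideal \<Gamma> \<subseteq> (face_ideal \<Gamma> :: ('x, 'k) mpoly set)"
    unfolding stanley_reisner_ideal_def
    by (intro ideal.span_minimal subspace_face_ideal assms) auto
next
  show "(face_ideal \<Gamma> :: ('x, 'k) mpoly set) \<subseteq> stanley_reisner_ideal \<Gamma>"
  proof
    fix p :: "('x, 'k) mpoly" assume p: "p \<in> face_ideal \<Gamma>"
    have "single m (lookup p m) \<in> stanley_reisner_ideal \<Gamma>" if "m \<in> keys p" for m
    proof -
      have "keys m \<notin> \<Gamma>" using p that by (simp add: face_ideal_def)
      then obtain H where H: "H \<subseteq> keys m" "H \<in> minimal_nonfaces \<Gamma>"
        by (rule minimal_nonface_subset)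
      have "m = m - sq_monom H + sq_monom H"
        using H(1) by (intro poly_mapping_eqI) (auto simp: lookup_add lookup_minus in_keys_iff)
      then have "single m (lookup p m)
          = single (m - sq_monom H) (lookup p m) * (\<Prod>i\<in>H. var i)"
        by (metis prod_var mult_single mult.right_neutral)
      moreover have "(\<Prod>i\<in>H. var i) \<in> (stanley_reisner_ideal \<Gamma> :: ('x, 'k) mpoly set)"
        unfolding stanley_reisner_ideal_def using H(2) by (intro ideal.span_base) auto
      ultimately show ?thesis
        unfolding stanley_reisner_ideal_def by (simp only: ideal.span_scale)
    qed
    then have "(\<Sum>m\<in>keys p. single m (lookup p m)) \<in> stanley_reisner_ideal \<Gamma>"
      unfolding stanley_reisner_ideal_def by (intro ideal.span_sum)
    then show "p \<in> stanley_reisner_ideal \<Gamma>" by (simp add: sum_single_lookup)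
  qed
qed

text \<open>The minimal non-faces of \<open>{{}}\<close> are the singletons. Membership in the
  irrelevant ideal thereby becomes absence of a constant term.\<close>

lemma irrelevant_ideal_eq:
  "irrelevant_ideal = (face_ideal {{}} :: ('x::finite, 'k::field) mpoly set)"
proof -
  have sc: "simplicial_complex {{} :: 'x set}" by (simp add: simplicial_complex_def)
  have "minimal_nonfaces {{} :: 'x set} = (\<lambda>i. {i}) ` UNIV"
  proof -
    have "F \<in> minimal_nonfaces {{}} \<longleftrightarrow> (\<exists>i. F = {i})" for F :: "'x set"
    proof
      assume F: "F \<in> minimal_nonfaces {{}}"
      then obtain i where "i \<in> F" by (auto simp: minimal_nonfaces_def)
      with F have "\<not> {i} \<subset> F" by (auto simp: minimal_nonfaces_def)
      with \<open>i \<in> F\<close> show "\<exists>i. F = {i}" by auto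
    qed (auto simp: minimal_nonfaces_def)
    then show ?thesis by auto
  qed
  then have "stanley_reisner_ideal {{}} = (irrelevant_ideal :: ('x, 'k) mpoly set)"
    by (simp add: stanley_reisner_ideal_def irrelevant_ideal_def image_image)
  then show ?thesis using stanley_reisner_ideal_eq[OF sc, where 'k='k] by simp
qed

text \<open>A unique decomposition of \<open>a + b\<close> rules out cancellation. Leading terms
  have this property, which gives primality of the coordinate ideals.\<close>

lemma lookup_mult_extreme:
  fixes p q :: "('x::finite, 'k::field) mpoly"
  assumes a: "a \<in> keys p" and b: "b \<in> keys q"
    and uniq: "\<And>a' b'. a' \<in> keys p \<Longrightarrow> b' \<in> keys q \<Longrightarrow> a' + b' = a + b \<Longrightarrow> a' = a \<and> b' = b"
  shows "lookup (p * q) (a + b) = lookup p a * lookup q b"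
proof -
  have "lookup (p * q) (a + b)
      = (\<Sum>a'\<in>keys p. \<Sum>b'\<in>keys q. if a' = a then if b' = b then lookup p a * lookup q b else 0 else 0)"
    unfolding lookup_mult_sum_keys using uniq by (intro sum.cong) auto
  also have "\<dots> = (\<Sum>a'\<in>keys p. if a' = a then (\<Sum>b'\<in>keys q. if b' = b then lookup p a * lookup q b else 0) else 0)"
    by (intro sum.cong) auto
  also have "\<dots> = lookup p a * lookup q b"
    using a b by simp
  finally show ?thesis .
qed

text \<open>
  Monomials are compared through an additive injection into \<open>nat \<Rightarrow>\<^sub>0 nat\<close>, which is linearly
  ordered, because the index type \<open>'x\<close> carries no order.
\<close>

lemma prime_ideal_face_ideal_Pow:
  "prime_ideal (face_ideal (Pow F) :: ('x::finite, 'k::field) mpoly set)"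
  unfolding prime_ideal_def
proof (intro conjI allI impI)
  have sc: "simplicial_complex (Pow F)" by (auto simp: simplicial_complex_def)
  show "ideal.subspace (face_ideal (Pow F) :: ('x, 'k) mpoly set)"
    by (rule subspace_face_ideal[OF sc])
  show "1 \<notin> (face_ideal (Pow F) :: ('x, 'k) mpoly set)"
    by (simp add: face_ideal_def)
  fix p q :: "('x, 'k) mpoly"
  assume pq: "p * q \<in> face_ideal (Pow F)"
  show "p \<in> face_ideal (Pow F) \<or> q \<in> face_ideal (Pow F)"
  proof (rule ccontr)
    assume "\<not> ?thesis"
    then have ne: "{m\<in>keys p. keys m \<subseteq> F} \<noteq> {}" "{m\<in>keys q. keys m \<subseteq> F} \<noteq> {}"
      by (auto simp: face_ideal_def)
    obtain idx :: "'x \<Rightarrow> nat" where idx: "inj idx"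
      using finite_imp_inj_to_nat_seg[of "UNIV :: 'x set"] by auto
    define h :: "('x \<Rightarrow>\<^sub>0 nat) \<Rightarrow> (nat \<Rightarrow>\<^sub>0 nat)"
      where "h m = (\<Sum>i\<in>UNIV. single (idx i) (lookup m i))" for m
    have h_add: "h (a + b) = h a + h b" for a b
      by (simp add: h_def lookup_add single_add sum.distrib)
    have "lookup (h m) (idx i) = lookup m i" for m i
      using idx by (simp add: h_def lookup_sum lookup_single when_def inj_eq)
    then have h_inj: "h a = h b \<Longrightarrow> a = b" for a b
      by (metis poly_mapping_eqI)
    obtain a where a: "a \<in> keys p" "keys a \<subseteq> F"
      and amax: "\<And>m. m \<in> keys p \<Longrightarrow> keys m \<subseteq> F \<Longrightarrow> h m \<le> h a"
    proof -
      have "Max (h ` {m\<in>keys p. keys m \<subseteq> F}) \<in> h ` {m\<in>keys p. keys m \<subseteq> F}"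
        using ne by (intro Max_in) auto
      then obtain a where "a \<in> {m\<in>keys p. keys m \<subseteq> F}" "h a = Max (h ` {m\<in>keys p. keys m \<subseteq> F})"
        by auto
      then show ?thesis by (intro that[of a]) auto
    qed
    obtain b where b: "b \<in> keys q" "keys b \<subseteq> F"
      and bmax: "\<And>m. m \<in> keys q \<Longrightarrow> keys m \<subseteq> F \<Longrightarrow> h m \<le> h b"
    proof -
      have "Max (h ` {m\<in>keys q. keys m \<subseteq> F}) \<in> h ` {m\<in>keys q. keys m \<subseteq> F}"
        using ne by (intro Max_in) auto
      then obtain b where "b \<in> {m\<in>keys q. keys m \<subseteq> F}" "h b = Max (h ` {m\<in>keys q. keys m \<subseteq> F})"
        by auto
      then show ?thesis by (intro that[of b]) auto
    qed
    have "lookup (p * q) (a + b) = lookup p a * lookup q b"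
    proof (rule lookup_mult_extreme[OF a(1) b(1)])
      fix a' b' assume m: "a' \<in> keys p" "b' \<in> keys q" "a' + b' = a + b"
      \<comment> \<open>Maximality is known only among monomials supported in \<open>F\<close>. The
        supports of \<open>a'\<close> and \<open>b'\<close> lie in that of \<open>a + b\<close>, so
        both qualify.\<close>
      then have "keys a' \<union> keys b' = keys a \<union> keys b" by (metis keys_add_nat)
      then have "keys a' \<subseteq> F" "keys b' \<subseteq> F" using a b by auto
      then have le: "h a' \<le> h a" "h b' \<le> h b" using amax bmax m by auto
      have "h a' + h b' = h a + h b" using m(3) by (metis h_add)
      with le have "h a' = h a" "h b' = h b"
        by (metis add_le_cancel_left add_mono_thms_linordered_semiring(2) add_right_cancel antisym add_mono order_refl)+
      then show "a' = a \<and> b' = b" using h_inj by blast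
    qed
    moreover have "keys (a + b) \<in> Pow F" using a b by (simp add: keys_add_nat)
    ultimately have "lookup p a * lookup q b = 0"
      using lookup_face_ideal[OF pq] by simp
    then show False using a(1) b(1) by (simp add: in_keys_iff)
  qed
qed

section \<open>Weakly regular sequences\<close>

abbreviation adjoin :: "'r::comm_ring_1 set \<Rightarrow> 'r \<Rightarrow> 'r set" where
  "adjoin I f \<equiv> ideal.span (insert f I)"

text \<open>Leaving out the condition that the final quotient is non-zero makes every sequence
  weakly regular on the unit ideal, so void complexes can occur in the inductions.\<close>

fun weakly_regular :: "'r::comm_ring_1 set \<Rightarrow> 'r list \<Rightarrow> bool" where
  "weakly_regular I [] \<longleftrightarrow> True"
| "weakly_regular I (f # fs) \<longleftrightarrow> (\<forall>g. f * g \<in> I \<longrightarrow> g \<in> I) \<and> weakly_regular (adjoin I f) fs"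

lemma mem_adjoin:
  assumes "ideal.subspace I"
  shows "x \<in> adjoin I f \<longleftrightarrow> (\<exists>h. x - h * f \<in> I)"
  by (simp add: ideal.span_insert ideal.span_eq_iff[THEN iffD2, OF assms])

lemma span_span_Un: "ideal.span (ideal.span A \<union> B) = ideal.span (A \<union> B)"
proof (rule antisym)
  show "ideal.span (ideal.span A \<union> B) \<subseteq> ideal.span (A \<union> B)"
    by (intro ideal.span_minimal ideal.subspace_span Un_least ideal.span_mono)
      (auto intro: ideal.span_base)
  show "ideal.span (A \<union> B) \<subseteq> ideal.span (ideal.span A \<union> B)"
    by (intro ideal.span_mono) (auto intro: ideal.span_base)
qed

lemma adjoin_span: "adjoin (ideal.span A) f = ideal.span (insert f A)"
  using span_span_Un[of A "{f}"] by simp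

lemma regular_seq_iff:
  assumes "ideal.subspace I"
  shows "regular_seq I fs \<longleftrightarrow> weakly_regular I fs \<and> 1 \<notin> ideal.span (I \<union> set fs)"
proof -
  have "(\<forall>i<length fs. \<forall>g. fs ! i * g \<in> ideal.span (I \<union> set (take i fs))
          \<longrightarrow> g \<in> ideal.span (I \<union> set (take i fs))) \<longleftrightarrow> weakly_regular I fs"
    using assms
  proof (induction fs arbitrary: I)
    case (Cons f fs)
    have span: "ideal.span (I \<union> insert f A) = ideal.span (adjoin I f \<union> A)" for A
      by (simp add: span_span_Un)
    have "ideal.span I = I" using Cons.prems by (simp add: ideal.span_eq_iff)
    then show ?case
      unfolding length_Cons All_less_Suc2 weakly_regular.simps
        Cons.IH[OF ideal.subspace_span, symmetric]
      by (simp only: nth_Cons_0 nth_Cons_Suc take_0 take_Suc_Cons list.set Un_empty_right span)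
  qed auto
  then show ?thesis by (simp add: regular_seq_def)
qed

lemma weakly_regular_UNIV: "weakly_regular UNIV fs"
proof (induction fs)
  case (Cons f fs)
  then show ?case by (simp add: ideal.span_UNIV)
qed auto

lemma weakly_regular_append_left: "weakly_regular I (fs @ gs) \<Longrightarrow> weakly_regular I fs"
  by (induction fs arbitrary: I) auto

text \<open>
  This is the depth lemma for \<open>0 \<rightarrow> R/(I \<inter> J) \<rightarrow> R/I \<oplus> R/J \<rightarrow> R/(I + J) \<rightarrow> 0\<close>, with one and the same
  sequence on all three modules.
\<close>

lemma weakly_regular_Int:
  assumes "ideal.subspace I" "ideal.subspace J"
    and "weakly_regular I fs" "weakly_regular J fs"
    and "weakly_regular (ideal.span (I \<union> J)) (butlast fs)"
  shows "weakly_regular (I \<inter> J) fs"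
  using assms
proof (induction fs arbitrary: I J)
  case (Cons f fs)
  note sub = Cons.prems(1,2) ideal.subspace_inter[OF Cons.prems(1,2)]
  show ?case
  proof (cases "fs = []")
    \<comment> \<open>A single element only has to be a non-zero-divisor on both quotients, which
      passes directly to the intersection. This is why the sequence on the sum may be one
      shorter.\<close>
    case True
    then show ?thesis using Cons.prems by auto
  next
    case False
    have nzd: "\<And>g. f * g \<in> ideal.span (I \<union> J) \<Longrightarrow> g \<in> ideal.span (I \<union> J)"
      using Cons.prems False by simp
    have "adjoin I f \<inter> adjoin J f \<subseteq> adjoin (I \<inter> J) f"
    proof
      fix x assume "x \<in> adjoin I f \<inter> adjoin J f"
      then obtain u v where uv: "x - u * f \<in> I" "x - v * f \<in> J"
        using sub by (auto simp: mem_adjoin)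
      have "(x - v * f) - (x - u * f) \<in> ideal.span (I \<union> J)"
        using uv by (intro ideal.span_diff[of "x - v * f" _ "x - u * f"]) (auto intro: ideal.span_base)
      then have "f * (u - v) \<in> ideal.span (I \<union> J)" by (simp add: algebra_simps)
      then have "u - v \<in> ideal.span (I \<union> J)" by (rule nzd)
      then obtain i j where ij: "u - v = i + j" "i \<in> I" "j \<in> J"
        using sub unfolding ideal.span_Un by (auto simp: ideal.span_eq_iff[THEN iffD2])
      \<comment> \<open>The multiplier \<open>u - i\<close> equals \<open>v + j\<close>, so it
        represents \<open>x\<close> modulo \<open>I\<close> and modulo \<open>J\<close> at
        once.\<close>
      have "x - (u - i) * f = (x - u * f) + f * i" by (simp add: algebra_simps)
      then have "x - (u - i) * f \<in> I"
        using uv(1) ij(2) sub(1) by (simp only: ideal.subspace_add ideal.subspace_scale)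
      moreover have "u - i = v + j" using ij(1) by (simp add: algebra_simps)
      then have "x - (u - i) * f = (x - v * f) + (- f) * j" by (simp add: algebra_simps)
      then have "x - (u - i) * f \<in> J"
        using uv(2) ij(3) sub(2) by (simp only: ideal.subspace_add ideal.subspace_scale)
      ultimately show "x \<in> adjoin (I \<inter> J) f"
        unfolding mem_adjoin[OF sub(3)] by blast
    qed
    moreover have "adjoin (I \<inter> J) f \<subseteq> adjoin I f \<inter> adjoin J f"
      using ideal.span_mono[of "insert f (I \<inter> J)" "insert f I"]
        ideal.span_mono[of "insert f (I \<inter> J)" "insert f J"] by blast
    ultimately have eq: "adjoin (I \<inter> J) f = adjoin I f \<inter> adjoin J f" by blast
    have "ideal.span (adjoin I f \<union> adjoin J f) = adjoin (ideal.span (I \<union> J)) f"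
      by (metis (no_types, lifting) Un_insert_left Un_insert_right Un_commute adjoin_span
          insert_absorb2 span_span_Un)
    then have "weakly_regular (adjoin I f \<inter> adjoin J f) fs"
      using Cons.prems False by (intro Cons.IH ideal.subspace_span) auto
    then show ?thesis using Cons.prems by (simp add: eq)
  qed
qed auto

section \<open>Degrees\<close>

definition tdeg :: "('x::finite \<Rightarrow>\<^sub>0 nat) \<Rightarrow> nat" where
  "tdeg m = (\<Sum>i\<in>UNIV. lookup m i)"

lemma tdeg_add: "tdeg (a + b) = tdeg a + tdeg b"
  by (simp add: tdeg_def lookup_add sum.distrib)

lemma tdeg_eq_0_iff: "tdeg m = 0 \<longleftrightarrow> m = 0"
  by (auto simp: tdeg_def poly_mapping_eq_iff fun_eq_iff)

lemma tdeg_sq_monom: "tdeg (sq_monom S) = card S"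
  by (simp add: tdeg_def sum.If_cases)

definition hcomp :: "nat \<Rightarrow> ('x::finite, 'k::field) mpoly \<Rightarrow> ('x, 'k) mpoly" where
  "hcomp d p = (\<Sum>m\<in>{m\<in>keys p. tdeg m = d}. single m (lookup p m))"

lemma lookup_hcomp: "lookup (hcomp d p) m = (if tdeg m = d then lookup p m else 0)"
  by (auto simp: hcomp_def lookup_sum lookup_single when_def in_keys_iff)

lemma hcomp_diff: "hcomp d (p - q) = hcomp d p - hcomp d q"
  by (rule poly_mapping_eqI) (simp add: lookup_hcomp lookup_minus)

lemma sum_hcomp:
  assumes "\<And>m. m \<in> keys p \<Longrightarrow> tdeg m < N"
  shows "(\<Sum>d<N. hcomp d p) = p"
  by (rule poly_mapping_eqI)
    (use assms in \<open>auto simp: lookup_sum lookup_hcomp in_keys_iff\<close>)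

definition graded :: "('x::finite, 'k::field) mpoly set \<Rightarrow> bool" where
  "graded I \<longleftrightarrow> (\<forall>p\<in>I. \<forall>d. hcomp d p \<in> I)"

lemma graded_face_ideal: "graded (face_ideal \<Gamma>)"
  by (simp add: graded_def face_ideal_iff_lookup lookup_hcomp)

text \<open>Multiplication by a homogeneous \<open>f\<close> shifts degrees by \<open>e\<close>, so
  \<open>h'\<close> is the component of \<open>h\<close> in degree \<open>d - e\<close>, or 0 if
  \<open>d < e\<close>.\<close>

lemma hcomp_mult_homogeneous:
  assumes f: "\<And>m. m \<in> keys f \<Longrightarrow> tdeg m = e"
  shows "\<exists>h'. hcomp d (h * f) = h' * f"
proof -
  obtain h' where h': "\<And>a. a \<in> keys h' \<Longrightarrow> tdeg a + e = d"
    "\<And>a. a \<in> keys (h - h') \<Longrightarrow> tdeg a + e \<noteq> d"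
  proof (cases "e \<le> d")
    case True
    show ?thesis
      by (rule that[of "hcomp (d - e) h"])
        (use True in \<open>auto simp: in_keys_iff lookup_hcomp lookup_minus split: if_splits\<close>)
  next
    case False
    show ?thesis by (rule that[of 0]) (use False in auto)
  qed
  have "lookup (hcomp d (h * f)) m = lookup (h' * f) m" for m
  proof -
    have *: "tdeg m = d" if "m \<in> keys (h' * f)"
    proof -
      obtain a b where "m = a + b" "a \<in> keys h'" "b \<in> keys f"
        using keys_mult[of h' f] \<open>m \<in> keys (h' * f)\<close> by blast
      then show ?thesis using f h'(1) by (simp add: tdeg_add)
    qed
    have **: "tdeg m \<noteq> d" if "m \<in> keys ((h - h') * f)"
    proof -
      obtain a b where "m = a + b" "a \<in> keys (h - h')" "b \<in> keys f"
        using keys_mult[of "h - h'" f] \<open>m \<in> keys ((h - h') * f)\<close> by blast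
      then show ?thesis using f h'(2) by (simp add: tdeg_add)
    qed
    have "h * f = h' * f + (h - h') * f" by (simp add: algebra_simps)
    then have "lookup (h * f) m = lookup (h' * f) m + lookup ((h - h') * f) m"
      by (metis lookup_add)
    with * ** show ?thesis
      by (auto simp: lookup_hcomp in_keys_iff)
  qed
  then show ?thesis by (metis poly_mapping_eqI)
qed

lemma graded_adjoin:
  assumes I: "ideal.subspace I" "graded I" and f: "\<And>m. m \<in> keys f \<Longrightarrow> tdeg m = e"
  shows "graded (adjoin I f)"
  unfolding graded_def
proof (intro ballI allI)
  fix p d assume "p \<in> adjoin I f"
  then obtain h where h: "p - h * f \<in> I" using I(1) by (auto simp: mem_adjoin)
  obtain h' where h': "hcomp d (h * f) = h' * f"
    using hcomp_mult_homogeneous[OF f] by blast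
  have "hcomp d p - h' * f \<in> I"
    using h I(2) by (auto simp: graded_def hcomp_diff simp flip: h')
  then show "hcomp d p \<in> adjoin I f" using I(1) by (auto simp: mem_adjoin)
qed

lemma tdeg_power:
  assumes "f \<in> face_ideal {{}}" "m \<in> keys (f ^ N)"
  shows "N \<le> tdeg m"
  using assms(2)
proof (induction N arbitrary: m)
  case (Suc N)
  obtain a b where ab: "m = a + b" "a \<in> keys f" "b \<in> keys (f ^ N)"
    using keys_mult[of f "f ^ N"] Suc.prems by auto
  have "a \<noteq> 0" using ab(2) assms(1) by (auto simp: face_ideal_def)
  then have "tdeg a \<noteq> 0" by (simp add: tdeg_eq_0_iff)
  then show ?case using Suc.IH[OF ab(3)] by (simp add: ab(1) tdeg_add)
qed auto

text \<open>A graded form of Krull's intersection theorem: multiples of \<open>f ^ N\<close> start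
  in degree \<open>N\<close>, so with \<open>N\<close> beyond all degrees of \<open>p\<close> every
  homogeneous component of \<open>p\<close> already lies in \<open>I\<close>.\<close>

lemma mem_of_powers:
  assumes "graded I" "ideal.subspace I" "f \<in> face_ideal {{}}"
    and powers: "\<And>N. \<exists>h. p - f ^ N * h \<in> I"
  shows "p \<in> I"
proof -
  define N where "N = Suc (\<Sum>m\<in>keys p. tdeg m)"
  have N: "tdeg m < N" if "m \<in> keys p" for m
    unfolding N_def using that member_le_sum[of m "keys p" tdeg] by simp
  obtain h where h: "p - f ^ N * h \<in> I" using powers by blast
  have "hcomp d p \<in> I" if "d < N" for d
  proof -
    have "lookup (f ^ N * h) m = 0" if "tdeg m = d" for m
    proof (rule ccontr)
      assume "\<not> ?thesis"
      then have "m \<in> keys (f ^ N * h)" by (simp add: in_keys_iff)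
      then obtain a b where ab: "m = a + b" "a \<in> keys (f ^ N)"
        using keys_mult[of "f ^ N" h] by auto
      have "N \<le> tdeg m" using tdeg_power[OF assms(3) ab(2)] by (simp add: ab(1) tdeg_add)
      with that \<open>d < N\<close> show False by simp
    qed
    then have "hcomp d (f ^ N * h) = 0"
      by (intro poly_mapping_eqI) (simp add: lookup_hcomp)
    then have "hcomp d (p - f ^ N * h) = hcomp d p" by (simp add: hcomp_diff)
    then show ?thesis using h assms(1) by (metis graded_def)
  qed
  then have "(\<Sum>d<N. hcomp d p) \<in> I" by (intro ideal.subspace_sum[OF assms(2)]) auto
  moreover have "(\<Sum>d<N. hcomp d p) = p" by (rule sum_hcomp) (rule N)
  ultimately show ?thesis by (simp only:)
qed

section \<open>Exchanging elements of a homogeneous regular sequence\<close>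

lemma non_zero_divisor_powers:
  fixes a :: "'r::comm_ring_1"
  assumes "\<And>g. a * g \<in> I \<Longrightarrow> g \<in> I"
  shows "a ^ N * g \<in> I \<Longrightarrow> g \<in> I"
proof (induction N)
  case (Suc N)
  then have "a * (a ^ N * g) \<in> I" by (simp add: mult.assoc)
  then have "a ^ N * g \<in> I" by (rule assms)
  then show ?case by (rule Suc.IH)
qed simp

text \<open>For the first claim \<open>g\<close> is divided by \<open>a\<close> again and again,
  which places it in \<open>I + (a ^ N)\<close> for every \<open>N\<close>; gradedness then puts it
  into \<open>I\<close>. The second claim is a syzygy computation.\<close>

lemma weakly_regular_swap:
  assumes I: "ideal.subspace I" "graded I" and a: "a \<in> face_ideal {{}}"
    and nzd_a: "\<And>g. a * g \<in> I \<Longrightarrow> g \<in> I"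
    and nzd_f: "\<And>g. f * g \<in> adjoin I a \<Longrightarrow> g \<in> adjoin I a"
  shows "f * g \<in> I \<Longrightarrow> g \<in> I" "a * g \<in> adjoin I f \<Longrightarrow> g \<in> adjoin I f"
proof -
  have nzd_f': "\<exists>h'. g - h' * a \<in> I" if "f * g - h * a \<in> I" for g h
    using nzd_f[of g] that unfolding mem_adjoin[OF I(1)] by blast
  show "g \<in> I" if fg: "f * g \<in> I"
  proof (rule mem_of_powers[OF I(2,1) a])
    fix N
    show "\<exists>h. g - a ^ N * h \<in> I"
    proof (induction N)
      case 0
      have "g - a ^ 0 * g \<in> I" using ideal.subspace_0[OF I(1)] by simp
      then show ?case by (rule exI)
    next
      case (Suc N)
      then obtain h where h: "g - a ^ N * h \<in> I" by (rule exE)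
      \<comment> \<open>Modulo \<open>I\<close> the factor \<open>a ^ N\<close> can be cancelled,
        and regularity of \<open>f\<close> modulo \<open>a\<close> then extracts one more factor
        \<open>a\<close> from \<open>h\<close>.\<close>
      have "a ^ N * (f * h) = f * g - f * (g - a ^ N * h)" by (simp add: algebra_simps)
      also have "\<dots> \<in> I"
        by (rule ideal.subspace_diff[OF I(1) fg ideal.subspace_scale[OF I(1) h]])
      finally have "f * h \<in> I"
        by (rule non_zero_divisor_powers[rotated]) (rule nzd_a)
      then obtain h' where h': "h - h' * a \<in> I" using nzd_f'[of h 0] by auto
      have "g - a ^ Suc N * h' = (g - a ^ N * h) + a ^ N * (h - h' * a)"
        by (simp add: algebra_simps)
      also have "\<dots> \<in> I"
        by (rule ideal.subspace_add[OF I(1) h ideal.subspace_scale[OF I(1) h']])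
      finally show ?case by (rule exI)
    qed
  qed
  show "g \<in> adjoin I f" if ag: "a * g \<in> adjoin I f"
  proof -
    obtain h where h: "a * g - h * f \<in> I"
      using mem_adjoin[OF I(1), THEN iffD1, OF ag] by (rule exE)
    have "f * h - g * a = (-1) * (a * g - h * f)" by (simp add: algebra_simps)
    also have "\<dots> \<in> I" by (rule ideal.subspace_scale[OF I(1) h])
    finally obtain h' where h': "h - h' * a \<in> I" using nzd_f'[of h g] by blast
    have "a * (g - h' * f) = (a * g - h * f) + f * (h - h' * a)" by (simp add: algebra_simps)
    also have "\<dots> \<in> I"
      by (rule ideal.subspace_add[OF I(1) h ideal.subspace_scale[OF I(1) h']])
    finally have "g - h' * f \<in> I" by (rule nzd_a)
    then show ?thesis unfolding mem_adjoin[OF I(1)] by (rule exI)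
  qed
qed

text \<open>Repeated exchange; homogeneity of each \<open>f\<close> keeps the growing ideal graded.
  On a simplex the top elementary symmetric polynomial is easiest to treat first, although it comes
  last in the sequence.\<close>

lemma weakly_regular_move_to_end:
  assumes "ideal.subspace I" "graded I" "a \<in> face_ideal {{}}"
    and "\<And>f. f \<in> set fs \<Longrightarrow> \<exists>e. \<forall>m\<in>keys f. tdeg m = e"
    and "weakly_regular I (a # fs)"
  shows "weakly_regular I (fs @ [a])"
  using assms(1,2,4,5)
proof (induction fs arbitrary: I)
  case (Cons f fs)
  note I = Cons.prems(1,2)
  have nzd: "\<And>g. a * g \<in> I \<Longrightarrow> g \<in> I" "\<And>g. f * g \<in> adjoin I a \<Longrightarrow> g \<in> adjoin I a"
    using Cons.prems(4) by simp_all
  note swap = weakly_regular_swap[OF I assms(3) nzd]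
  have "adjoin (adjoin I a) f = adjoin (adjoin I f) a"
    by (simp add: adjoin_span insert_commute)
  then have "weakly_regular (adjoin I f) (a # fs)"
    using Cons.prems(4) swap(2) by simp
  moreover obtain e where "\<forall>m\<in>keys f. tdeg m = e"
    using Cons.prems(3)[of f] by auto
  then have "graded (adjoin I f)"
    by (intro graded_adjoin[OF I, of f e]) blast
  moreover have "\<And>f'. f' \<in> set fs \<Longrightarrow> \<exists>e. \<forall>m\<in>keys f'. tdeg m = e"
    using Cons.prems(3) by simp
  ultimately have "weakly_regular (adjoin I f) (fs @ [a])"
    by (intro Cons.IH ideal.subspace_span)
  then show ?case using swap(1) by simp
qed simp

section \<open>Elementary symmetric polynomials as a universal sequence\<close>

definition esym :: "nat \<Rightarrow> ('x::finite, 'k::field) mpoly" where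
  "esym k = (\<Sum>S | card S = k. single (sq_monom S) 1)"

lemma keys_esym:
  assumes "m \<in> keys (esym k :: ('x::finite, 'k::field) mpoly)"
  shows "\<exists>S. m = sq_monom S \<and> card S = k"
proof -
  have "m \<in> (\<Union>S\<in>{S. card S = k}. keys (single (sq_monom S) (1::'k)))"
    using assms keys_sum[of "\<lambda>S. single (sq_monom S) (1::'k)" "{S. card S = k}"]
    unfolding esym_def by blast
  then show ?thesis by auto
qed

lemma sq_monom_eq_iff: "sq_monom S = sq_monom T \<longleftrightarrow> S = (T :: 'x::finite set)"
  by (metis keys_sq_monom)

lemma lookup_esym_sq_monom: "lookup (esym k) (sq_monom S) = (if card S = k then 1 else 0)"
  by (simp add: esym_def lookup_sum lookup_single when_def sq_monom_eq_iff)

lemma esym_irrelevant: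
  assumes "0 < k"
  shows "esym k \<in> face_ideal {{}}"
  unfolding face_ideal_def
proof (intro CollectI ballI)
  fix m assume "m \<in> keys (esym k)"
  then obtain S where "m = sq_monom S" "card S = k" using keys_esym by blast
  then show "keys m \<notin> {{}}" using assms by auto
qed

text \<open>All complexes are tested on initial segments of one sequence, formed in all variables of
  \<open>'x\<close> and not just in the vertices of \<open>\<Gamma>\<close>. It starts at 1 because
  \<open>esym 0\<close> is the unit.\<close>

definition esym_regular :: "'k::field itself \<Rightarrow> 'x::finite set set \<Rightarrow> nat \<Rightarrow> bool" where
  "esym_regular _ \<Gamma> k \<longleftrightarrow>
     weakly_regular (face_ideal \<Gamma> :: ('x, 'k) mpoly set) (map esym [1..<Suc k])"

lemma esym_regular_mono:
  assumes "esym_regular K \<Gamma> k" "j \<le> k"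
  shows "esym_regular K \<Gamma> j"
proof -
  have "[1..<Suc j + (k - j)] = [1..<Suc j] @ [Suc j..<Suc j + (k - j)]"
    by (rule upt_add_eq_append) simp
  then have "map f [1..<Suc k] = map f [1..<Suc j] @ map f [Suc j..<Suc k]" for f :: "nat \<Rightarrow> 'z"
    using assms(2) by simp
  then show ?thesis
    using assms(1) weakly_regular_append_left unfolding esym_regular_def by metis
qed

lemma esym_regular_0 [simp]: "esym_regular K \<Gamma> 0"
  by (simp add: esym_regular_def)

lemma esym_regular_empty [simp]: "esym_regular K {} k"
  by (simp add: esym_regular_def weakly_regular_UNIV)

lemma span_face_ideal_Un:
  assumes "simplicial_complex \<Gamma>" "simplicial_complex \<Gamma>'"
  shows "ideal.span (face_ideal \<Gamma> \<union> face_ideal \<Gamma>') =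
    (face_ideal (\<Gamma> \<inter> \<Gamma>') :: ('x, 'k::field) mpoly set)"
proof
  have "simplicial_complex (\<Gamma> \<inter> \<Gamma>')"
    using assms by (auto simp: simplicial_complex_def)
  then show "ideal.span (face_ideal \<Gamma> \<union> face_ideal \<Gamma>') \<subseteq> (face_ideal (\<Gamma> \<inter> \<Gamma>') :: ('x, 'k) mpoly set)"
    by (intro ideal.span_minimal subspace_face_ideal) (auto simp: face_ideal_def)
  show "(face_ideal (\<Gamma> \<inter> \<Gamma>') :: ('x, 'k) mpoly set) \<subseteq> ideal.span (face_ideal \<Gamma> \<union> face_ideal \<Gamma>')"
  proof
    fix p :: "('x, 'k) mpoly" assume "p \<in> face_ideal (\<Gamma> \<inter> \<Gamma>')"
    then obtain q r where "p = q + r" "q \<in> face_ideal \<Gamma>" "r \<in> face_ideal \<Gamma>'"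
      by (rule face_ideal_Int_split)
    then show "p \<in> ideal.span (face_ideal \<Gamma> \<union> face_ideal \<Gamma>')"
      by (auto intro!: ideal.span_add intro: ideal.span_base)
  qed
qed

text \<open>The depth lemma \<open>weakly_regular_Int\<close> for complexes: intersection and sum of
  face ideals belong to union and intersection of complexes, and \<open>butlast\<close> becomes
  \<open>k - 1\<close>.\<close>

lemma esym_regular_Un:
  assumes sc: "simplicial_complex \<Gamma>" "simplicial_complex \<Gamma>'"
    and "esym_regular K \<Gamma> k" "esym_regular K \<Gamma>' k" "esym_regular K (\<Gamma> \<inter> \<Gamma>') (k - 1)"
  shows "esym_regular K (\<Gamma> \<union> \<Gamma>') k"
proof (cases k)
  case (Suc k')
  show ?thesis
    using assms unfolding esym_regular_def face_ideal_Un
    by (intro weakly_regular_Int subspace_face_ideal)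
      (auto simp: span_face_ideal_Un[OF sc] Suc simp flip: map_butlast)
qed auto

text \<open>A squarefree monomial of degree \<open>card F\<close> supported in \<open>F\<close> must
  be that of \<open>F\<close>, so \<open>esym (card F)\<close> is this monomial modulo
  \<open>face_ideal (Pow F)\<close>. The right-hand side is the boundary of the simplex, written as
  a punctured simplex with \<open>S = F\<close>.\<close>

lemma adjoin_face_ideal_Pow_esym:
  "adjoin (face_ideal (Pow F)) (esym (card F)) =
    (face_ideal {H. H \<subseteq> F \<and> \<not> F \<subseteq> H} :: ('x::finite, 'k::field) mpoly set)"
proof
  have sc: "simplicial_complex {H. H \<subseteq> F \<and> \<not> F \<subseteq> H}" by (auto simp: simplicial_complex_def)
  have "esym (card F) \<in> (face_ideal {H. H \<subseteq> F \<and> \<not> F \<subseteq> H} :: ('x, 'k) mpoly set)"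
    unfolding face_ideal_def
  proof (intro CollectI ballI)
    fix m assume "m \<in> keys (esym (card F) :: ('x, 'k) mpoly)"
    then obtain S where S: "m = sq_monom S" "card S = card F" using keys_esym by blast
    then show "keys m \<notin> {H. H \<subseteq> F \<and> \<not> F \<subseteq> H}"
      using card_subset_eq[of F S] by auto
  qed
  then show "adjoin (face_ideal (Pow F)) (esym (card F)) \<subseteq>
      (face_ideal {H. H \<subseteq> F \<and> \<not> F \<subseteq> H} :: ('x, 'k) mpoly set)"
    by (intro ideal.span_minimal subspace_face_ideal[OF sc]) (auto simp: face_ideal_def)
  let ?J = "adjoin (face_ideal (Pow F)) (esym (card F)) :: ('x, 'k) mpoly set"
  have "esym (card F) - single (sq_monom F) 1 \<in> (face_ideal (Pow F) :: ('x, 'k) mpoly set)"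
    unfolding face_ideal_iff_lookup
  proof (intro allI impI)
    fix m :: "'x \<Rightarrow>\<^sub>0 nat" assume m: "keys m \<in> Pow F"
    show "lookup (esym (card F) - single (sq_monom F) (1::'k)) m = 0"
    proof (cases "m \<in> keys (esym (card F) :: ('x, 'k) mpoly)")
      case True
      then obtain S where S: "m = sq_monom S" "card S = card F" using keys_esym by blast
      with m have "S = F" by (simp add: card_subset_eq)
      with S show ?thesis by (simp add: lookup_minus lookup_esym_sq_monom)
    next
      case False
      then have "m \<noteq> sq_monom F"
        by (auto simp: in_keys_iff lookup_esym_sq_monom)
      with False show ?thesis by (simp add: lookup_minus lookup_single in_keys_iff)
    qed
  qed
  then have "esym (card F) - (esym (card F) - single (sq_monom F) 1) \<in> ?J"
    by - (rule ideal.span_diff[OF ideal.span_base ideal.span_base], auto)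
  then have xF: "single (sq_monom F) 1 \<in> ?J" by simp
  show "(face_ideal {H. H \<subseteq> F \<and> \<not> F \<subseteq> H} :: ('x, 'k) mpoly set) \<subseteq> ?J"
  proof
    fix p :: "('x, 'k) mpoly" assume p: "p \<in> face_ideal {H. H \<subseteq> F \<and> \<not> F \<subseteq> H}"
    have "single m (lookup p m) \<in> ?J" if "m \<in> keys p" for m
    proof (cases "keys m \<subseteq> F")
      case True
      then have "F \<subseteq> keys m" using p that by (auto simp: face_ideal_def)
      then have "m = m - sq_monom F + sq_monom F"
        by (intro poly_mapping_eqI) (auto simp: lookup_add lookup_minus in_keys_iff)
      then have "single m (lookup p m) = single (m - sq_monom F) (lookup p m) * single (sq_monom F) 1"
        by (metis mult_single mult.right_neutral)
      then show ?thesis using xF by (simp only: ideal.span_scale)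
    next
      case False
      then show ?thesis by (auto intro!: ideal.span_base single_in_face_ideal)
    qed
    then have "(\<Sum>m\<in>keys p. single m (lookup p m)) \<in> ?J" by (intro ideal.span_sum)
    then show "p \<in> ?J" by (simp add: sum_single_lookup)
  qed
qed

text \<open>The two statements feed each other. Adjoining the top polynomial reduces a simplex to
  its boundary; the boundary is the union of the simplices \<open>Pow (F - {v})\<close>, glued one
  at a time along punctured simplices on \<open>F - {v}\<close>. The set \<open>S\<close> lists the
  vertices whose opposite simplices have been added.\<close>

lemma esym_regular_simplex_aux:
  fixes F :: "'x::finite set"
  shows "esym_regular (K :: 'k::field itself) (Pow F) (card F) \<and>
    (\<forall>S\<subseteq>F. esym_regular K {H. H \<subseteq> F \<and> \<not> S \<subseteq> H} (card F - 1))"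
proof (induction "card F" arbitrary: F rule: less_induct)
  case (less F)
  have punctured: "esym_regular K {H. H \<subseteq> F \<and> \<not> S \<subseteq> H} (card F - 1)" if "S \<subseteq> F" for S
  proof -
    have "finite S" by simp
    then show ?thesis using that
    proof (induction S rule: finite_induct)
      case (insert v S)
      have "v \<in> F" using insert.prems by simp
      then have card: "card (F - {v}) = card F - 1" "card (F - {v}) < card F"
        by (simp add: card_Diff_singleton, intro card_Diff1_less) auto
      have 1: "{H. H \<subseteq> F \<and> \<not> insert v S \<subseteq> H} = Pow (F - {v}) \<union> {H. H \<subseteq> F \<and> \<not> S \<subseteq> H}"
        by auto
      have 2: "Pow (F - {v}) \<inter> {H. H \<subseteq> F \<and> \<not> S \<subseteq> H} = {H. H \<subseteq> F - {v} \<and> \<not> S \<subseteq> H}"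
        by auto
      have "S \<subseteq> F - {v}" using insert by auto
      show ?case
        unfolding 1
      proof (rule esym_regular_Un)
        show "esym_regular K (Pow (F - {v})) (card F - 1)"
          "esym_regular K (Pow (F - {v}) \<inter> {H. H \<subseteq> F \<and> \<not> S \<subseteq> H}) (card F - 1 - 1)"
          using less[OF card(2)] \<open>S \<subseteq> F - {v}\<close> unfolding 2 card(1) by blast+
        show "esym_regular K {H. H \<subseteq> F \<and> \<not> S \<subseteq> H} (card F - 1)"
          using insert by blast
      qed (auto simp: simplicial_complex_def)
    qed auto
  qed
  have "esym_regular K (Pow F) (card F)"
  proof (cases "card F")
    case (Suc k)
    let ?I = "face_ideal (Pow F) :: ('x, 'k) mpoly set"
    let ?a = "esym (card F) :: ('x, 'k) mpoly"
    \<comment> \<open>The quotient is a domain, so every element outside the ideal is a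
      non-zero-divisor. Beginning with the top polynomial makes the next quotient a face ring
      again.\<close>
    have prime: "prime_ideal ?I" by (rule prime_ideal_face_ideal_Pow)
    have "lookup ?a (sq_monom F) \<noteq> 0" by (simp add: lookup_esym_sq_monom)
    then have "?a \<notin> ?I" using lookup_face_ideal[of ?a "Pow F" "sq_monom F"] by auto
    then have "\<forall>g. ?a * g \<in> ?I \<longrightarrow> g \<in> ?I" using prime by (auto simp: prime_ideal_def)
    moreover have "weakly_regular (adjoin ?I ?a) (map esym [1..<card F])"
      unfolding adjoin_face_ideal_Pow_esym
      using punctured[of F] Suc by (simp add: esym_regular_def)
    ultimately have "weakly_regular ?I (?a # map esym [1..<card F])" by simp
    moreover have "\<exists>e. \<forall>m\<in>keys f. tdeg m = e"
      if "f \<in> set (map esym [1..<card F])" for f :: "('x, 'k) mpoly"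
      using that by (auto, metis keys_esym tdeg_sq_monom)
    ultimately have "weakly_regular ?I (map esym [1..<card F] @ [?a])"
      using prime Suc
      by (intro weakly_regular_move_to_end graded_face_ideal esym_irrelevant)
        (auto simp: prime_ideal_def)
    then show ?thesis by (simp add: esym_regular_def Suc)
  qed auto
  with punctured show ?case by auto
qed

lemma esym_regular_Pow: "esym_regular K (Pow F) (card F)"
  using esym_regular_simplex_aux by blast

lemma esym_regular_punctured:
  "S \<subseteq> F \<Longrightarrow> esym_regular K {H. H \<subseteq> F \<and> \<not> S \<subseteq> H} (card F - 1)"
  using esym_regular_simplex_aux by blast

text \<open>The non-degeneracy condition is recovered here: the empty face puts
  \<open>face_ideal \<Gamma>\<close> inside the irrelevant ideal, which also contains the
  sequence.\<close>

lemma regular_seq_esym: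
  assumes sc: "simplicial_complex \<Gamma>" and ne: "\<Gamma> \<noteq> {}"
    and reg: "esym_regular TYPE('k::field) \<Gamma> k"
  shows "\<exists>fs. set fs \<subseteq> irrelevant_ideal \<and> length fs = k \<and>
    regular_seq (face_ideal \<Gamma> :: ('x::finite, 'k) mpoly set) fs"
proof (intro exI conjI)
  let ?fs = "map esym [1..<Suc k] :: ('x, 'k) mpoly list"
  show fs: "set ?fs \<subseteq> irrelevant_ideal"
    by (auto simp: irrelevant_ideal_eq intro!: esym_irrelevant)
  have "{} \<in> \<Gamma>" using sc ne by (auto simp: simplicial_complex_def)
  then have "(face_ideal \<Gamma> :: ('x, 'k) mpoly set) \<subseteq> face_ideal {{}}"
    by (auto simp: face_ideal_def)
  moreover have "simplicial_complex {{} :: 'x set}" by (simp add: simplicial_complex_def)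
  ultimately have "ideal.span (face_ideal \<Gamma> \<union> set ?fs) \<subseteq> (face_ideal {{}} :: ('x, 'k) mpoly set)"
    using fs unfolding irrelevant_ideal_eq by (intro ideal.span_minimal subspace_face_ideal) auto
  moreover have "(1 :: ('x, 'k) mpoly) \<notin> face_ideal {{}}" by (simp add: face_ideal_def)
  ultimately have "1 \<notin> ideal.span (face_ideal \<Gamma> \<union> set ?fs)" by blast
  then show "regular_seq (face_ideal \<Gamma> :: ('x, 'k) mpoly set) ?fs"
    using reg by (simp add: regular_seq_iff subspace_face_ideal sc esym_regular_def)
qed simp

section \<open>Krull dimension of coordinate subspaces\<close>

text \<open>Gaussian elimination: the equation \<open>b\<close> is solved for the unknown
  \<open>a0\<close>, and the induction hypothesis is applied to the system after
  substitution.\<close>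

lemma homogeneous_system_nontrivial_solution:
  fixes M :: "'a \<Rightarrow> 'b \<Rightarrow> 'k::field"
  assumes "finite B" "finite A" "card B < card A"
  shows "\<exists>c. (\<exists>a\<in>A. c a \<noteq> 0) \<and> (\<forall>b\<in>B. (\<Sum>a\<in>A. c a * M a b) = 0)"
  using assms
proof (induction B arbitrary: A M rule: finite_induct)
  case empty
  then have "A \<noteq> {}" by auto
  then show ?case by (intro exI[of _ "\<lambda>_. 1"]) auto
next
  case (insert b B)
  show ?case
  proof (cases "\<forall>a\<in>A. M a b = 0")
    case True
    have "card B < card A" using insert by simp
    then obtain c where "\<exists>a\<in>A. c a \<noteq> 0" "\<forall>b\<in>B. (\<Sum>a\<in>A. c a * M a b) = 0"
      using insert.IH[of A M] insert.prems(1) by blast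
    with True show ?thesis by (intro exI[of _ c]) auto
  next
    case False
    then obtain a0 where a0: "a0 \<in> A" "M a0 b \<noteq> 0" by blast
    define A' where "A' = A - {a0}"
    have A': "finite A'" "a0 \<notin> A'" "A = insert a0 A'"
      using insert.prems a0 by (auto simp: A'_def)
    then have "card B < card A'" using insert by simp
    then obtain c' where c': "\<exists>a\<in>A'. c' a \<noteq> 0"
      "\<forall>b'\<in>B. (\<Sum>a\<in>A'. c' a * (M a b' - M a b / M a0 b * M a0 b')) = 0"
      using insert.IH[of A' "\<lambda>a b'. M a b' - M a b / M a0 b * M a0 b'"] A'(1) by blast
    define c where "c a = (if a = a0 then - (\<Sum>a\<in>A'. c' a * M a b) / M a0 b else c' a)" for a
    have sum: "(\<Sum>a\<in>A. c a * M a b') = c a0 * M a0 b' + (\<Sum>a\<in>A'. c' a * M a b')" for b'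
    proof -
      have "(\<Sum>a\<in>A'. c a * M a b') = (\<Sum>a\<in>A'. c' a * M a b')"
        using A'(2) by (intro sum.cong) (auto simp: c_def)
      then show ?thesis using A' by simp
    qed
    have "(\<Sum>a\<in>A. c a * M a b) = 0"
      unfolding sum using a0 by (simp add: c_def)
    moreover have "(\<Sum>a\<in>A. c a * M a b') = 0" if "b' \<in> B" for b'
    proof -
      have "0 = (\<Sum>a\<in>A'. c' a * (M a b' - M a b / M a0 b * M a0 b'))" using c'(2) that by simp
      also have "\<dots> = (\<Sum>a\<in>A'. c' a * M a b') - (\<Sum>a\<in>A'. c' a * M a b * (M a0 b' / M a0 b))"
        by (simp add: right_diff_distrib sum_subtractf mult.assoc)
      also have "\<dots> = (\<Sum>a\<in>A'. c' a * M a b') - (\<Sum>a\<in>A'. c' a * M a b) * (M a0 b' / M a0 b)"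
        by (simp only: sum_distrib_right)
      finally show ?thesis unfolding sum by (simp add: c_def)
    qed
    moreover have "\<exists>a\<in>A. c a \<noteq> 0" using c'(1) A' by (auto simp: c_def)
    ultimately show ?thesis by (intro exI[of _ c]) simp
  qed
qed

section \<open>Algebraic relations and the length of prime chains\<close>

fun eval_monom :: "'r::comm_ring_1 list \<Rightarrow> nat list \<Rightarrow> 'r" where
  "eval_monom (f # fs) (e # es) = f ^ e * eval_monom fs es"
| "eval_monom _ _ = 1"

text \<open>With separate exponents bounded instead of the total degree, monomials supported in
  \<open>F\<close> are counted as functions from \<open>F\<close> to an interval.\<close>

definition exponents_le :: "nat \<Rightarrow> ('x, 'k::field) mpoly \<Rightarrow> bool" where
  "exponents_le N p \<longleftrightarrow> (\<forall>m\<in>keys p. \<forall>i. lookup m i \<le> N)"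

lemma exponents_le_1 [simp]: "exponents_le N 1"
  by (simp add: exponents_le_def)

lemma exponents_le_mult:
  assumes "exponents_le M p" "exponents_le N q"
  shows "exponents_le (M + N) (p * q)"
  unfolding exponents_le_def
proof (intro ballI allI)
  fix m i assume "m \<in> keys (p * q)"
  then obtain a b where "m = a + b" "a \<in> keys p" "b \<in> keys q" using keys_mult[of p q] by blast
  then show "lookup m i \<le> M + N"
    using assms by (auto simp: exponents_le_def lookup_add intro!: add_mono)
qed

lemma exponents_le_mono: "exponents_le M p \<Longrightarrow> M \<le> N \<Longrightarrow> exponents_le N p"
  unfolding exponents_le_def using le_trans by blast

lemma exponents_le_power: "exponents_le M p \<Longrightarrow> exponents_le (e * M) (p ^ e)"
  by (induction e) (auto dest: exponents_le_mult)

lemma exponents_le_exists: "\<exists>N. exponents_le N (p :: ('x::finite, 'k::field) mpoly)"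
proof -
  have "lookup m i \<le> (\<Sum>m\<in>keys p. \<Sum>i\<in>UNIV. lookup m i)" if "m \<in> keys p" for m i
  proof -
    have "lookup m i \<le> (\<Sum>i\<in>UNIV. lookup m i)" by (intro member_le_sum) auto
    also have "\<dots> \<le> (\<Sum>m\<in>keys p. \<Sum>i\<in>UNIV. lookup m i)" using that by (intro member_le_sum) auto
    finally show ?thesis .
  qed
  then show ?thesis unfolding exponents_le_def by blast
qed

lemma exponents_le_eval_monom:
  assumes "\<And>f. f \<in> set fs \<Longrightarrow> exponents_le D f" "\<And>e. e \<in> set es \<Longrightarrow> e \<le> N"
  shows "exponents_le (length fs * (N * D)) (eval_monom fs es)"
  using assms
proof (induction fs es rule: eval_monom.induct)
  case (1 f fs e es)
  have "exponents_le (e * D) (f ^ e)" using 1 by (intro exponents_le_power) auto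
  then have "exponents_le (N * D) (f ^ e)"
    using 1(3)[of e] by (auto elim!: exponents_le_mono)
  then show ?case using exponents_le_mult 1 by fastforce
qed auto

lemma card_bounded_monomials:
  fixes F :: "'x::finite set"
  shows "finite {m :: 'x \<Rightarrow>\<^sub>0 nat. keys m \<subseteq> F \<and> (\<forall>i. lookup m i \<le> E)}"
    and "card {m :: 'x \<Rightarrow>\<^sub>0 nat. keys m \<subseteq> F \<and> (\<forall>i. lookup m i \<le> E)} \<le> (E + 1) ^ card F"
proof -
  let ?B = "{m :: 'x \<Rightarrow>\<^sub>0 nat. keys m \<subseteq> F \<and> (\<forall>i. lookup m i \<le> E)}"
  have inj: "inj_on (\<lambda>m. restrict (lookup m) F) ?B"
  proof (rule inj_onI)
    fix a b assume ab: "a \<in> ?B" "b \<in> ?B" and eq: "restrict (lookup a) F = restrict (lookup b) F"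
    show "a = b"
    proof (rule poly_mapping_eqI)
      fix i
      show "lookup a i = lookup b i"
      proof (cases "i \<in> F")
        case True
        then show ?thesis using fun_cong[OF eq, of i] by simp
      next
        case False
        then have "i \<notin> keys a" "i \<notin> keys b" using ab by auto
        then show ?thesis by (simp add: in_keys_iff)
      qed
    qed
  qed
  have img: "(\<lambda>m. restrict (lookup m) F) ` ?B \<subseteq> PiE F (\<lambda>_. {..E})" by auto
  have fin: "finite (PiE F (\<lambda>_. {..E}))" by (intro finite_PiE) auto
  show "finite ?B" using inj_on_finite[OF inj img fin] .
  have "card ?B \<le> card (PiE F (\<lambda>_. {..E}))" using card_inj_on_le[OF inj img fin] .
  then show "card ?B \<le> (E + 1) ^ card F" by (simp add: card_PiE)
qed

lemma lookup_const_mult: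
  fixes p :: "('x, 'k::field) mpoly"
  shows "lookup (single 0 c * p) m = c * lookup p m"
  using lookup_single_mult[of 0 c p m] by simp

text \<open>
  There are \<open>(N + 1)\<^sup>d\<close> monomials in \<open>fs\<close> with exponents at most \<open>N\<close>, and modulo the ideal they
  lie in a space of dimension \<open>O(N ^ card F)\<close>.
\<close>

lemma algebraic_relation_exists:
  fixes fs :: "('x::finite, 'k::field) mpoly list"
  assumes "card F < length fs"
  shows "\<exists>A c. finite A \<and> A \<noteq> {} \<and> (\<forall>es\<in>A. length es = length fs \<and> c es \<noteq> 0) \<and>
    (\<Sum>es\<in>A. single 0 (c es) * eval_monom fs es) \<in> face_ideal (Pow F)"
proof -
  define d where "d = length fs"
  obtain D where D: "\<And>f. f \<in> set fs \<Longrightarrow> exponents_le D f"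
  proof -
    obtain g where g: "\<And>f :: ('x, 'k) mpoly. exponents_le (g f) f" using exponents_le_exists by metis
    have "exponents_le (\<Sum>f\<in>set fs. g f) f" if "f \<in> set fs" for f
      using exponents_le_mono[OF g[of f]] member_le_sum[of f "set fs" g] that by auto
    then show ?thesis using that by blast
  qed
  \<comment> \<open>Exponents in \<open>fs\<close> are at most \<open>D\<close>, so products with
    powers up to \<open>N\<close> have exponents at most \<open>E = d * (N * D)\<close>. Taking
    \<open>N\<close> to be the constant factor \<open>(d * D + 1) ^ card F\<close> bounds the number
    of equations by \<open>N * (N + 1) ^ card F\<close>, below the number of unknowns.\<close>
  define N where "N = (d * D + 1) ^ card F"
  define E where "E = d * (N * D)"
  define B where "B = {m :: 'x \<Rightarrow>\<^sub>0 nat. keys m \<subseteq> F \<and> (\<forall>i. lookup m i \<le> E)}"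
  define L where "L = {es. set es \<subseteq> {..N} \<and> length es = d}"
  have "card B \<le> (E + 1) ^ card F" unfolding B_def by (rule card_bounded_monomials)
  also have "\<dots> \<le> ((d * D + 1) * (N + 1)) ^ card F"
    by (intro power_mono) (auto simp: E_def algebra_simps)
  also have "\<dots> = N * (N + 1) ^ card F" by (simp only: power_mult_distrib N_def)
  also have "\<dots> < (N + 1) ^ Suc (card F)" by simp
  also have "\<dots> \<le> (N + 1) ^ d" using assms by (intro power_increasing) (auto simp: d_def)
  also have "\<dots> = card L" by (simp add: L_def card_lists_length_eq)
  finally have "card B < card L" .
  moreover have "finite B" unfolding B_def by (rule card_bounded_monomials)
  moreover have "finite L" unfolding L_def by (intro finite_lists_length_eq) auto
  ultimately obtain c where c: "\<exists>es\<in>L. c es \<noteq> 0"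
    "\<forall>m\<in>B. (\<Sum>es\<in>L. c es * lookup (eval_monom fs es) m) = 0"
    using homogeneous_system_nontrivial_solution[of B L "\<lambda>es. lookup (eval_monom fs es)"] by blast
  \<comment> \<open>Zero coefficients are discarded so that the least monomial of the relation
    really occurs in it.\<close>
  define A where "A = {es\<in>L. c es \<noteq> 0}"
  have "(\<Sum>es\<in>A. single 0 (c es) * eval_monom fs es) \<in> face_ideal (Pow F)"
    unfolding face_ideal_iff_lookup
  proof (intro allI impI)
    fix m :: "'x \<Rightarrow>\<^sub>0 nat" assume m: "keys m \<in> Pow F"
    have "lookup (\<Sum>es\<in>A. single 0 (c es) * eval_monom fs es) m
        = (\<Sum>es\<in>A. c es * lookup (eval_monom fs es) m)"
      by (simp add: lookup_sum lookup_const_mult)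
    also have "\<dots> = (\<Sum>es\<in>L. c es * lookup (eval_monom fs es) m)"
      unfolding A_def using \<open>finite L\<close> by (intro sum.mono_neutral_left) auto
    also have "\<dots> = 0"
    proof (cases "m \<in> B")
      case False
      have "lookup (eval_monom fs es) m = 0" if "es \<in> L" for es
      proof -
        have "exponents_le E (eval_monom fs es)"
          unfolding E_def d_def using that D by (intro exponents_le_eval_monom) (auto simp: L_def)
        then show ?thesis
          using False m unfolding B_def exponents_le_def by (auto simp: in_keys_iff)
      qed
      then show ?thesis by simp
    qed (use c(2) in auto)
    finally show "lookup (\<Sum>es\<in>A. single 0 (c es) * eval_monom fs es) m = 0" .
  qed
  moreover have "finite A" "A \<noteq> {}" using c(1) \<open>finite L\<close> by (auto simp: A_def)
  moreover have "\<forall>es\<in>A. length es = length fs \<and> c es \<noteq> 0" by (auto simp: A_def L_def d_def)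
  ultimately show ?thesis by blast
qed

text \<open>Strictness of each inclusion is recorded by a witness \<open>f\<close>; these witnesses
  are the elements to which the algebraic relation is applied.\<close>

fun separated_chain :: "'r::comm_ring_1 set \<Rightarrow> 'r set list \<Rightarrow> 'r list \<Rightarrow> bool" where
  "separated_chain P [] [] \<longleftrightarrow> prime_ideal P"
| "separated_chain P (Q # Qs) (f # fs) \<longleftrightarrow>
     prime_ideal P \<and> P \<subseteq> Q \<and> f \<in> Q \<and> f \<notin> P \<and> separated_chain Q Qs fs"
| "separated_chain _ _ _ \<longleftrightarrow> False"

lemma separated_chain_length: "separated_chain P Qs fs \<Longrightarrow> length fs = length Qs"
  by (induction P Qs fs rule: separated_chain.induct) auto

lemma separated_chain_prime: "separated_chain P Qs fs \<Longrightarrow> prime_ideal P"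
  by (cases Qs; cases fs) auto

lemma separated_chain_exists:
  assumes "sorted_wrt (\<subset>) (P # Qs)" "\<forall>Q\<in>set (P # Qs). prime_ideal Q"
  shows "\<exists>fs. separated_chain P Qs fs"
  using assms
proof (induction Qs arbitrary: P)
  case Nil
  then show ?case by (intro exI[of _ "[]"]) simp
next
  case (Cons Q Qs)
  then obtain fs where "separated_chain Q Qs fs" by (metis list.set_intros(2) sorted_wrt.simps(2))
  moreover obtain f where "f \<in> Q" "f \<notin> P" using Cons.prems by auto
  ultimately have "separated_chain P (Q # Qs) (f # fs)" using Cons.prems by auto
  then show ?case by blast
qed

lemma prime_ideal_power: "prime_ideal P \<Longrightarrow> f ^ n * g \<in> P \<Longrightarrow> f \<notin> P \<Longrightarrow> g \<in> P"
  by (induction n) (auto simp: prime_ideal_def mult.assoc)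

text \<open>
  The lexicographically smallest monomial of a relation survives: the least power of \<open>f\<close> can be
  cancelled modulo \<open>P\<close>, and the remaining terms divisible by \<open>f\<close> vanish modulo the next prime.
\<close>

lemma separated_chain_no_relation:
  fixes fs :: "('x::finite, 'k::field) mpoly list"
  assumes "separated_chain P Qs fs" "finite A" "A \<noteq> {}"
    and "\<forall>es\<in>A. length es = length fs \<and> c es \<noteq> 0"
    and "(\<Sum>es\<in>A. single 0 (c es) * eval_monom fs es) \<in> P"
  shows False
  using assms
proof (induction P Qs fs arbitrary: A c rule: separated_chain.induct)
  case (1 P)
  then have "A = {[]}" by auto
  then have "single 0 (c []) \<in> P" and "c [] \<noteq> 0" using 1 by auto
  then have "single 0 (inverse (c [])) * single 0 (c []) \<in> P"
    using 1 by (auto simp: prime_ideal_def intro!: ideal.subspace_scale)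
  then have "1 \<in> P" using \<open>c [] \<noteq> 0\<close> by (simp add: mult_single)
  then show False using 1 by (simp add: prime_ideal_def)
next
  case (2 P Q Qs f fs)
  define m where "m = Min (hd ` A)"
  have "m \<in> hd ` A" unfolding m_def using "2.prems" by (intro Min_in) auto
  have m_le: "m \<le> hd es" if "es \<in> A" for es
    unfolding m_def using "2.prems" that by (intro Min_le) auto
  define A0 where "A0 = {es\<in>A. hd es = m}"
  have A0: "finite A0" "A0 \<noteq> {}" "A0 \<subseteq> A"
    using "2.prems" \<open>m \<in> hd ` A\<close> by (auto simp: A0_def)
  let ?t = "\<lambda>es. single 0 (c es) * (f ^ (hd es - m) * eval_monom fs (tl es))"
  have summand: "single 0 (c es) * eval_monom (f # fs) es = f ^ m * ?t es" if "es \<in> A" for es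
  proof -
    have "length es = Suc (length fs)" using "2.prems"(4) \<open>es \<in> A\<close> by simp
    then obtain e es' where es: "es = e # es'" by (cases es) auto
    have "f ^ e = f ^ m * f ^ (e - m)" using m_le[OF \<open>es \<in> A\<close>] by (simp add: es flip: power_add)
    then show ?thesis by (simp add: es ac_simps)
  qed
  have Q: "prime_ideal Q" using "2.prems"(1) by (auto intro: separated_chain_prime)
  then have subQ: "ideal.subspace Q" by (simp add: prime_ideal_def)
  have "(\<Sum>es\<in>A. single 0 (c es) * eval_monom (f # fs) es) = (\<Sum>es\<in>A. f ^ m * ?t es)"
    by (intro sum.cong refl summand)
  also have "\<dots> = f ^ m * (\<Sum>es\<in>A. ?t es)" by (simp only: sum_distrib_left)
  finally have "(\<Sum>es\<in>A. single 0 (c es) * eval_monom (f # fs) es) = f ^ m * (\<Sum>es\<in>A. ?t es)" .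
  then have "(\<Sum>es\<in>A. ?t es) \<in> P"
    using "2.prems" prime_ideal_power[of P f m "\<Sum>es\<in>A. ?t es"] by auto
  then have inQ: "(\<Sum>es\<in>A. ?t es) \<in> Q" using "2.prems" by auto
  have "(\<Sum>es\<in>A - A0. ?t es) \<in> Q"
  proof (rule ideal.subspace_sum[OF subQ])
    fix es assume "es \<in> A - A0"
    then have "hd es - m = Suc (hd es - m - 1)" using m_le[of es] by (auto simp: A0_def)
    then have "f ^ (hd es - m) = f ^ (hd es - m - 1) * f" by (metis power_Suc2)
    then have "?t es = (single 0 (c es) * f ^ (hd es - m - 1) * eval_monom fs (tl es)) * f"
      by (simp only: ac_simps)
    moreover have "f \<in> Q" using "2.prems"(1) by simp
    ultimately show "?t es \<in> Q" by (simp only: ideal.subspace_scale[OF subQ])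
  qed
  then have "(\<Sum>es\<in>A. ?t es) - (\<Sum>es\<in>A - A0. ?t es) \<in> Q"
    by (rule ideal.subspace_diff[OF subQ inQ])
  moreover have "(\<Sum>es\<in>A. ?t es) = (\<Sum>es\<in>A - A0. ?t es) + (\<Sum>es\<in>A0. ?t es)"
    using "2.prems" A0 by (intro sum.subset_diff) auto
  ultimately have "(\<Sum>es\<in>A0. ?t es) \<in> Q" by simp
  have cons: "m # tl es = es" if "es \<in> A0" for es
    using that "2.prems" by (cases es) (auto simp: A0_def)
  \<comment> \<open>All lists in \<open>A0\<close> share the head \<open>m\<close>, so dropping it
    merges no two terms.\<close>
  have inj: "inj_on tl A0" by (rule inj_onI) (metis cons)
  have "(\<Sum>es\<in>A0. ?t es) = (\<Sum>es\<in>A0. single 0 (c (m # tl es)) * eval_monom fs (tl es))"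
    by (intro sum.cong) (auto simp: cons A0_def)
  also have "\<dots> = (\<Sum>es\<in>tl ` A0. single 0 (c (m # es)) * eval_monom fs es)"
    by (simp add: sum.reindex[OF inj])
  finally have "(\<Sum>es\<in>tl ` A0. single 0 (c (m # es)) * eval_monom fs es) \<in> Q"
    using \<open>(\<Sum>es\<in>A0. ?t es) \<in> Q\<close> by simp
  moreover have "\<forall>es\<in>tl ` A0. length es = length fs \<and> c (m # es) \<noteq> 0"
    using cons A0(3) "2.prems"(4) by (metis Suc_inject imageE length_Cons subsetD)
  ultimately show False
    using "2.prems"(1) A0
    by - (rule "2.IH"[of "tl ` A0" "\<lambda>es. c (m # es)"], auto)
qed auto

text \<open>An elementary transcendence degree bound: too long a chain has more than
  \<open>card F\<close> separating elements. They satisfy a relation modulo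
  \<open>face_ideal (Pow F)\<close>, hence modulo the lowest prime, where none can hold.\<close>

lemma krull_dim_face_ideal_Pow_le:
  "krull_dim (face_ideal (Pow F) :: ('x::finite, 'k::field) mpoly set) \<le> enat (card F)"
  unfolding krull_dim_def
proof (rule Sup_least, clarify)
  fix Ps :: "('x, 'k) mpoly set list"
  assume Ps: "Ps \<noteq> []" "sorted_wrt (\<subset>) Ps"
    "\<forall>P\<in>set Ps. prime_ideal P \<and> face_ideal (Pow F) \<subseteq> P"
  obtain P Qs where PQ: "Ps = P # Qs" using Ps(1) by (cases Ps) auto
  obtain fs where fs: "separated_chain P Qs fs"
    using separated_chain_exists[of P Qs] Ps by (auto simp: PQ simp del: sorted_wrt.simps)
  have "\<not> card F < length fs"
  proof
    assume "card F < length fs"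
    from algebraic_relation_exists[OF this] obtain A c
      where A: "finite A" "A \<noteq> {}" "\<forall>es\<in>A. length es = length fs \<and> c es \<noteq> 0"
      and rel: "(\<Sum>es\<in>A. single 0 (c es) * eval_monom fs es) \<in> face_ideal (Pow F)"
      by (elim exE conjE)
    have "face_ideal (Pow F) \<subseteq> P" using Ps by (simp add: PQ)
    then have "(\<Sum>es\<in>A. single 0 (c es) * eval_monom fs es) \<in> P" using rel by (rule subsetD)
    then show False by (rule separated_chain_no_relation[OF fs A])
  qed
  then show "enat (length Ps - 1) \<le> enat (card F)"
    using separated_chain_length[OF fs] by (simp add: PQ)
qed

text \<open>Removing vertices one by one gives a chain of coordinate primes; the variable of the
  removed vertex makes each inclusion strict.\<close>

lemma prime_chain_exists:
  fixes F :: "'x::finite set"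
  shows "\<exists>Ps :: ('x, 'k::field) mpoly set list. length Ps = Suc (card F) \<and> sorted_wrt (\<subset>) Ps \<and>
    (\<forall>P\<in>set Ps. prime_ideal P \<and> face_ideal (Pow F) \<subseteq> P)"
proof -
  have "finite F" by simp
  then show ?thesis
  proof (induction F rule: finite_induct)
    case empty
    then show ?case
      by (intro exI[of _ "[face_ideal (Pow {})]"]) (use prime_ideal_face_ideal_Pow[of "{}"] in auto)
  next
    case (insert v F)
    then obtain Ps :: "('x, 'k) mpoly set list" where Ps: "length Ps = Suc (card F)"
      "sorted_wrt (\<subset>) Ps" "\<forall>P\<in>set Ps. prime_ideal P \<and> face_ideal (Pow F) \<subseteq> P"
      by blast
    let ?P = "face_ideal (Pow (insert v F)) :: ('x, 'k) mpoly set"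
    have "?P \<subseteq> face_ideal (Pow F)" by (auto simp: face_ideal_def)
    moreover have "single (sq_monom {v}) 1 \<in> (face_ideal (Pow F) :: ('x, 'k) mpoly set)"
      using insert by (auto intro: single_in_face_ideal)
    moreover have "single (sq_monom {v}) 1 \<notin> ?P" by (simp add: face_ideal_def)
    ultimately have "?P \<subset> face_ideal (Pow F)" by blast
    then have "?P \<subset> P" if "P \<in> set Ps" for P using Ps(3) that by blast
    then show ?case using Ps insert
      by (intro exI[of _ "?P # Ps"]) (auto intro: prime_ideal_face_ideal_Pow)
  qed
qed

lemma krull_dim_ge:
  assumes "I \<subseteq> (face_ideal (Pow F) :: ('x::finite, 'k::field) mpoly set)"
  shows "enat (card F) \<le> krull_dim I"
proof -
  obtain Ps :: "('x, 'k) mpoly set list" where Ps: "length Ps = Suc (card F)"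
    "sorted_wrt (\<subset>) Ps" "\<forall>P\<in>set Ps. prime_ideal P \<and> face_ideal (Pow F) \<subseteq> P"
    using prime_chain_exists by blast
  show ?thesis
    unfolding krull_dim_def using Ps assms
    by (intro Sup_upper CollectI exI[of _ Ps]) auto
qed

section \<open>Initial dimension of a face ideal\<close>

lemma facet_superset:
  fixes F :: "'x::finite set"
  assumes "F \<in> \<Gamma>"
  obtains H where "H \<in> facets \<Gamma>" "F \<subseteq> H"
proof -
  have "finite {H\<in>\<Gamma>. F \<subseteq> H}" "{H\<in>\<Gamma>. F \<subseteq> H} \<noteq> {}" using assms by auto
  then obtain H where H: "H \<in> {H\<in>\<Gamma>. F \<subseteq> H}"
    and max: "\<And>H'. H' \<in> {H\<in>\<Gamma>. F \<subseteq> H} \<Longrightarrow> H \<subseteq> H' \<Longrightarrow> H = H'"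
    by (metis (no_types, lifting) finite_has_maximal)
  have "H \<in> facets \<Gamma>" unfolding facets_def using H max by blast
  with H that show thesis by auto
qed

text \<open>Some monomial of \<open>a\<close> lives on a face; for a facet \<open>F\<close> above
  it, \<open>a\<close> is non-zero modulo the prime \<open>face_ideal (Pow F)\<close>, so every
  annihilator of \<open>a\<close> lies in that prime. The inclusion bounds
  \<open>krull_dim P\<close> below.\<close>

lemma assoc_prime_subset:
  assumes sc: "simplicial_complex \<Gamma>"
    and P: "P \<in> assoc_primes (face_ideal \<Gamma> :: ('x::finite, 'k::field) mpoly set)"
  obtains F where "F \<in> facets \<Gamma>" "P \<subseteq> face_ideal (Pow F)"
proof -
  obtain a where a: "P = {r. r * a \<in> face_ideal \<Gamma>}" and prime: "prime_ideal P"
    using P by (auto simp: assoc_primes_def)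
  have "1 \<notin> P" using prime by (simp add: prime_ideal_def)
  then have "a \<notin> face_ideal \<Gamma>" by (simp add: a)
  then obtain m where m: "m \<in> keys a" "keys m \<in> \<Gamma>" by (auto simp: face_ideal_def)
  obtain F where F: "F \<in> facets \<Gamma>" "keys m \<subseteq> F" using facet_superset[OF m(2)] by blast
  have "face_ideal \<Gamma> \<subseteq> (face_ideal (Pow F) :: ('x, 'k) mpoly set)"
    using F(1) sc by (auto simp: face_ideal_def facets_def simplicial_complex_def)
  moreover have "a \<notin> face_ideal (Pow F)" using m F by (auto simp: face_ideal_def)
  moreover have "r \<in> face_ideal (Pow F) \<or> a \<in> face_ideal (Pow F)"
    if "r * a \<in> face_ideal (Pow F)" for r
    using prime_ideal_face_ideal_Pow[of F, where 'k='k] that unfolding prime_ideal_def by blast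
  ultimately have "P \<subseteq> face_ideal (Pow F)" unfolding a by blast
  with F(1) show thesis by (rule that)
qed

text \<open>The prime is the annihilator of the squarefree monomial of \<open>F\<close>:
  multiplication by it enlarges supports by \<open>F\<close>, and by maximality the result is a face
  only for supports inside \<open>F\<close>.\<close>

lemma facet_assoc_prime:
  assumes sc: "simplicial_complex \<Gamma>" and F: "F \<in> facets \<Gamma>"
  shows "face_ideal (Pow F) \<in> assoc_primes (face_ideal \<Gamma> :: ('x::finite, 'k::field) mpoly set)"
proof -
  have union: "keys m \<union> F \<notin> \<Gamma> \<longleftrightarrow> \<not> keys m \<subseteq> F" for m :: "'x \<Rightarrow>\<^sub>0 nat"
  proof (cases "keys m \<subseteq> F")
    case True
    then have "keys m \<union> F = F" by blast
    moreover have "F \<in> \<Gamma>" using F by (simp add: facets_def)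
    ultimately show ?thesis using True by simp
  next
    case False
    have "keys m \<union> F = F" if "keys m \<union> F \<in> \<Gamma>"
      using F that unfolding facets_def by blast
    then show ?thesis using False by blast
  qed
  have "keys (r * single (sq_monom F) 1) = (+) (sq_monom F) ` keys r" for r :: "('x, 'k) mpoly"
    using keys_single_mult[of 1 "sq_monom F" r] by (simp add: mult.commute)
  then have "r * single (sq_monom F) 1 \<in> face_ideal \<Gamma> \<longleftrightarrow> r \<in> face_ideal (Pow F)"
    for r :: "('x, 'k) mpoly"
    using union by (simp add: face_ideal_def keys_add_nat sup.commute)
  then have "face_ideal (Pow F) = {r :: ('x, 'k) mpoly. r * single (sq_monom F) 1 \<in> face_ideal \<Gamma>}"
    by (intro set_eqI) simp
  with prime_ideal_face_ideal_Pow[of F] show ?thesis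
    unfolding assoc_primes_def by (intro CollectI conjI exI)
qed

lemma indim_quot_face_ideal:
  assumes sc: "simplicial_complex \<Gamma>" and F: "F \<in> facets \<Gamma>"
    and min: "\<forall>H\<in>facets \<Gamma>. card F \<le> card H"
  shows "indim_quot (face_ideal \<Gamma> :: ('x::finite, 'k::field) mpoly set) = enat (card F)"
proof (rule antisym)
  have "indim_quot (face_ideal \<Gamma> :: ('x, 'k) mpoly set) \<le> krull_dim (face_ideal (Pow F) :: ('x, 'k) mpoly set)"
    unfolding indim_quot_def by (rule INF_lower) (rule facet_assoc_prime[OF sc F])
  also have "\<dots> \<le> enat (card F)" by (rule krull_dim_face_ideal_Pow_le)
  finally show "indim_quot (face_ideal \<Gamma> :: ('x, 'k) mpoly set) \<le> enat (card F)" .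
  show "enat (card F) \<le> indim_quot (face_ideal \<Gamma> :: ('x, 'k) mpoly set)"
    unfolding indim_quot_def
  proof (rule INF_greatest)
    fix P assume "P \<in> assoc_primes (face_ideal \<Gamma> :: ('x, 'k) mpoly set)"
    then obtain H where H: "H \<in> facets \<Gamma>" "P \<subseteq> face_ideal (Pow H)"
      using assoc_prime_subset[OF sc] by blast
    have "enat (card F) \<le> enat (card H)" using min H(1) by simp
    also have "\<dots> \<le> krull_dim P" by (rule krull_dim_ge[OF H(2)])
    finally show "enat (card F) \<le> krull_dim P" .
  qed
qed

section \<open>Koszul cochains\<close>

text \<open>Koszul signs need a total order on the vertices; an arbitrary injection supplies
  one.\<close>

definition vertex_index :: "'x::finite \<Rightarrow> nat" where
  "vertex_index = (SOME f. inj f)"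

lemma inj_vertex_index: "inj vertex_index"
proof -
  obtain f :: "'a \<Rightarrow> nat" where "inj f"
    using finite_imp_inj_to_nat_seg[of "UNIV :: 'a set"] by auto
  then show ?thesis unfolding vertex_index_def by (rule someI[where P = inj])
qed

definition ksign :: "'x::finite \<Rightarrow> 'x set \<Rightarrow> 'r::comm_ring_1" where
  "ksign j T = (- 1) ^ card {i\<in>T. vertex_index i < vertex_index j}"

lemma ksign_square: "ksign j T * ksign j T = 1"
  by (simp add: ksign_def flip: power_add mult_2)

lemma ksign_nonzero [simp]: "ksign j T \<noteq> (0 :: 'k::field)"
  by (simp add: ksign_def)

lemma ksign_insert_self [simp]: "ksign j (insert j T) = ksign j T"
  unfolding ksign_def by (rule arg_cong[where f = "\<lambda>A. (- 1) ^ card A"]) auto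

lemma ksign_Diff_self [simp]: "ksign j (T - {j}) = ksign j T"
  unfolding ksign_def by (rule arg_cong[where f = "\<lambda>A. (- 1) ^ card A"]) auto

lemma ksign_remove_below:
  assumes "i \<in> T" "vertex_index i < vertex_index j"
  shows "ksign j (T - {i}) = - ksign j T"
proof -
  let ?A = "{l\<in>T. vertex_index l < vertex_index j}"
  have "{l\<in>T - {i}. vertex_index l < vertex_index j} = ?A - {i}" by auto
  moreover have "card ?A = Suc (card (?A - {i}))"
    using assms by (intro card.remove) auto
  ultimately show ?thesis by (simp add: ksign_def)
qed

lemma ksign_remove_above:
  assumes "vertex_index j < vertex_index i"
  shows "ksign j (T - {i}) = ksign j T"
proof -
  have "{l\<in>T - {i}. vertex_index l < vertex_index j} = {l\<in>T. vertex_index l < vertex_index j}"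
    using assms by auto
  then show ?thesis by (simp add: ksign_def)
qed

text \<open>Removing the smaller vertex flips the sign of the larger one, while removing the larger
  changes nothing, so exactly one of the two products acquires a sign.\<close>

lemma ksign_swap:
  assumes "i \<in> T" "j \<in> T" "i \<noteq> j"
  shows "ksign i T * ksign j (T - {i}) = - (ksign j T * ksign i (T - {j}))"
proof -
  have "vertex_index i \<noteq> vertex_index j" using assms(3) by (simp add: inj_eq[OF inj_vertex_index])
  then show ?thesis
    using assms by (cases "vertex_index i < vertex_index j")
      (simp_all add: ksign_remove_below ksign_remove_above mult.commute)
qed

text \<open>The Koszul coboundary, with degree read off from the cardinality of the argument.
  Cochains take values in \<open>R\<close> itself; statements over \<open>R/I\<close> are phrased as
  membership in \<open>I\<close>.\<close>

definition kdiff :: "('x::finite \<Rightarrow> 'r::comm_ring_1) \<Rightarrow> ('x set \<Rightarrow> 'r) \<Rightarrow> 'x set \<Rightarrow> 'r" where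
  "kdiff y \<omega> T = (\<Sum>j\<in>T. ksign j T * y j * \<omega> (T - {j}))"

text \<open>Exchanging indices would only show that twice the sum is 0, which is useless in
  characteristic 2. Induction pairs the terms instead.\<close>

lemma sum_antisymmetric_zero:
  fixes g :: "'a \<Rightarrow> 'a \<Rightarrow> 'r::ab_group_add"
  assumes "finite T" "\<And>i j. i \<in> T \<Longrightarrow> j \<in> T \<Longrightarrow> i \<noteq> j \<Longrightarrow> g i j = - g j i"
  shows "(\<Sum>j\<in>T. \<Sum>i\<in>T - {j}. g j i) = 0"
  using assms
proof (induction T rule: finite_induct)
  case (insert a T)
  have "(\<Sum>i\<in>insert a T - {j}. g j i) = g j a + (\<Sum>i\<in>T - {j}. g j i)" if "j \<in> T" for j
  proof -
    have "insert a T - {j} = insert a (T - {j})" using insert.hyps that by auto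
    then show ?thesis using insert.hyps by simp
  qed
  then have "(\<Sum>j\<in>T. \<Sum>i\<in>insert a T - {j}. g j i) = (\<Sum>j\<in>T. g j a) + (\<Sum>j\<in>T. \<Sum>i\<in>T - {j}. g j i)"
    by (simp add: sum.distrib)
  moreover have "(\<Sum>j\<in>T. \<Sum>i\<in>T - {j}. g j i) = 0"
    using insert.prems by (intro insert.IH) blast
  moreover have "insert a T - {a} = T" using insert.hyps by simp
  moreover have "(\<Sum>j\<in>T. g j a) = - (\<Sum>j\<in>T. g a j)"
  proof -
    have "(\<Sum>j\<in>T. g j a) = (\<Sum>j\<in>T. - g a j)"
      using insert by (intro sum.cong refl) blast
    then show ?thesis by (simp add: sum_negf)
  qed
  ultimately show ?case using insert.hyps by simp
qed simp

lemma kdiff_kdiff: "kdiff y (kdiff y \<omega>) T = 0"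
proof -
  let ?g = "\<lambda>j i. ksign j T * y j * (ksign i (T - {j}) * y i * \<omega> (T - {j} - {i}))"
  have "kdiff y (kdiff y \<omega>) T = (\<Sum>j\<in>T. \<Sum>i\<in>T - {j}. ?g j i)"
    by (simp add: kdiff_def sum_distrib_left)
  also have "\<dots> = 0"
  proof (rule sum_antisymmetric_zero)
    fix i j assume ij: "i \<in> T" "j \<in> T" "i \<noteq> j"
    have set: "T - {i} - {j} = T - {j} - {i}" by auto
    have "?g i j = (ksign i T * ksign j (T - {i})) * (y i * y j * \<omega> (T - {i} - {j}))"
      by (simp only: ac_simps)
    also have "\<dots> = - ((ksign j T * ksign i (T - {j})) * (y i * y j * \<omega> (T - {j} - {i})))"
      unfolding ksign_swap[OF ij] set by (rule mult_minus_left)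
    also have "\<dots> = - ?g j i"
      by (simp only: ac_simps)
    finally show "?g i j = - ?g j i" .
  qed simp
  finally show ?thesis .
qed

lemma kdiff_add: "kdiff y (\<lambda>T. \<omega> T + \<eta> T) T = kdiff y \<omega> T + kdiff y \<eta> T"
  by (simp add: kdiff_def distrib_left sum.distrib)

lemma kdiff_diff: "kdiff y (\<lambda>T. \<omega> T - \<eta> T) T = kdiff y \<omega> T - kdiff y \<eta> T"
  by (simp add: kdiff_def right_diff_distrib sum_subtractf)

lemma kdiff_scale: "kdiff y (\<lambda>T. c * \<omega> T) T = c * kdiff y \<omega> T"
  by (simp add: kdiff_def sum_distrib_left mult.left_commute)

lemma kdiff_mem:
  assumes "ideal.subspace I" "\<And>j. j \<in> T \<Longrightarrow> \<omega> (T - {j}) \<in> I"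
  shows "kdiff y \<omega> T \<in> I"
  unfolding kdiff_def by (intro ideal.subspace_sum ideal.subspace_scale assms)

text \<open>Contraction with the basis vector of \<open>j\<close>, the homotopy showing that
  \<open>y j\<close> annihilates Koszul cohomology.\<close>

definition kcontract :: "'x::finite \<Rightarrow> ('x set \<Rightarrow> 'r::comm_ring_1) \<Rightarrow> 'x set \<Rightarrow> 'r" where
  "kcontract j \<omega> T = (if j \<in> T then 0 else ksign j T * \<omega> (insert j T))"

lemma kcontract_homotopy:
  fixes y :: "'x::finite \<Rightarrow> 'r::comm_ring_1"
  shows "kdiff y (kcontract j \<omega>) T + kcontract j (kdiff y \<omega>) T = y j * \<omega> T"
proof (cases "j \<in> T")
  case True
  have "kdiff y (kcontract j \<omega>) T
      = (\<Sum>l\<in>T. if l = j then ksign j T * y j * (ksign j T * \<omega> T) else 0)"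
    unfolding kdiff_def
    by (intro sum.cong refl) (use True in \<open>auto simp: kcontract_def insert_absorb\<close>)
  also have "\<dots> = (ksign j T * ksign j T) * (y j * \<omega> T)"
    using True by (simp add: ac_simps)
  finally show ?thesis using True by (simp add: ksign_square kcontract_def)
next
  case False
  let ?U = "insert j T"
  have sign: "ksign l T * ksign j (T - {l}) = - (ksign j T * ksign l ?U :: 'r)"
    if l: "l \<in> T" for l
  proof -
    have "ksign j ?U * ksign l (?U - {j}) = - (ksign l ?U * ksign j (?U - {l}))"
      using l False by (intro ksign_swap) auto
    moreover have "?U - {j} = T" using False by auto
    moreover have "?U - {l} = insert j (T - {l})" using l False by auto
    ultimately have "ksign j T * ksign l T = - (ksign l ?U * ksign j (T - {l}) :: 'r)" by simp
    note swap = this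
    have "ksign l T * ksign j (T - {l}) = (ksign j T * ksign j T) * (ksign l T * ksign j (T - {l}) :: 'r)"
      by (simp add: ksign_square)
    also have "\<dots> = (ksign j T * ksign l T) * (ksign j T * ksign j (T - {l}))"
      by (simp only: ac_simps)
    also have "\<dots> = - ((ksign l ?U * ksign j (T - {l})) * (ksign j T * ksign j (T - {l})))"
      unfolding swap by (rule mult_minus_left)
    also have "\<dots> = - ((ksign j T * ksign l ?U) * (ksign j (T - {l}) * ksign j (T - {l})))"
      by (simp only: ac_simps)
    finally show ?thesis by (simp add: ksign_square)
  qed
  have "kdiff y (kcontract j \<omega>) T
      = (\<Sum>l\<in>T. - (ksign j T * (ksign l ?U * y l * \<omega> (?U - {l}))))"
    unfolding kdiff_def
  proof (intro sum.cong refl)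
    fix l assume l: "l \<in> T"
    have U: "?U - {l} = insert j (T - {l})" using l False by auto
    have "ksign l T * y l * kcontract j \<omega> (T - {l})
        = (ksign l T * ksign j (T - {l})) * (y l * \<omega> (?U - {l}))"
      using False by (simp add: kcontract_def U ac_simps)
    also have "\<dots> = - (ksign j T * (ksign l ?U * y l * \<omega> (?U - {l})))"
      unfolding sign[OF l] by (simp add: ac_simps)
    finally show "ksign l T * y l * kcontract j \<omega> (T - {l})
        = - (ksign j T * (ksign l ?U * y l * \<omega> (?U - {l})))" .
  qed
  moreover have "kcontract j (kdiff y \<omega>) T = (ksign j T * ksign j T) * (y j * \<omega> T)
      + (\<Sum>l\<in>T. ksign j T * (ksign l ?U * y l * \<omega> (?U - {l})))"
    using False by (simp add: kcontract_def kdiff_def distrib_left sum_distrib_left ac_simps)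
  ultimately show ?thesis by (simp add: ksign_square sum_negf)
qed

text \<open>Vanishing of the class of \<open>\<omega>\<close> in degree \<open>i\<close> over
  \<open>R/I\<close>. In degree 0 the differential is an empty sum, so the condition is
  \<open>\<omega> {} \<in> I\<close>.\<close>

definition kexact :: "'r::comm_ring_1 set \<Rightarrow> ('x::finite \<Rightarrow> 'r) \<Rightarrow> nat \<Rightarrow> ('x set \<Rightarrow> 'r) \<Rightarrow> bool" where
  "kexact I y i \<omega> \<longleftrightarrow> (\<exists>\<eta>. \<forall>T. card T = i \<longrightarrow> \<omega> T - kdiff y \<eta> T \<in> I)"

text \<open>The multipliers that make \<open>\<omega>\<close> exact form an ideal, and
  \<open>kcontract_homotopy\<close> puts every \<open>y j\<close> into it.\<close>

lemma kexact_scale_generators: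
  assumes I: "ideal.subspace I" and closed: "\<And>T. card T = Suc i \<Longrightarrow> kdiff y \<omega> T \<in> I"
    and q: "q \<in> ideal.span (range y)"
  shows "kexact I y i (\<lambda>T. q * \<omega> T)"
proof -
  let ?S = "{q. kexact I y i (\<lambda>T. q * \<omega> T)}"
  have "ideal.subspace ?S"
  proof (rule ideal.subspaceI)
    show "0 \<in> ?S"
      using ideal.subspace_0[OF I]
      by (auto simp: kexact_def kdiff_def intro!: exI[of _ "\<lambda>_. 0"])
    fix p q assume "p \<in> ?S" "q \<in> ?S"
    then obtain \<eta> \<eta>' where \<eta>: "\<And>T. card T = i \<Longrightarrow> p * \<omega> T - kdiff y \<eta> T \<in> I"
      "\<And>T. card T = i \<Longrightarrow> q * \<omega> T - kdiff y \<eta>' T \<in> I"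
      unfolding kexact_def by blast
    have "(p + q) * \<omega> T - kdiff y (\<lambda>T. \<eta> T + \<eta>' T) T \<in> I" if "card T = i" for T
      using ideal.subspace_add[OF I \<eta>(1)[OF that] \<eta>(2)[OF that]]
      by (simp add: kdiff_add distrib_right add_diff_add)
    then show "p + q \<in> ?S" unfolding kexact_def by blast
  next
    fix c q assume "q \<in> ?S"
    then obtain \<eta> where \<eta>: "\<And>T. card T = i \<Longrightarrow> q * \<omega> T - kdiff y \<eta> T \<in> I"
      unfolding kexact_def by blast
    have "c * q * \<omega> T - kdiff y (\<lambda>T. c * \<eta> T) T \<in> I" if "card T = i" for T
      using ideal.subspace_scale[OF I \<eta>[OF that], of c]
      by (simp add: kdiff_scale right_diff_distrib mult.assoc)
    then show "c * q \<in> ?S" unfolding kexact_def by blast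
  qed
  moreover have "y j \<in> ?S" for j
  proof -
    have "y j * \<omega> T - kdiff y (kcontract j \<omega>) T \<in> I" if T: "card T = i" for T
    proof -
      have "y j * \<omega> T - kdiff y (kcontract j \<omega>) T = kcontract j (kdiff y \<omega>) T"
        by (simp flip: kcontract_homotopy[of y j \<omega> T])
      moreover have "kcontract j (kdiff y \<omega>) T \<in> I"
      proof (cases "j \<in> T")
        case True
        then show ?thesis using ideal.subspace_0[OF I] by (simp add: kcontract_def)
      next
        case False
        then have "card (insert j T) = Suc i" using T by simp
        then show ?thesis
          using False ideal.subspace_scale[OF I closed] by (simp add: kcontract_def)
      qed
      ultimately show ?thesis by simp
    qed
    then show ?thesis unfolding kexact_def by blast
  qed
  ultimately have "ideal.span (range y) \<subseteq> ?S" by (intro ideal.span_minimal) auto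
  with q show ?thesis by blast
qed

text \<open>A piece of the long exact sequence of multiplication by \<open>f\<close>. A primitive
  \<open>\<eta>\<close> of \<open>f * \<omega>\<close> is closed modulo \<open>(I, f)\<close>, hence
  exact there by vanishing one degree lower. Up to exact terms it is \<open>f * \<xi>\<close>, and
  cancelling \<open>f\<close> makes \<open>\<xi>\<close> a primitive of
  \<open>\<omega>\<close>.\<close>

lemma kexact_cancel:
  assumes I: "ideal.subspace I" and nzd: "\<And>g. f * g \<in> I \<Longrightarrow> g \<in> I"
    and lower: "\<And>i' \<eta>. i = Suc i' \<Longrightarrow> (\<And>T. card T = i \<Longrightarrow> kdiff y \<eta> T \<in> adjoin I f) \<Longrightarrow>
      kexact (adjoin I f) y i' \<eta>"
    and exact: "kexact I y i (\<lambda>T. f * \<omega> T)"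
  shows "kexact I y i \<omega>"
proof -
  obtain \<eta> where \<eta>: "\<And>T. card T = i \<Longrightarrow> f * \<omega> T - kdiff y \<eta> T \<in> I"
    using exact unfolding kexact_def by blast
  show ?thesis
  proof (cases i)
    case 0
    have "\<omega> T - kdiff y \<eta> T \<in> I" if "card T = 0" for T
      using \<eta>[of T] that nzd by (simp add: 0 kdiff_def)
    then show ?thesis unfolding kexact_def 0 by blast
  next
    case (Suc i')
    have "kdiff y \<eta> T \<in> adjoin I f" if "card T = i" for T
    proof -
      have "\<omega> T * f - (f * \<omega> T - kdiff y \<eta> T) \<in> adjoin I f"
        by (rule ideal.span_diff[OF ideal.span_scale]) (auto intro!: ideal.span_base \<eta> that)
      then show ?thesis by (simp add: mult.commute)
    qed
    then obtain \<zeta> where \<zeta>: "\<And>T. card T = i' \<Longrightarrow> \<eta> T - kdiff y \<zeta> T \<in> adjoin I f"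
      using lower[OF Suc] unfolding kexact_def by blast
    then have "\<exists>h. card T = i' \<longrightarrow> \<eta> T - kdiff y \<zeta> T - h * f \<in> I" for T
      unfolding mem_adjoin[OF I] by blast
    then obtain \<xi> where \<xi>: "\<And>T. card T = i' \<Longrightarrow> \<eta> T - kdiff y \<zeta> T - \<xi> T * f \<in> I"
      by metis
    have "\<omega> T - kdiff y \<xi> T \<in> I" if T: "card T = i" for T
    proof -
      have "kdiff y (\<lambda>T. \<eta> T - kdiff y \<zeta> T - f * \<xi> T) T \<in> I"
      proof (rule kdiff_mem[OF I])
        fix j assume "j \<in> T"
        then have "card (T - {j}) = i'" using T Suc by simp
        then show "\<eta> (T - {j}) - kdiff y \<zeta> (T - {j}) - f * \<xi> (T - {j}) \<in> I"
          using \<xi> by (simp only: mult.commute[of f])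
      qed
      then have "kdiff y \<eta> T - f * kdiff y \<xi> T \<in> I"
        by (simp only: kdiff_diff kdiff_scale kdiff_kdiff diff_0_right)
      from ideal.subspace_add[OF I \<eta>[OF T] this] have "f * (\<omega> T - kdiff y \<xi> T) \<in> I"
        by (simp add: right_diff_distrib)
      then show ?thesis by (rule nzd)
    qed
    then show ?thesis unfolding kexact_def by blast
  qed
qed

text \<open>
  Cohomology below the length of a regular sequence vanishes: multiplication by \<open>f\<close> is injective
  on the lowest possibly non-zero group by \<open>kexact_cancel\<close>, and nilpotent by
  \<open>kexact_scale_generators\<close>.
\<close>

lemma weakly_regular_kexact:
  assumes "ideal.subspace I" "weakly_regular I fs"
    and "\<And>f. f \<in> set fs \<Longrightarrow> \<exists>N. f ^ N \<in> ideal.span (range y)"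
    and "i < length fs" "\<And>T. card T = Suc i \<Longrightarrow> kdiff y \<omega> T \<in> I"
  shows "kexact I y i \<omega>"
  using assms
proof (induction fs arbitrary: I i \<omega>)
  case (Cons f fs)
  note I = Cons.prems(1)
  have nzd: "\<And>g. f * g \<in> I \<Longrightarrow> g \<in> I" and reg: "weakly_regular (adjoin I f) fs"
    using Cons.prems(2) by auto
  have lower: "kexact (adjoin I f) y i' \<eta>"
    if "i = Suc i'" "\<And>T. card T = i \<Longrightarrow> kdiff y \<eta> T \<in> adjoin I f" for i' \<eta>
    using Cons.prems(3,4) that by (intro Cons.IH[OF ideal.subspace_span reg]) auto
  have cancel: "kexact I y i (\<lambda>T. f ^ N * \<omega> T) \<Longrightarrow> kexact I y i \<omega>" for N
  proof (induction N)
    case (Suc N)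
    then have "kexact I y i (\<lambda>T. f * (f ^ N * \<omega> T))" by (simp add: mult.assoc)
    then have "kexact I y i (\<lambda>T. f ^ N * \<omega> T)"
      by (rule kexact_cancel[OF I, rotated 2]) (fact nzd, fact lower)
    then show ?case by (rule Suc.IH)
  qed simp
  obtain N where "f ^ N \<in> ideal.span (range y)" using Cons.prems(3) by auto
  then have "kexact I y i (\<lambda>T. f ^ N * \<omega> T)"
    by (rule kexact_scale_generators[OF I, rotated]) (fact Cons.prems(5))
  then show ?case by (rule cancel)
qed simp

section \<open>Upper bounds for the depth of a face ideal\<close>

definition var_square :: "'x \<Rightarrow> ('x, 'k::field) mpoly" where
  "var_square j = single (single j 2) 1"

text \<open>Pigeonhole: in \<open>n\<close> variables a monomial of degree at least
  \<open>n + 1\<close> has an exponent at least 2.\<close>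

lemma irrelevant_power_in_var_squares:
  assumes "(f :: ('x::finite, 'k::field) mpoly) \<in> irrelevant_ideal"
  shows "\<exists>N. f ^ N \<in> ideal.span (range var_square)"
proof
  let ?N = "Suc (card (UNIV :: 'x set))"
  have "single m (lookup (f ^ ?N) m) \<in> ideal.span (range var_square)" if m: "m \<in> keys (f ^ ?N)" for m
  proof -
    have "?N \<le> tdeg m" using assms m by (intro tdeg_power[of f]) (auto simp: irrelevant_ideal_eq)
    have "\<exists>j. 2 \<le> lookup m j"
    proof (rule ccontr)
      assume "\<not> ?thesis"
      then have "\<And>j. lookup m j \<le> 1" by (simp add: not_le less_Suc_eq_le numeral_2_eq_2)
      then have "tdeg m \<le> card (UNIV :: 'x set)"
        unfolding tdeg_def using sum_bounded_above[of UNIV "lookup m" 1] by simp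
      with \<open>?N \<le> tdeg m\<close> show False by simp
    qed
    then obtain j where j: "2 \<le> lookup m j" by blast
    then have "m = (m - single j 2) + single j 2"
      by (intro poly_mapping_eqI) (auto simp: lookup_add lookup_minus lookup_single when_def)
    then have "single m (lookup (f ^ ?N) m) = single (m - single j 2) (lookup (f ^ ?N) m) * var_square j"
      by (metis var_square_def mult_single mult.right_neutral)
    then show ?thesis by (auto intro: ideal.span_scale ideal.span_base)
  qed
  then have "(\<Sum>m\<in>keys (f ^ ?N). single m (lookup (f ^ ?N) m)) \<in> ideal.span (range var_square)"
    by (intro ideal.span_sum)
  then show "f ^ ?N \<in> ideal.span (range var_square)" by (simp only: sum_single_lookup)
qed

lemma regular_seq_length_le:
  fixes \<omega> :: "'x::finite set \<Rightarrow> ('x, 'k::field) mpoly" and fs :: "('x, 'k) mpoly list"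
  assumes "simplicial_complex \<Gamma>" "regular_seq (face_ideal \<Gamma>) fs" "set fs \<subseteq> irrelevant_ideal"
    and "\<And>T. card T = Suc i \<Longrightarrow> kdiff var_square \<omega> T \<in> face_ideal \<Gamma>"
    and "\<not> kexact (face_ideal \<Gamma>) var_square i \<omega>"
  shows "length fs \<le> i"
proof (rule ccontr)
  assume "\<not> ?thesis"
  note I = subspace_face_ideal[OF assms(1), where 'k = 'k]
  have "kexact (face_ideal \<Gamma>) var_square i \<omega>"
  proof (rule weakly_regular_kexact[OF I])
    show "weakly_regular (face_ideal \<Gamma>) fs" using assms(2) by (simp add: regular_seq_iff[OF I])
    show "\<exists>N. f ^ N \<in> ideal.span (range var_square)" if "f \<in> set fs" for f
      using assms(3) that by (intro irrelevant_power_in_var_squares) auto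
    show "i < length fs" using \<open>\<not> length fs \<le> i\<close> by simp
  qed (fact assms(4))
  with assms(5) show False by simp
qed

lemma lookup_ksign_mult: "lookup (ksign j T * p) m = ksign j T * lookup (p :: ('x, 'k::field) mpoly) m"
proof -
  have "lookup ((- 1) ^ n * p) m = (- 1) ^ n * lookup p m" for n
    by (induction n) (simp_all add: mult.assoc)
  then show ?thesis by (simp add: ksign_def)
qed

lemma ksign_mult_single:
  "ksign j T * single m c = (single m (ksign j T * c) :: ('x, 'k::field) mpoly)"
  by (rule poly_mapping_eqI) (simp add: lookup_ksign_mult lookup_single when_def)

text \<open>
  The cochains used below are simplicial cochains \<open>e\<close> written with the monomials
  \<open>\<Prod>\<^sub>i\<^sub>\<in>\<^sub>U\<^sub>-\<^sub>C x\<^sub>i \<Prod>\<^sub>i\<^sub>\<in>\<^sub>U\<^sub>\<inter>\<^sub>C x\<^sub>i\<^sup>2\<close>, which makes the Koszul differential of \<open>e\<close> its simplicial coboundary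
  in the directions of \<open>C\<close>.
\<close>

definition kmonom :: "'x set \<Rightarrow> 'x set \<Rightarrow> 'x \<Rightarrow>\<^sub>0 nat" where
  "kmonom C U = sq_monom U + sq_monom (U \<inter> C)"

lemma lookup_kmonom:
  "lookup (kmonom C U) j = (if j \<in> U then if j \<in> C then 2 else 1 else (0::nat))"
  for j :: "'x::finite"
  by (simp add: kmonom_def lookup_add)

lemma keys_kmonom [simp]: "keys (kmonom C U) = (U :: 'x::finite set)"
  by (auto simp: in_keys_iff lookup_kmonom split: if_splits)

lemma kmonom_remove:
  assumes "j \<in> U" "j \<in> C"
  shows "single j 2 + kmonom C (U - {j}) = kmonom C (U :: 'x::finite set)"
  by (rule poly_mapping_eqI)
    (use assms in \<open>auto simp: lookup_add lookup_kmonom lookup_single when_def\<close>)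

definition coboundary :: "('x::finite set \<Rightarrow> 'k::field) \<Rightarrow> 'x set \<Rightarrow> 'k" where
  "coboundary e U = (\<Sum>j\<in>U. ksign j U * e (U - {j}))"

text \<open>For \<open>j \<in> C\<close> the monomials of \<open>U\<close> and
  \<open>U - {j}\<close> differ exactly by the square of the variable. For \<open>j\<close> outside
  \<open>C\<close> the exponents would not match, but the support condition makes that term
  0.\<close>

lemma kdiff_kmonom:
  fixes e :: "'x::finite set \<Rightarrow> 'k::field"
  assumes "\<forall>V. e V \<noteq> 0 \<longrightarrow> - C \<subseteq> V"
  shows "kdiff var_square (\<lambda>U. single (kmonom C U) (e U)) U = single (kmonom C U) (coboundary e U)"
proof -
  have "ksign j U * var_square j * single (kmonom C (U - {j})) (e (U - {j}))
      = single (kmonom C U) (ksign j U * e (U - {j}))" if j: "j \<in> U" for j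
  proof (cases "j \<in> C")
    case True
    then show ?thesis
      by (simp add: var_square_def mult.assoc mult_single kmonom_remove[OF j] ksign_mult_single)
  next
    case False
    then have "e (U - {j}) = 0" using assms by blast
    then show ?thesis by simp
  qed
  then have "kdiff var_square (\<lambda>U. single (kmonom C U) (e U)) U
      = (\<Sum>j\<in>U. single (kmonom C U) (ksign j U * e (U - {j})))"
    unfolding kdiff_def by (intro sum.cong refl)
  also have "\<dots> = single (kmonom C U) (coboundary e U)"
    by (intro poly_mapping_eqI) (simp add: lookup_sum lookup_single when_def coboundary_def)
  finally show ?thesis .
qed

lemma kdiff_kmonom_in_face_ideal:
  fixes e :: "'x::finite set \<Rightarrow> 'k::field"
  assumes "\<forall>V. e V \<noteq> 0 \<longrightarrow> - C \<subseteq> V" and "U \<in> \<Gamma> \<Longrightarrow> coboundary e U = 0"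
  shows "kdiff var_square (\<lambda>U. single (kmonom C U) (e U)) U \<in> face_ideal \<Gamma>"
  unfolding kdiff_kmonom[OF assms(1)]
  by (cases "U \<in> \<Gamma>") (auto simp: assms(2) face_ideal_def)

text \<open>On vertices of \<open>U\<close> outside \<open>C\<close> the monomial has exponent 1 and
  is not divisible by the square, so only directions in \<open>C\<close> contribute to this
  coefficient.\<close>

lemma lookup_kdiff_var_square:
  fixes \<eta> :: "'x::finite set \<Rightarrow> ('x, 'k::field) mpoly"
  assumes "\<And>j. j \<in> U \<inter> C \<Longrightarrow> lookup (\<eta> (U - {j})) (kmonom C (U - {j})) = 0"
  shows "lookup (kdiff var_square \<eta> U) (kmonom C U) = 0"
proof -
  have "lookup (ksign j U * var_square j * \<eta> (U - {j})) (kmonom C U) = 0" if j: "j \<in> U" for j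
  proof (cases "j \<in> C")
    case True
    then have "lookup (var_square j * \<eta> (U - {j})) (kmonom C U) = lookup (\<eta> (U - {j})) (kmonom C (U - {j}))"
      using lookup_single_mult[of "single j 2" 1 "\<eta> (U - {j})" "kmonom C (U - {j})"]
      by (simp add: var_square_def kmonom_remove[OF j])
    then show ?thesis using assms[of j] j True by (simp add: mult.assoc lookup_ksign_mult)
  next
    case False
    have "kmonom C U \<noteq> single j 2 + n" for n
    proof
      assume "kmonom C U = single j 2 + n"
      then have "lookup (kmonom C U) j = lookup (single j 2 + n) j" by simp
      then show False using j False by (simp add: lookup_kmonom lookup_add)
    qed
    then have "lookup (var_square j * \<eta> (U - {j})) (kmonom C U) = 0"
      unfolding var_square_def by (rule lookup_single_mult_eq_0)
    then show ?thesis by (simp add: mult.assoc lookup_ksign_mult)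
  qed
  then show ?thesis by (simp add: kdiff_def lookup_sum)
qed

text \<open>A cocycle is paired with a cycle. The faces \<open>U - {j}\<close> with
  \<open>j \<in> U \<inter> C\<close> bound the non-face \<open>U\<close>; an exact cochain pairs to
  0 with this boundary because \<open>kdiff\<close> squares to 0, while \<open>e\<close> pairs to
  \<open>coboundary e U\<close>.\<close>

lemma regular_seq_length_le_cocycle:
  fixes e :: "'x::finite set \<Rightarrow> 'k::field"
  assumes sc: "simplicial_complex \<Gamma>"
    and reg: "regular_seq (face_ideal \<Gamma> :: ('x, 'k) mpoly set) fs" "set fs \<subseteq> irrelevant_ideal"
    and supp: "\<forall>V. e V \<noteq> 0 \<longrightarrow> - C \<subseteq> V"
    and closed: "\<And>U. U \<in> \<Gamma> \<Longrightarrow> card U = Suc i \<Longrightarrow> coboundary e U = 0"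
    and U: "card U = Suc i" "coboundary e U \<noteq> 0" "\<And>j. j \<in> U \<inter> C \<Longrightarrow> U - {j} \<in> \<Gamma>"
  shows "length fs \<le> i"
proof (rule regular_seq_length_le[OF sc reg])
  let ?\<omega> = "\<lambda>U. single (kmonom C U) (e U)"
  show "kdiff var_square ?\<omega> T \<in> face_ideal \<Gamma>" if "card T = Suc i" for T
    by (rule kdiff_kmonom_in_face_ideal[OF supp]) (use closed that in auto)
  show "\<not> kexact (face_ideal \<Gamma>) var_square i ?\<omega>"
  proof
    assume "kexact (face_ideal \<Gamma>) var_square i ?\<omega>"
    then obtain \<eta> where \<eta>: "\<And>T. card T = i \<Longrightarrow> ?\<omega> T - kdiff var_square \<eta> T \<in> face_ideal \<Gamma>"
      unfolding kexact_def by blast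
    have "lookup (kdiff var_square (\<lambda>T. ?\<omega> T - kdiff var_square \<eta> T) U) (kmonom C U) = 0"
    proof (rule lookup_kdiff_var_square)
      fix j assume j: "j \<in> U \<inter> C"
      then have "card (U - {j}) = i" using U(1) by simp
      from lookup_face_ideal[OF \<eta>[OF this]] U(3)[OF j]
      show "lookup (?\<omega> (U - {j}) - kdiff var_square \<eta> (U - {j})) (kmonom C (U - {j})) = 0" by simp
    qed
    then have "lookup (single (kmonom C U) (coboundary e U)) (kmonom C U) = 0"
      by (simp only: kdiff_diff kdiff_kdiff kdiff_kmonom[OF supp] diff_0_right)
    then show False using U(2) by simp
  qed
qed

text \<open>The facet itself carries a class, in the multidegree -1 on \<open>F\<close>. It is
  closed because no larger face contains \<open>F\<close>, and not exact because no vertex of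
  \<open>F\<close> lies in \<open>C = - F\<close>.\<close>

lemma regular_seq_length_le_facet:
  assumes sc: "simplicial_complex \<Gamma>"
    and reg: "regular_seq (face_ideal \<Gamma> :: ('x::finite, 'k::field) mpoly set) fs" "set fs \<subseteq> irrelevant_ideal"
    and F: "F \<in> facets \<Gamma>"
  shows "length fs \<le> card F"
proof (rule regular_seq_length_le[OF sc reg])
  define e :: "'x set \<Rightarrow> 'k" where "e U = (if U = F then 1 else 0)" for U
  let ?\<omega> = "\<lambda>U. single (kmonom (- F) U) (e U)"
  have supp: "\<forall>V. e V \<noteq> 0 \<longrightarrow> - (- F) \<subseteq> V" by (simp add: e_def)
  show "kdiff var_square ?\<omega> U \<in> face_ideal \<Gamma>" if U: "card U = Suc (card F)" for U
  proof (rule kdiff_kmonom_in_face_ideal[OF supp])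
    assume "U \<in> \<Gamma>"
    have "U - {j} \<noteq> F" for j
    proof
      assume "U - {j} = F"
      then have "F \<subseteq> U" by blast
      then have "U = F" using F \<open>U \<in> \<Gamma>\<close> unfolding facets_def by blast
      then show False using U by simp
    qed
    then show "coboundary e U = 0" by (simp add: coboundary_def e_def)
  qed
  show "\<not> kexact (face_ideal \<Gamma>) var_square (card F) ?\<omega>"
  proof
    assume "kexact (face_ideal \<Gamma>) var_square (card F) ?\<omega>"
    then obtain \<eta> where "?\<omega> F - kdiff var_square \<eta> F \<in> face_ideal \<Gamma>"
      unfolding kexact_def by blast
    moreover have "F \<in> \<Gamma>" using F by (simp add: facets_def)
    ultimately have "lookup (?\<omega> F - kdiff var_square \<eta> F) (kmonom (- F) F) = 0"
      by (intro lookup_face_ideal[of _ \<Gamma>]) simp_all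
    moreover have "lookup (kdiff var_square \<eta> F) (kmonom (- F) F) = 0"
      by (rule lookup_kdiff_var_square) auto
    ultimately show False by (simp add: lookup_minus e_def)
  qed
qed

section \<open>Initially Cohen--Macaulay complexes\<close>

lemma initially_CM_iff_regular_seq:
  assumes sc: "simplicial_complex \<Gamma>" and F: "F \<in> facets \<Gamma>"
    and min: "\<forall>H\<in>facets \<Gamma>. card F \<le> card H"
  shows "initially_CM TYPE('k::field) \<Gamma> \<longleftrightarrow>
    (\<exists>fs. set fs \<subseteq> irrelevant_ideal \<and> length fs = card F \<and>
      regular_seq (face_ideal \<Gamma> :: ('x::finite, 'k) mpoly set) fs)"
    (is "_ \<longleftrightarrow> ?R")
proof -
  let ?I = "face_ideal \<Gamma> :: ('x, 'k) mpoly set"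
  have ne: "\<Gamma> \<noteq> {}" using F by (auto simp: facets_def)
  define S where "S = {enat (length fs) | fs. set fs \<subseteq> irrelevant_ideal \<and> regular_seq ?I fs}"
  have depth: "depth_quot irrelevant_ideal ?I = Sup S"
    by (simp add: depth_quot_def S_def)
  have le: "length fs \<le> card F" if "set fs \<subseteq> irrelevant_ideal" "regular_seq ?I fs" for fs
    using regular_seq_length_le_facet[OF sc that(2,1) F] .
  have "initially_CM TYPE('k) \<Gamma> \<longleftrightarrow> Sup S = enat (card F)"
    using ne by (simp add: initially_CM_def initially_CM_ideal_def stanley_reisner_ideal_eq[OF sc]
        face_ideal_eq_UNIV_iff[OF sc] depth indim_quot_face_ideal[OF sc F min])
  also have "\<dots> \<longleftrightarrow> ?R"
  proof
    assume Sup: "Sup S = enat (card F)"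
    show ?R
    proof (rule ccontr)
      assume none: "\<not> ?R"
      \<comment> \<open>Without a sequence of full length all lengths are at most
        \<open>card F - 1\<close>, which is a strict decrease only for positive
        \<open>card F\<close>. For \<open>card F = 0\<close> the empty sequence has full
        length.\<close>
      have "card F \<noteq> 0"
      proof
        assume 0: "card F = 0"
        have "esym_regular TYPE('k) \<Gamma> 0" by simp
        from regular_seq_esym[OF sc ne this] none show False unfolding 0 by blast
      qed
      have "Sup S \<le> enat (card F - 1)"
        unfolding S_def
      proof (rule Sup_least, clarify)
        fix fs assume fs: "set fs \<subseteq> irrelevant_ideal" "regular_seq ?I fs"
        then have "length fs \<noteq> card F" using none by blast
        with le[OF fs] show "enat (length fs) \<le> enat (card F - 1)" by simp
      qed
      then have "card F \<le> card F - 1" unfolding Sup enat_ord_simps .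
      moreover obtain n where "card F = Suc n" using \<open>card F \<noteq> 0\<close> not0_implies_Suc by blast
      ultimately show False by simp
    qed
  next
    assume ?R
    then obtain fs where fs: "set fs \<subseteq> irrelevant_ideal" "length fs = card F" "regular_seq ?I fs"
      by blast
    then have "enat (length fs) \<in> S" unfolding S_def by blast
    then have "enat (card F) \<in> S" unfolding fs(2) .
    then have "enat (card F) \<le> Sup S" by (rule Sup_upper)
    moreover have "Sup S \<le> enat (card F)"
      unfolding S_def by (rule Sup_least) (use le in auto)
    ultimately show "Sup S = enat (card F)" by (rule antisym[rotated])
  qed
  finally show ?thesis .
qed

lemma initially_CM_of_esym_regular:
  assumes "simplicial_complex \<Gamma>" "F \<in> facets \<Gamma>"
    and "\<forall>H\<in>facets \<Gamma>. card F \<le> card H"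
    and "esym_regular TYPE('k::field) \<Gamma> (card F)"
  shows "initially_CM TYPE('k) \<Gamma>"
proof -
  have "\<Gamma> \<noteq> {}" using assms(2) by (auto simp: facets_def)
  from regular_seq_esym[OF assms(1) this assms(4)] show ?thesis
    using initially_CM_iff_regular_seq[OF assms(1,2,3), where 'k = 'k] by blast
qed

lemma initially_CM_void: "initially_CM K {}"
  by (simp add: initially_CM_def initially_CM_ideal_def stanley_reisner_ideal_eq
      simplicial_complex_def)

text \<open>A component \<open>A\<close> of the link of \<open>T\<close> gives a cocycle in degree \<open>card T + 1\<close>.\<close>

lemma regular_seq_length_le_disconnected_link:
  fixes T :: "'x::finite set"
  assumes sc: "simplicial_complex \<Gamma>"
    and reg: "regular_seq (face_ideal \<Gamma> :: ('x, 'k::field) mpoly set) fs" "set fs \<subseteq> irrelevant_ideal"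
    and A: "a \<in> A" "\<And>v. v \<in> A \<Longrightarrow> v \<notin> T \<and> insert v T \<in> \<Gamma>"
    and b: "b \<notin> A" "b \<notin> T" "insert b T \<in> \<Gamma>"
    and comp: "\<And>u v. u \<in> A \<Longrightarrow> v \<notin> T \<Longrightarrow> insert u (insert v T) \<in> \<Gamma> \<Longrightarrow> v \<in> A"
  shows "length fs \<le> Suc (card T)"
proof -
  \<comment> \<open>The indicator of \<open>A\<close> on the link, with signs chosen such that the
    two contributions of an edge inside \<open>A\<close> cancel, whereas an edge with one end in
    \<open>A\<close> keeps a non-zero value.\<close>
  define e :: "'x set \<Rightarrow> 'k"
    where "e V = (\<Sum>v\<in>A. if V = insert v T then ksign v T else 0)" for V
  have e_insert: "e (insert v T) = (if v \<in> A then ksign v T else 0)" if "v \<notin> T" for v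
  proof -
    have "insert v T = insert w T \<longleftrightarrow> v = w" if "w \<in> A" for w
      using \<open>v \<notin> T\<close> A(2)[OF that] by auto
    then have "e (insert v T) = (\<Sum>w\<in>A. if v = w then ksign w T else 0)"
      unfolding e_def by (intro sum.cong) auto
    then show ?thesis by simp
  qed
  have supp: "\<forall>V. e V \<noteq> 0 \<longrightarrow> - (- T) \<subseteq> V"
  proof (intro allI impI)
    fix V assume V: "e V \<noteq> 0"
    have "\<exists>v\<in>A. V = insert v T"
    proof (rule ccontr)
      assume "\<not> ?thesis"
      then have "e V = 0" unfolding e_def by (intro sum.neutral) simp
      with V show False by simp
    qed
    then show "- (- T) \<subseteq> V" by auto
  qed
  have cob: "coboundary e (insert u (insert v T)) =
      (if u \<in> A then if v \<in> A then 0 else ksign v (insert u (insert v T)) * ksign u T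
       else if v \<in> A then ksign u (insert u (insert v T)) * ksign v T else 0)"
    if uv: "u \<notin> T" "v \<notin> T" "u \<noteq> v" for u v
  proof -
    let ?U = "insert u (insert v T)"
    have sets: "?U - {u} = insert v T" "?U - {v} = insert u T" using uv by auto
    have zero: "e (?U - {j}) = 0" if "j \<in> T" for j
      using supp that uv by blast
    have "coboundary e ?U = (\<Sum>j\<in>{u, v}. ksign j ?U * e (?U - {j}))"
      unfolding coboundary_def by (rule sum.mono_neutral_right) (use zero in auto)
    also have "\<dots> = ksign u ?U * e (?U - {u}) + ksign v ?U * e (?U - {v})"
      using uv(3) by simp
    finally have eq: "coboundary e ?U = ksign u ?U * e (insert v T) + ksign v ?U * e (insert u T)"
      unfolding sets .
    have "ksign u ?U * ksign v (?U - {u}) = - (ksign v ?U * ksign u (?U - {v}) :: 'k)"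
      by (rule ksign_swap) (use uv in auto)
    then have swap: "ksign u ?U * ksign v T = - (ksign v ?U * ksign u T :: 'k)"
      unfolding sets ksign_insert_self .
    show ?thesis
      unfolding eq e_insert[OF uv(1)] e_insert[OF uv(2)] using swap by simp
  qed
  \<comment> \<open>The test cycle is a pair of points of the link in different components.\<close>
  let ?U = "insert a (insert b T)"
  have a: "a \<notin> T" "insert a T \<in> \<Gamma>" using A(2)[OF A(1)] by simp_all
  have "a \<noteq> b" using A(1) b(1) by blast
  show ?thesis
  proof (rule regular_seq_length_le_cocycle[OF sc reg supp])
    show "card ?U = Suc (Suc (card T))" using a b(2) \<open>a \<noteq> b\<close> by simp
    show "coboundary e ?U \<noteq> 0" using cob[OF a(1) b(2) \<open>a \<noteq> b\<close>] A(1) b(1) by simp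
    have sets: "?U - {a} = insert b T" "?U - {b} = insert a T" using a b(2) \<open>a \<noteq> b\<close> by auto
    show "?U - {j} \<in> \<Gamma>" if j: "j \<in> ?U \<inter> - T" for j
    proof -
      have "j = a \<or> j = b" using j by blast
      then show ?thesis using sets a(2) b(3) by metis
    qed
    fix U assume U: "U \<in> \<Gamma>" "card U = Suc (Suc (card T))"
    show "coboundary e U = 0"
    proof (cases "T \<subseteq> U")
      case False
      then have "e (U - {j}) = 0" for j using supp by blast
      then show ?thesis by (simp add: coboundary_def)
    next
      case True
      then have "card (U - T) = 2" using U(2) by (simp add: card_Diff_subset)
      then obtain u v where uv: "U - T = {u, v}" "u \<noteq> v" by (auto simp: card_2_iff)
      then have eq: "U = insert u (insert v T)" "u \<notin> T" "v \<notin> T" using True by auto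
      have "u \<in> A \<longleftrightarrow> v \<in> A"
        using comp[of u v] comp[of v u] U(1) eq insert_commute[of u v T] by metis
      then show ?thesis unfolding eq(1) cob[OF eq(2,3) uv(2)] by simp
    qed
  qed
qed

section \<open>Induced cycles and the Alexander dual\<close>

lemma alexander_dual_iff: "F \<in> alexander_dual \<Delta> \<longleftrightarrow> - F \<notin> \<Delta>"
  by (auto simp: alexander_dual_def Compl_eq_Diff_UNIV double_diff)

text \<open>
  The cocycle is dual to the fan of triangles \<open>{v\<^sub>0, v\<^sub>i, v\<^sub>i\<^sub>+\<^sub>1}\<close> filling the cycle.  Consecutive
  triangles share one diagonal, so the signs can be chosen recursively.
\<close>

lemma regular_seq_length_le_induced_cycle:
  fixes adj :: "'x::finite \<Rightarrow> 'x \<Rightarrow> bool"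
  assumes cyc: "induced_cycle adj vs" "4 \<le> length vs" and graph: "simple_graph adj"
    and reg: "regular_seq (face_ideal (alexander_dual (clique_complex adj)) :: ('x, 'k::field) mpoly set) fs"
      "set fs \<subseteq> irrelevant_ideal"
  shows "length fs \<le> card (UNIV :: 'x set) - 3"
proof -
  let ?\<Gamma> = "alexander_dual (clique_complex adj)"
  define k where "k = length vs"
  define v where "v i = vs ! i" for i
  have k: "4 \<le> k" using cyc by (simp add: k_def)
  have v_eq: "v i = v j \<longleftrightarrow> i = j" if "i < k" "j < k" for i j
    using cyc that by (simp add: v_def k_def induced_cycle_def nth_eq_iff_index_eq)
  have v_adj: "adj (v i) (v j) \<longleftrightarrow> j = Suc i \<or> (i = 0 \<and> j = k - 1)" if "i < j" "j < k" for i j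
  proof -
    have "adj (v i) (v j) \<longleftrightarrow> j = Suc i mod k \<or> i = Suc j mod k"
      using cyc that by (simp add: v_def k_def induced_cycle_def)
    also have "Suc i mod k = Suc i" using that by simp
    also have "i = Suc j mod k \<longleftrightarrow> i = 0 \<and> j = k - 1"
      using that k by (cases "Suc j = k") auto
    finally show ?thesis .
  qed
  have sym: "adj x y \<Longrightarrow> adj y x" for x y
    using graph by (auto simp: simple_graph_def symp_def)
  define C where "C = v ` {..<k}"
  define tri where "tri i = {v 0, v i, v (Suc i)}" for i
  have mem: "U \<in> ?\<Gamma> \<longleftrightarrow> (\<exists>x\<in>- U. \<exists>y\<in>- U. x \<noteq> y \<and> \<not> adj x y)" for U
    by (auto simp: alexander_dual_iff clique_complex_def)
  \<comment> \<open>The diagonal from \<open>v 0\<close> to \<open>v l\<close> lies in the triangles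
    \<open>tri l\<close> and \<open>tri (l - 1)\<close>, completed by \<open>v (Suc l)\<close> and
    \<open>v (l - 1)\<close>. As signs are their own inverses, \<open>\<sigma> l\<close> is the
    ratio of the two incidence signs, and \<open>\<epsilon>\<close> is chosen to make the
    contributions cancel.\<close>
  define \<sigma> :: "nat \<Rightarrow> 'k"
    where "\<sigma> l = ksign (v (Suc l)) (- {v 0, v l}) * ksign (v (l - 1)) (- {v 0, v l})" for l
  define \<epsilon> :: "nat \<Rightarrow> 'k" where "\<epsilon> = rec_nat 1 (\<lambda>n r. - \<sigma> (Suc n) * r)"
  have \<epsilon>_Suc: "\<epsilon> (Suc n) = - \<sigma> (Suc n) * \<epsilon> n" for n by (simp add: \<epsilon>_def)
  have \<epsilon>_nonzero: "\<epsilon> n \<noteq> 0" for n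
    by (induction n) (simp_all add: \<epsilon>_Suc \<sigma>_def, simp add: \<epsilon>_def)
  \<comment> \<open>Deleting a vertex of a set enlarges its complement. Hence the coboundary at the
    complement of a pair collects the fan triangles containing that pair.\<close>
  define e :: "'x set \<Rightarrow> 'k"
    where "e V = (\<Sum>i\<in>{1..k-2}. if V = - tri i then \<epsilon> i else 0)" for V
  have tri_eq: "tri i = tri j \<longleftrightarrow> i = j" if "i \<in> {1..k-2}" "j \<in> {1..k-2}" for i j
  proof
    assume eq: "tri i = tri j"
    have "v i \<in> tri j" "v (Suc i) \<in> tri j" unfolding eq[symmetric] by (auto simp: tri_def)
    then show "i = j" using that k by (auto simp: tri_def v_eq)
  qed simp
  have e_tri: "e (- tri i) = \<epsilon> i" if "i \<in> {1..k-2}" for i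
  proof -
    have "e (- tri i) = (\<Sum>j\<in>{1..k-2}. if i = j then \<epsilon> j else 0)"
      unfolding e_def using tri_eq that by (intro sum.cong) auto
    then show ?thesis using that by simp
  qed
  have e_nonzero: "\<exists>i\<in>{1..k-2}. V = - tri i" if "e V \<noteq> 0" for V
  proof (rule ccontr)
    assume "\<not> ?thesis"
    then have "e V = 0" unfolding e_def by (intro sum.neutral) simp
    with that show False by simp
  qed
  have supp: "\<forall>V. e V \<noteq> 0 \<longrightarrow> - C \<subseteq> V"
  proof (intro allI impI)
    fix V assume "e V \<noteq> 0"
    then obtain i where i: "i \<in> {1..k-2}" "V = - tri i" using e_nonzero by blast
    then have "tri i \<subseteq> C" using k by (auto simp: tri_def C_def)
    then show "- C \<subseteq> V" using i by auto
  qed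
  have diagonal: "coboundary e (- {v 0, v l}) = 0" if l: "2 \<le> l" "l \<le> k - 2" for l
  proof -
    let ?U = "- {v 0, v l}"
    have ne: "v (Suc l) \<noteq> v (l - 1)" using l k by (subst v_eq) auto
    have U1: "?U - {v (Suc l)} = - tri l" by (auto simp: tri_def)
    have "Suc (l - 1) = l" using l by simp
    then have U2: "?U - {v (l - 1)} = - tri (l - 1)" by (auto simp: tri_def)
    have zero: "e (?U - {j}) = 0" if j: "j \<in> ?U - {v (Suc l), v (l - 1)}" for j
    proof (rule ccontr)
      assume "e (?U - {j}) \<noteq> 0"
      then obtain i where i: "i \<in> {1..k-2}" "?U - {j} = - tri i" using e_nonzero by blast
      have "tri i = - (?U - {j})" unfolding i(2) by simp
      then have tri: "tri i = {v 0, v l, j}" by (simp add: insert_commute)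
      then have "v l \<in> tri i" by simp
      moreover have "l < k" "0 < k" "i < k" "Suc i < k" "l \<noteq> 0" using i(1) l k by auto
      ultimately have "l = i \<or> l = Suc i" by (simp add: tri_def v_eq)
      then show False
      proof
        assume "l = i"
        then have "v (Suc l) \<in> {v 0, v l, j}" unfolding tri[symmetric] by (simp add: tri_def)
        then show False using j l k by (auto simp: v_eq)
      next
        assume "l = Suc i"
        then have "v (l - 1) \<in> {v 0, v l, j}" unfolding tri[symmetric] by (simp add: tri_def)
        then show False using j l k by (auto simp: v_eq)
      qed
    qed
    have "coboundary e ?U = (\<Sum>j\<in>{v (Suc l), v (l - 1)}. ksign j ?U * e (?U - {j}))"
      unfolding coboundary_def
    proof (rule sum.mono_neutral_right)
      show "{v (Suc l), v (l - 1)} \<subseteq> ?U" using l k by (auto simp: v_eq)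
    qed (use zero in auto)
    also have "\<dots> = ksign (v (Suc l)) ?U * e (- tri l) + ksign (v (l - 1)) ?U * e (- tri (l - 1))"
      using ne by (simp add: U1 U2 del: One_nat_def)
    also have "\<dots> = ksign (v (Suc l)) ?U * \<epsilon> l + ksign (v (l - 1)) ?U * \<epsilon> (l - 1)"
    proof -
      have "l \<in> {1..k-2}" "l - 1 \<in> {1..k-2}" using l by auto
      then show ?thesis by (simp only: e_tri)
    qed
    also have "\<epsilon> l = - \<sigma> l * \<epsilon> (l - 1)" using \<epsilon>_Suc[of "l - 1"] l by simp
    also have "ksign (v (Suc l)) ?U * (- \<sigma> l * \<epsilon> (l - 1))
        = - ((ksign (v (Suc l)) ?U * ksign (v (Suc l)) ?U) * (ksign (v (l - 1)) ?U * \<epsilon> (l - 1)))"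
      by (simp add: \<sigma>_def ac_simps)
    finally show ?thesis by (simp add: ksign_square)
  qed
  \<comment> \<open>The cycle edge \<open>{v 0, v 1}\<close> lies in only one fan triangle, so
    nothing cancels. Adding any other cycle vertex to it creates a non-adjacent pair, since the
    cycle has at least four vertices; so the required sets are faces of the dual.\<close>
  let ?U = "- {v 0, v 1}"
  have U2: "?U - {v 2} = - tri 1" by (auto simp: tri_def numeral_2_eq_2)
  have cardU: "card ?U = Suc (card (UNIV :: 'x set) - 3)"
  proof -
    have "v 0 \<noteq> v 1" using k by (subst v_eq) auto
    then have "card ?U = card (UNIV :: 'x set) - 2" by (simp add: Compl_eq_Diff_UNIV card_Diff_subset)
    moreover have "4 \<le> card (UNIV :: 'x set)"
    proof -
      have "inj_on v {..<k}" by (rule inj_onI) (simp add: v_eq)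
      then have "k = card C" by (simp add: C_def card_image)
      also have "\<dots> \<le> card (UNIV :: 'x set)" by (intro card_mono) auto
      finally show ?thesis using k by simp
    qed
    ultimately show ?thesis by simp
  qed
  show ?thesis
  proof (rule regular_seq_length_le_cocycle[OF simplicial_complex_alexander_dual reg supp _ cardU])
    show "simplicial_complex (clique_complex adj)" by (rule simplicial_complex_clique_complex)
    have zero: "e (?U - {j}) = 0" if j: "j \<in> ?U - {v 2}" for j
    proof (rule ccontr)
      assume "e (?U - {j}) \<noteq> 0"
      then obtain i where i: "i \<in> {1..k-2}" "?U - {j} = - tri i" using e_nonzero by blast
      have "tri i = - (?U - {j})" unfolding i(2) by simp
      then have tri: "tri i = {v 0, v 1, j}" by (simp add: insert_commute)
      then have "v 1 \<in> tri i" by simp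
      moreover have "1 < k" "0 < k" "i < k" "Suc i < k" "1 \<le> i" using i(1) k by auto
      ultimately have "i = 1" by (simp add: tri_def v_eq)
      then have "v 2 \<in> {v 0, v 1, j}" unfolding tri[symmetric] by (simp add: tri_def numeral_2_eq_2)
      then show False using j k by (auto simp: v_eq)
    qed
    have "coboundary e ?U = (\<Sum>j\<in>{v 2}. ksign j ?U * e (?U - {j}))"
      unfolding coboundary_def
    proof (rule sum.mono_neutral_right)
      show "{v 2} \<subseteq> ?U" using k by (simp add: v_eq)
    qed (use zero in auto)
    also have "\<dots> = ksign (v 2) ?U * \<epsilon> 1"
      using k by (simp add: U2 e_tri del: One_nat_def)
    finally show "coboundary e ?U \<noteq> 0" by (simp add: \<epsilon>_nonzero)
    show "?U - {j} \<in> ?\<Gamma>" if j: "j \<in> ?U \<inter> C" for j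
    proof -
      obtain l where l: "j = v l" "l < k" using j by (auto simp: C_def)
      have "l \<noteq> 0" "l \<noteq> 1" using j unfolding l(1) by (metis ComplD IntE insertI1 insertI2)+
      show ?thesis
      proof (cases "l = k - 1")
        case True
        then have "v 1 \<noteq> v l" "\<not> adj (v 1) (v l)" using l k by (simp_all add: v_eq v_adj)
        then show ?thesis unfolding mem l(1) by blast
      next
        case False
        then have "v 0 \<noteq> v l" "\<not> adj (v 0) (v l)"
          using l k \<open>l \<noteq> 0\<close> \<open>l \<noteq> 1\<close> by (simp_all add: v_eq v_adj)
        then show ?thesis unfolding mem l(1) by blast
      qed
    qed
    fix U assume U: "U \<in> ?\<Gamma>"
    show "coboundary e U = 0"
    proof (cases "\<forall>j\<in>U. e (U - {j}) = 0")
      \<comment> \<open>The complement of \<open>U\<close> is a pair inside a fan triangle. If it is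
        a cycle edge, \<open>U\<close> is not in the dual; otherwise it is a diagonal, where the
        signs cancel.\<close>
      case False
      then obtain j i where ji: "j \<in> U" "i \<in> {1..k-2}" "U - {j} = - tri i"
        using e_nonzero by blast
      then have "j \<in> tri i" by auto
      have U_eq: "U = - (tri i - {j})" using ji by auto
      have lt: "1 \<le> i" "Suc i < k" using ji(2) k by auto
      have "v 0 \<noteq> v i" "v 0 \<noteq> v (Suc i)" "v i \<noteq> v (Suc i)" using lt by (simp_all add: v_eq)
      then have "tri i - {v 0} = {v i, v (Suc i)}" "tri i - {v i} = {v 0, v (Suc i)}"
        "tri i - {v (Suc i)} = {v 0, v i}"
        by (auto simp: tri_def)
      moreover have "j = v 0 \<or> j = v i \<or> j = v (Suc i)" using \<open>j \<in> tri i\<close> by (simp add: tri_def)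
      ultimately consider "j = v 0" "U = - {v i, v (Suc i)}"
        | "j = v i" "U = - {v 0, v (Suc i)}" | "j = v (Suc i)" "U = - {v 0, v i}"
        using U_eq by metis
      then show ?thesis
      proof cases
        case 1
        have "adj (v i) (v (Suc i))" using lt by (simp add: v_adj)
        then have "U \<notin> ?\<Gamma>" using sym unfolding 1 mem by auto
        with U show ?thesis by simp
      next
        case 2
        have "Suc i \<noteq> k - 1"
        proof
          assume "Suc i = k - 1"
          then have "adj (v 0) (v (Suc i))" using lt by (simp add: v_adj)
          then have "U \<notin> ?\<Gamma>" using sym unfolding 2 mem by auto
          with U show False by simp
        qed
        then show ?thesis unfolding 2 using lt by (intro diagonal) auto
      next
        case 3
        have "i \<noteq> 1"
        proof
          assume "i = 1"
          then have "adj (v 0) (v i)" using lt by (simp add: v_adj)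
          then have "U \<notin> ?\<Gamma>" using sym unfolding 3 mem by auto
          with U show False by simp
        qed
        then show ?thesis unfolding 3 using lt by (intro diagonal) auto
      qed
    qed (simp add: coboundary_def)
  qed
qed

section \<open>Weak connectedness as reachability\<close>

text \<open>The condition with \<open>Suc\<close> expresses codimension one without truncated
  subtraction; for \<open>d = 0\<close> there are no steps.\<close>

definition ridge_steps :: "'x set set \<Rightarrow> nat \<Rightarrow> ('x set \<times> 'x set) set" where
  "ridge_steps \<Gamma> d =
    {(F, G). F \<in> \<Gamma> \<and> G \<in> \<Gamma> \<and> card F = d \<and> card G = d \<and> Suc (card (F \<inter> G)) = d}"

lemma face_extends:
  fixes T :: "'x::finite set"
  assumes sc: "simplicial_complex \<Gamma>" and large: "\<forall>H\<in>facets \<Gamma>. d \<le> card H"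
    and T: "T \<in> \<Gamma>" "card T \<le> d"
  obtains G where "G \<in> \<Gamma>" "T \<subseteq> G" "card G = d"
proof -
  obtain H where H: "H \<in> facets \<Gamma>" "T \<subseteq> H" using facet_superset[OF T(1)] by blast
  obtain G where G: "T \<subseteq> G" "G \<subseteq> H" "card G = d"
    using exists_subset_between[OF T(2) bspec[OF large H(1)] H(2)] by auto
  have "H \<in> \<Gamma>" using H(1) by (simp add: facets_def)
  then have "G \<in> \<Gamma>" using sc G(2) unfolding simplicial_complex_def by blast
  with G show thesis using that by blast
qed

lemma rtrancl_imp_list:
  assumes "(x, y) \<in> r\<^sup>*"
  shows "\<exists>xs. xs \<noteq> [] \<and> hd xs = x \<and> last xs = y \<and> successively (\<lambda>a b. (a, b) \<in> r) xs"
  using assms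
proof (induction rule: converse_rtrancl_induct)
  case base
  show ?case by (rule exI[of _ "[y]"]) simp
next
  case (step x z)
  then obtain xs where "xs \<noteq> []" "hd xs = z" "last xs = y" "successively (\<lambda>a b. (a, b) \<in> r) xs"
    by blast
  with step(1) show ?case
    by (intro exI[of _ "x # xs"]) (simp add: successively_Cons)
qed

lemma list_imp_rtrancl:
  assumes "xs \<noteq> []" "successively (\<lambda>a b. (a, b) \<in> r) xs"
  shows "(hd xs, last xs) \<in> r\<^sup>*"
  using assms
proof (induction xs)
  case (Cons x xs)
  show ?case
  proof (cases "xs = []")
    case False
    then have "(x, hd xs) \<in> r" "(hd xs, last xs) \<in> r\<^sup>*"
      using Cons by (simp_all add: successively_Cons)
    then show ?thesis using False by simp
  qed simp
qed simp

text \<open>Every facet has at least \<open>card F\<close> vertices, so the skeleton is pure and its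
  facets are the faces of size \<open>card F\<close>. Chains of facets then become
  reachability.\<close>

lemma weakly_connected_iff:
  fixes \<Gamma> :: "'x::finite set set"
  assumes sc: "simplicial_complex \<Gamma>" and F: "F \<in> facets \<Gamma>"
    and min: "\<forall>H\<in>facets \<Gamma>. card F \<le> card H"
  shows "weakly_connected \<Gamma> \<longleftrightarrow> (\<forall>G\<in>\<Gamma>. \<forall>G'\<in>\<Gamma>. card G = card F \<longrightarrow> card G' = card F \<longrightarrow>
    (G, G') \<in> (ridge_steps \<Gamma> (card F))\<^sup>*)"
proof -
  define d where "d = card F"
  let ?S = "skeleton (complex_indim \<Gamma>) \<Gamma>"
  have "complex_indim \<Gamma> = int d - 1"
    unfolding complex_indim_def
  proof (rule Min_eqI)
    show "int d - 1 \<in> face_dim ` facets \<Gamma>" using F by (auto simp: face_dim_def d_def)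
    fix y assume "y \<in> face_dim ` facets \<Gamma>"
    then obtain H where "H \<in> facets \<Gamma>" "y = face_dim H" by blast
    moreover from this have "d \<le> card H" using min unfolding d_def by blast
    ultimately show "int d - 1 \<le> y" by (simp add: face_dim_def)
  qed simp
  then have S: "G \<in> ?S \<longleftrightarrow> G \<in> \<Gamma> \<and> card G \<le> d" for G
    by (auto simp: skeleton_def face_dim_def)
  have "F \<in> \<Gamma>" using F by (simp add: facets_def)
  have facets: "G \<in> facets ?S \<longleftrightarrow> G \<in> \<Gamma> \<and> card G = d" for G
  proof
    assume G: "G \<in> facets ?S"
    then have "G \<in> \<Gamma>" "card G \<le> d" unfolding facets_def using S by auto
    then obtain H where H: "H \<in> \<Gamma>" "G \<subseteq> H" "card H = d"
      using face_extends[OF sc, of d G] min unfolding d_def by blast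
    then have "H \<in> ?S" unfolding S by simp
    then have "H = G" using G H(2) unfolding facets_def by blast
    with H show "G \<in> \<Gamma> \<and> card G = d" by simp
  next
    assume G: "G \<in> \<Gamma> \<and> card G = d"
    have "H = G" if "H \<in> ?S" "G \<subseteq> H" for H
    proof -
      have "card H \<le> card G" using that(1) G unfolding S by simp
      with that(2) show ?thesis using card_seteq[of H G] by simp
    qed
    moreover have "G \<in> ?S" using G unfolding S by simp
    ultimately show "G \<in> facets ?S" unfolding facets_def by blast
  qed
  have dim: "complex_dim ?S = int d - 1"
    unfolding complex_dim_def
  proof (rule Max_eqI)
    show "int d - 1 \<in> face_dim ` ?S"
      using \<open>F \<in> \<Gamma>\<close> S[of F] by (auto simp: face_dim_def d_def)
    fix y assume "y \<in> face_dim ` ?S"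
    then obtain G where "G \<in> ?S" "y = face_dim G" by blast
    then show "y \<le> int d - 1" using S[of G] by (simp add: face_dim_def)
  qed simp
  have step: "(G, G') \<in> ridge_steps \<Gamma> d \<longleftrightarrow>
      G \<in> facets ?S \<and> G' \<in> facets ?S \<and> int (card (G \<inter> G')) = complex_dim ?S" for G G'
    unfolding facets dim ridge_steps_def by auto
  have chain: "(\<exists>Fs. Fs \<noteq> [] \<and> hd Fs = G \<and> last Fs = G' \<and> set Fs \<subseteq> facets ?S \<and>
        (\<forall>i. Suc i < length Fs \<longrightarrow> int (card (Fs ! i \<inter> Fs ! Suc i)) = complex_dim ?S))
      \<longleftrightarrow> (G, G') \<in> (ridge_steps \<Gamma> d)\<^sup>*" (is "?L \<longleftrightarrow> ?R")
    if GG': "G \<in> facets ?S" "G' \<in> facets ?S" for G G'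
  proof
    assume ?L
    then obtain Fs where Fs: "Fs \<noteq> []" "hd Fs = G" "last Fs = G'" "set Fs \<subseteq> facets ?S"
      "\<And>i. Suc i < length Fs \<Longrightarrow> int (card (Fs ! i \<inter> Fs ! Suc i)) = complex_dim ?S" by blast
    have "successively (\<lambda>a b. (a, b) \<in> ridge_steps \<Gamma> d) Fs"
      unfolding successively_conv_nth step
      using Fs(4,5) by (meson Suc_lessD nth_mem subsetD)
    then show ?R using list_imp_rtrancl[OF Fs(1)] Fs(2,3) by metis
  next
    assume ?R
    then obtain Fs where Fs: "Fs \<noteq> []" "hd Fs = G" "last Fs = G'"
      "successively (\<lambda>a b. (a, b) \<in> ridge_steps \<Gamma> d) Fs"
      using rtrancl_imp_list[of G G'] by blast
    have steps: "(Fs ! i, Fs ! Suc i) \<in> ridge_steps \<Gamma> d" if "Suc i < length Fs" for i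
      using Fs(4) that unfolding successively_conv_nth by blast
    have "Fs ! i \<in> facets ?S" if "i < length Fs" for i
    proof (cases i)
      case 0
      then show ?thesis using Fs(1,2) GG'(1) by (simp add: hd_conv_nth)
    next
      case (Suc i')
      then show ?thesis using steps[of i'] that unfolding step by simp
    qed
    then have "set Fs \<subseteq> facets ?S" by (auto simp: in_set_conv_nth)
    with Fs steps show ?L unfolding step by blast
  qed
  have "weakly_connected \<Gamma> \<longleftrightarrow>
      (\<forall>G\<in>facets ?S. \<forall>G'\<in>facets ?S. (G, G') \<in> (ridge_steps \<Gamma> d)\<^sup>*)"
    unfolding weakly_connected_def strongly_connected_def using chain by simp
  then show ?thesis using facets unfolding d_def by auto
qed

text \<open>Induction on a common face \<open>T\<close>, from large to small. With at least
  \<open>d - 1\<close> common vertices the faces are equal or adjacent. Otherwise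
  \<open>d > card T + 1\<close> forces the link of \<open>T\<close> to be connected, and each link
  edge is bridged by the induction hypothesis. The empty face finishes the argument.\<close>

lemma initially_CM_imp_weakly_connected:
  fixes \<Gamma> :: "'x::finite set set"
  assumes sc: "simplicial_complex \<Gamma>" and F: "F \<in> facets \<Gamma>"
    and min: "\<forall>H\<in>facets \<Gamma>. card F \<le> card H"
    and CM: "initially_CM TYPE('k::field) \<Gamma>"
  shows "weakly_connected \<Gamma>"
proof -
  define d where "d = card F"
  obtain fs :: "('x, 'k) mpoly list" where fs: "set fs \<subseteq> irrelevant_ideal" "length fs = d"
    "regular_seq (face_ideal \<Gamma>) fs"
    using CM unfolding initially_CM_iff_regular_seq[OF sc F min] d_def by blast
  have connected: "(G, G') \<in> (ridge_steps \<Gamma> d)\<^sup>*"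
    if "T \<subseteq> G" "T \<subseteq> G'" "G \<in> \<Gamma>" "G' \<in> \<Gamma>" "card G = d" "card G' = d" for T G G'
    using that
  proof (induction "d - card T" arbitrary: T G G' rule: less_induct)
    case less
    have TG: "T \<in> \<Gamma>" using less.prems(1,3) sc unfolding simplicial_complex_def by blast
    have le: "card T \<le> card (G \<inter> G')" using less.prems(1,2) by (intro card_mono) auto
    have le': "card (G \<inter> G') \<le> d" using less.prems(5) card_mono[of G "G \<inter> G'"] by simp
    show ?case
    proof (cases "d \<le> Suc (card T)")
      case True
      show ?thesis
      proof (cases "card (G \<inter> G') = d")
        case True
        have "G \<inter> G' = G" by (rule card_subset_eq) (use True less.prems(5) in simp_all)
        moreover have "G \<inter> G' = G'" by (rule card_subset_eq) (use True less.prems(6) in simp_all)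
        ultimately show ?thesis by simp
      next
        case False
        then have "Suc (card (G \<inter> G')) = d" using \<open>d \<le> Suc (card T)\<close> le le' by simp
        then have "(G, G') \<in> ridge_steps \<Gamma> d" using less.prems by (simp add: ridge_steps_def)
        then show ?thesis by simp
      qed
    next
      case False
      \<comment> \<open>Reachability is transferred from faces to vertices of the link of
        \<open>T\<close>. Once shown closed under link edges, \<open>A\<close> is a union of
        components, to which the depth bound for disconnected links applies.\<close>
      define A where "A = {u. u \<notin> T \<and> insert u T \<in> \<Gamma> \<and>
        (\<exists>H\<in>\<Gamma>. card H = d \<and> insert u T \<subseteq> H \<and> (G, H) \<in> (ridge_steps \<Gamma> d)\<^sup>*)}"
      have IH: "(H, H') \<in> (ridge_steps \<Gamma> d)\<^sup>*"
        if "u \<notin> T" "insert u T \<subseteq> H" "insert u T \<subseteq> H'" "H \<in> \<Gamma>" "H' \<in> \<Gamma>" "card H = d" "card H' = d"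
        for u H H'
        using that False by (intro less.hyps[of "insert u T"]) auto
      have "card T < card G" "card T < card G'" using False less.prems by auto
      then have "\<not> G \<subseteq> T" "\<not> G' \<subseteq> T" by (meson card_mono finite leD)+
      then obtain a b where a: "a \<in> G" "a \<notin> T" and b: "b \<in> G'" "b \<notin> T" by blast
      have sub: "insert a T \<subseteq> G" "insert b T \<subseteq> G'" using a b less.prems(1,2) by auto
      then have faces: "insert a T \<in> \<Gamma>" "insert b T \<in> \<Gamma>"
        using less.prems(3,4) sc unfolding simplicial_complex_def by blast+
      have "a \<in> A" unfolding A_def using a(2) faces(1) sub(1) less.prems(3,5) by blast
      have "v \<in> A" if uv: "u \<in> A" "v \<notin> T" "insert u (insert v T) \<in> \<Gamma>" for u v
      proof -
        obtain H where H: "u \<notin> T" "H \<in> \<Gamma>" "card H = d" "insert u T \<subseteq> H" "(G, H) \<in> (ridge_steps \<Gamma> d)\<^sup>*"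
          using uv(1) unfolding A_def by blast
        have "card (insert u (insert v T)) \<le> d"
          using False by (simp add: card_insert_if)
        then obtain H' where H': "H' \<in> \<Gamma>" "insert u (insert v T) \<subseteq> H'" "card H' = d"
          using face_extends[OF sc, of d "insert u (insert v T)"] min uv(3) unfolding d_def by blast
        \<comment> \<open>Both faces contain \<open>insert u T\<close>, a larger common face than
          \<open>T\<close>.\<close>
        have "(H, H') \<in> (ridge_steps \<Gamma> d)\<^sup>*"
          by (rule IH[OF H(1,4) _ H(2) H'(1) H(3) H'(3)]) (use H'(2) in blast)
        with H(5) have "(G, H') \<in> (ridge_steps \<Gamma> d)\<^sup>*" by (rule rtrancl_trans)
        moreover have "insert v T \<subseteq> H'" using H'(2) by blast
        moreover from this have "insert v T \<in> \<Gamma>"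
          using H'(1) sc unfolding simplicial_complex_def by blast
        ultimately show ?thesis unfolding A_def using uv(2) H'(1,3) by blast
      qed
      note closed = this
      have "b \<in> A"
      proof (rule ccontr)
        assume "b \<notin> A"
        have "v \<notin> T \<and> insert v T \<in> \<Gamma>" if "v \<in> A" for v using that unfolding A_def by simp
        with regular_seq_length_le_disconnected_link[OF sc fs(3,1) \<open>a \<in> A\<close>, of T b]
        have "length fs \<le> Suc (card T)" using \<open>b \<notin> A\<close> b(2) faces(2) closed by blast
        then show False using fs(2) False by simp
      qed
      then obtain H where H: "H \<in> \<Gamma>" "card H = d" "insert b T \<subseteq> H" "(G, H) \<in> (ridge_steps \<Gamma> d)\<^sup>*"
        unfolding A_def by blast
      have "(H, G') \<in> (ridge_steps \<Gamma> d)\<^sup>*"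
        by (rule IH[OF b(2) H(3) sub(2) H(1) less.prems(4) H(2) less.prems(6)])
      with H(4) show ?thesis by (rule rtrancl_trans)
    qed
  qed
  show ?thesis
    unfolding weakly_connected_iff[OF sc F min] using connected[of "{}"] unfolding d_def by simp
qed

section \<open>Chordal graphs\<close>

definition clique :: "('x \<Rightarrow> 'x \<Rightarrow> bool) \<Rightarrow> 'x set \<Rightarrow> bool" where
  "clique adj S \<longleftrightarrow> (\<forall>u\<in>S. \<forall>v\<in>S. u \<noteq> v \<longrightarrow> adj u v)"

lemma mem_clique_complex: "S \<in> clique_complex adj \<longleftrightarrow> clique adj S"
  by (simp add: clique_complex_def clique_def)

lemma clique_subset: "clique adj S \<Longrightarrow> T \<subseteq> S \<Longrightarrow> clique adj T"
  unfolding clique_def by blast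

text \<open>The sides may be disconnected and \<open>S\<close> may be empty, so disconnected graphs
  are covered and components can be moved from one side to the other.\<close>

definition separation :: "('x \<Rightarrow> 'x \<Rightarrow> bool) \<Rightarrow> 'x set \<Rightarrow> 'x set \<Rightarrow> 'x set \<Rightarrow> 'x set \<Rightarrow> bool" where
  "separation adj Y A S B \<longleftrightarrow> Y = A \<union> S \<union> B \<and> A \<inter> S = {} \<and> A \<inter> B = {} \<and> S \<inter> B = {} \<and>
    A \<noteq> {} \<and> B \<noteq> {} \<and> (\<forall>a\<in>A. \<forall>b\<in>B. \<not> adj a b \<and> \<not> adj b a)"

lemma separation_sym: "separation adj Y A S B \<Longrightarrow> separation adj Y B S A"
  unfolding separation_def by blast

definition induced_path :: "('x \<Rightarrow> 'x \<Rightarrow> bool) \<Rightarrow> (nat \<Rightarrow> 'x) \<Rightarrow> nat \<Rightarrow> bool" where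
  "induced_path adj p m \<longleftrightarrow> (\<forall>i j. i < j \<longrightarrow> j \<le> m \<longrightarrow> p i \<noteq> p j \<and> (adj (p i) (p j) \<longleftrightarrow> j = Suc i))"

text \<open>A shortest walk is an induced path.\<close>

lemma induced_path_exists:
  assumes "(x, y) \<in> {(u, v). u \<in> W \<and> v \<in> W \<and> adj u v}\<^sup>*" "x \<in> W"
  obtains p m where "induced_path adj p m" "p 0 = x" "p m = y" "\<And>i. i \<le> m \<Longrightarrow> p i \<in> W"
proof -
  let ?r = "{(u, v). u \<in> W \<and> v \<in> W \<and> adj u v}"
  define walk where "walk ps \<longleftrightarrow> ps \<noteq> [] \<and> hd ps = x \<and> last ps = y \<and>
    successively (\<lambda>u v. (u, v) \<in> ?r) ps" for ps
  obtain ps0 where "walk ps0" using rtrancl_imp_list[OF assms(1)] unfolding walk_def by blast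
  from ex_has_least_nat[of walk, OF this, of length] obtain ps
    where ps: "walk ps" and least: "\<And>qs. walk qs \<Longrightarrow> length ps \<le> length qs"
    by blast
  have ps': "ps \<noteq> []" "hd ps = x" "last ps = y" "successively (\<lambda>u v. (u, v) \<in> ?r) ps"
    using ps by (simp_all add: walk_def)
  have steps: "(ps ! i, ps ! Suc i) \<in> ?r" if "Suc i < length ps" for i
    using ps'(4) that unfolding successively_conv_nth by blast
  \<comment> \<open>Positions \<open>n\<close> to \<open>j - 1\<close> are cut out:
    \<open>n = i\<close> removes a repetition, \<open>n = Suc i\<close> uses a chord. The case
    \<open>n = 0\<close> replaces the starting point.\<close>
  have shortcut: "walk (take n ps @ drop j ps)"
    if n: "n \<le> length ps" "j < length ps"
      and join: "if n = 0 then ps ! j = x else (ps ! (n - 1), ps ! j) \<in> ?r" for n j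
  proof -
    have "successively (\<lambda>u v. (u, v) \<in> ?r) (take i ps @ drop i ps)" for i
      using ps'(4) by (simp only: append_take_drop_id)
    then have "successively (\<lambda>u v. (u, v) \<in> ?r) (take n ps)"
      "successively (\<lambda>u v. (u, v) \<in> ?r) (drop j ps)"
      unfolding successively_append_iff by blast+
    moreover have "drop j ps \<noteq> []" "hd (drop j ps) = ps ! j" "last (drop j ps) = y"
      using n ps' by (simp_all add: hd_drop_conv_nth)
    moreover have "hd (take n ps) = x" "last (take n ps) = ps ! (n - 1)" "take n ps \<noteq> []" if "n \<noteq> 0"
      using that n ps' by (simp_all add: last_conv_nth min_def)
    ultimately show ?thesis
      using join unfolding walk_def successively_append_iff by (cases "n = 0") auto
  qed
  define m where "m = length ps - 1"
  have len: "length ps = Suc m" using ps'(1) by (simp add: m_def)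
  have ends: "ps ! 0 = x" "ps ! m = y"
    using ps' by (simp_all add: m_def hd_conv_nth last_conv_nth)
  have path: "ps ! i \<noteq> ps ! j \<and> (adj (ps ! i) (ps ! j) \<longleftrightarrow> j = Suc i)" if ij: "i < j" "j \<le> m" for i j
  proof -
    have mem: "ps ! i \<in> W \<and> ps ! Suc i \<in> W" if "i < m" for i using steps[of i] that by (simp add: len)
    have W: "ps ! i \<in> W" "ps ! j \<in> W"
      using mem[of i] mem[of "j - 1"] ij by auto
    have "ps ! i \<noteq> ps ! j"
    proof
      assume eq: "ps ! i = ps ! j"
      have "walk (take i ps @ drop j ps)"
      proof (rule shortcut)
        show "if i = 0 then ps ! j = x else (ps ! (i - 1), ps ! j) \<in> ?r"
          using steps[of "i - 1"] ij len ends(1) eq by (cases i) auto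
      qed (use ij len in auto)
      then show False using least[of "take i ps @ drop j ps"] ij len by simp
    qed
    moreover have "j = Suc i" if "adj (ps ! i) (ps ! j)"
    proof (rule ccontr)
      assume "j \<noteq> Suc i"
      have "walk (take (Suc i) ps @ drop j ps)"
        by (rule shortcut) (use ij len W that in auto)
      then show False using least[of "take (Suc i) ps @ drop j ps"] ij len \<open>j \<noteq> Suc i\<close> by simp
    qed
    moreover have "adj (ps ! i) (ps ! Suc i)" if "j = Suc i"
      using steps[of i] ij len that by simp
    ultimately show ?thesis by blast
  qed
  have inW: "ps ! i \<in> W" if "i \<le> m" for i
  proof (cases i)
    case 0
    then show ?thesis using assms(2) ends(1) by simp
  next
    case (Suc i')
    then show ?thesis using steps[of i'] that by (simp add: len)
  qed
  show thesis
    by (rule that[of "(!) ps" m]) (use path inW ends in \<open>auto simp: induced_path_def\<close>)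
qed

lemma induced_cycle_of_paths:
  assumes graph: "simple_graph adj"
    and P: "induced_path adj p m" "p 0 = x" "p m = y" "2 \<le> m"
    and Q: "induced_path adj q l" "q 0 = x" "q l = y" "2 \<le> l"
    and apart: "\<And>i j. 0 < i \<Longrightarrow> i < m \<Longrightarrow> 0 < j \<Longrightarrow> j < l \<Longrightarrow> p i \<noteq> q j \<and> \<not> adj (p i) (q j)"
  shows "\<exists>vs. 4 \<le> length vs \<and> induced_cycle adj vs"
proof -
  define k where "k = m + l"
  \<comment> \<open>The path \<open>p\<close> runs from \<open>x\<close> to \<open>y\<close> and
    \<open>q\<close> returns. Both descriptions give \<open>y\<close> at \<open>i = m\<close>; the
    index \<open>k\<close>, which would give \<open>x\<close> again, is excluded.\<close>
  define c where "c i = (if i \<le> m then p i else q (k - i))" for i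
  have sym: "adj u v \<longleftrightarrow> adj v u" and irrefl: "\<not> adj u u" for u v
    using graph by (auto simp: simple_graph_def symp_def irreflp_def)
  have c_q: "c i = q (k - i)" if "m \<le> i" for i
    using that P(3) Q(3) by (cases "i = m") (simp_all add: c_def k_def)
  have path_p: "p i \<noteq> p j" "adj (p i) (p j) \<longleftrightarrow> j = Suc i" if "i < j" "j \<le> m" for i j
    using P(1) that unfolding induced_path_def by blast+
  have path_q: "q i \<noteq> q j" "adj (q i) (q j) \<longleftrightarrow> j = Suc i" if "i < j" "j \<le> l" for i j
    using Q(1) that unfolding induced_path_def by blast+
  have main: "c i \<noteq> c j \<and> (adj (c i) (c j) \<longleftrightarrow> j = Suc i \<or> (i = 0 \<and> j = k - 1))"
    if ij: "i < j" "j < k" for i j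
  proof -
    consider "j \<le> m" | "m \<le> i" | "i = 0" "m < j" | "0 < i" "i < m" "m < j"
      using ij by linarith
    then show ?thesis
    proof cases
      case 1
      then have "c i = p i" "c j = p j" "j \<noteq> k - 1" using ij Q(4) by (auto simp: c_def k_def)
      then show ?thesis using path_p[OF ij(1) 1] by simp
    next
      case 2
      then have c: "c i = q (k - i)" "c j = q (k - j)" using ij by (simp_all add: c_q)
      have lt: "k - j < k - i" "k - i \<le> l" using 2 ij by (auto simp: k_def)
      have "k - i = Suc (k - j) \<longleftrightarrow> j = Suc i" using ij by auto
      then show ?thesis
        using path_q[OF lt] 2 P(4) unfolding c sym[of "q (k - i)"] by auto
    next
      case 3
      then have c: "c i = q 0" "c j = q (k - j)" using ij P(2) Q(2) by (simp_all add: c_def)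
      have lt: "0 < k - j" "k - j \<le> l" using 3 ij by (auto simp: k_def)
      have "k - j = Suc 0 \<longleftrightarrow> j = k - 1" using ij by auto
      then show ?thesis using path_q[OF lt] 3 P(4) unfolding c by simp
    next
      case 4
      then have c: "c i = p i" "c j = q (k - j)" by (simp_all add: c_def)
      show ?thesis using apart[of i "k - j"] 4 ij unfolding c by (simp add: k_def)
    qed
  qed
  have k: "4 \<le> k" using P(4) Q(4) by (simp add: k_def)
  have modulo: "j = Suc i mod k \<or> i = Suc j mod k \<longleftrightarrow> j = Suc i \<or> (i = 0 \<and> j = k - 1)"
    if ij: "i < j" "j < k" for i j
  proof -
    have "Suc i mod k = Suc i" using ij by simp
    moreover have "i = Suc j mod k \<longleftrightarrow> i = 0 \<and> j = k - 1"
      using ij k by (cases "Suc j = k") auto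
    ultimately show ?thesis by simp
  qed
  have adj_c: "adj (c i) (c j) \<longleftrightarrow> j = Suc i mod k \<or> i = Suc j mod k" if ij: "i < k" "j < k" for i j
  proof (cases i j rule: linorder_cases)
    case less
    then show ?thesis using main[OF less ij(2)] modulo[OF less ij(2)] by simp
  next
    case equal
    have "Suc i mod k \<noteq> i" using ij k by (cases "Suc i = k") auto
    then show ?thesis using equal irrefl by auto
  next
    case greater
    then show ?thesis using main[OF greater ij(1)] modulo[OF greater ij(1)] sym by auto
  qed
  let ?vs = "map c [0..<k]"
  have "inj_on c {0..<k}"
  proof (rule inj_onI)
    fix i j assume ij: "i \<in> {0..<k}" "j \<in> {0..<k}" "c i = c j"
    then show "i = j" using main[of i j] main[of j i] by (cases i j rule: linorder_cases) auto
  qed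
  then have "distinct ?vs" by (simp add: distinct_map)
  then have "induced_cycle adj ?vs"
    unfolding induced_cycle_def using k adj_c by simp
  with k show ?thesis by (intro exI[of _ ?vs]) simp
qed

text \<open>If \<open>x\<close> had no neighbour in the component of \<open>a\<close> inside
  \<open>A\<close>, then \<open>x\<close> and the rest of \<open>A\<close> could move to the side of
  \<open>b\<close>, leaving a smaller separator.\<close>

lemma separator_neighbour:
  fixes Y :: "'x::finite set"
  assumes graph: "simple_graph adj"
    and sep: "separation adj Y A S B" "a \<in> A" "b \<in> B"
    and least: "\<forall>A' S' B'. separation adj Y A' S' B' \<longrightarrow> a \<in> A' \<longrightarrow> b \<in> B' \<longrightarrow> card S \<le> card S'"
    and x: "x \<in> S"
  shows "\<exists>p\<in>A. adj x p \<and> (a, p) \<in> {(u, v). u \<in> A \<and> v \<in> A \<and> adj u v}\<^sup>*"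
proof (rule ccontr)
  assume none: "\<not> ?thesis"
  let ?r = "{(u, v). u \<in> A \<and> v \<in> A \<and> adj u v}"
  define A0 where "A0 = {p\<in>A. (a, p) \<in> ?r\<^sup>*}"
  have sym: "adj u v \<Longrightarrow> adj v u" for u v
    using graph by (auto simp: simple_graph_def symp_def)
  have parts: "Y = A \<union> S \<union> B" "A \<inter> S = {}" "A \<inter> B = {}" "S \<inter> B = {}"
    and no_edge: "\<And>u v. u \<in> A \<Longrightarrow> v \<in> B \<Longrightarrow> \<not> adj u v"
    using sep(1) unfolding separation_def by auto
  have A0: "a \<in> A0" "A0 \<subseteq> A" using sep(2) by (auto simp: A0_def)
  have "v \<in> A0" if "u \<in> A0" "v \<in> A" "adj u v" for u v
  proof -
    have "(a, u) \<in> ?r\<^sup>*" "(u, v) \<in> ?r" using that by (auto simp: A0_def)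
    then have "(a, v) \<in> ?r\<^sup>*" by (rule rtrancl_into_rtrancl)
    with that(2) show ?thesis by (simp add: A0_def)
  qed
  then have edges: "\<not> adj u v" if "u \<in> A0" "v \<in> (A - A0) \<union> B \<union> {x}" for u v
    using that none no_edge sym A0(2) unfolding A0_def by blast
  have "separation adj Y A0 (S - {x}) ((A - A0) \<union> B \<union> {x})"
    unfolding separation_def
  proof (intro conjI)
    show "Y = A0 \<union> (S - {x}) \<union> (A - A0 \<union> B \<union> {x})" using parts(1) A0(2) x by blast
    show "A0 \<inter> (S - {x}) = {}" using A0(2) parts(2) by blast
    show "A0 \<inter> (A - A0 \<union> B \<union> {x}) = {}" using A0(2) parts(2,3) x by blast
    show "(S - {x}) \<inter> (A - A0 \<union> B \<union> {x}) = {}" using parts(2,4) by blast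
    show "A0 \<noteq> {}" "A - A0 \<union> B \<union> {x} \<noteq> {}" using A0(1) by auto
    show "\<forall>u\<in>A0. \<forall>v\<in>A - A0 \<union> B \<union> {x}. \<not> adj u v \<and> \<not> adj v u"
      using edges sym by blast
  qed
  then have "card S \<le> card (S - {x})" using least A0(1) sep(3) by blast
  moreover have "card (S - {x}) < card S" using x by (intro card_Diff1_less) auto
  ultimately show False by simp
qed

text \<open>Both \<open>x\<close> and \<open>y\<close> touch the component of \<open>a\<close> in
  \<open>A\<close>, so a walk through \<open>A\<close> joins them. A shortest one is induced, and
  non-adjacency gives it at least two edges.\<close>

lemma separator_path:
  fixes Y :: "'x::finite set"
  assumes graph: "simple_graph adj"
    and sep: "separation adj Y A S B" "a \<in> A" "b \<in> B"
    and least: "\<forall>A' S' B'. separation adj Y A' S' B' \<longrightarrow> a \<in> A' \<longrightarrow> b \<in> B' \<longrightarrow> card S \<le> card S'"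
    and xy: "x \<in> S" "y \<in> S" "x \<noteq> y" "\<not> adj x y"
  shows "\<exists>p m. induced_path adj p m \<and> p 0 = x \<and> p m = y \<and> 2 \<le> m \<and>
    (\<forall>i. 0 < i \<longrightarrow> i < m \<longrightarrow> p i \<in> A)"
proof -
  have sym: "adj u v \<Longrightarrow> adj v u" for u v
    using graph by (auto simp: simple_graph_def symp_def)
  let ?W = "insert x (insert y A)"
  let ?r = "{(u, v). u \<in> A \<and> v \<in> A \<and> adj u v}" and ?R = "{(u, v). u \<in> ?W \<and> v \<in> ?W \<and> adj u v}"
  obtain u where u: "u \<in> A" "adj x u" "(a, u) \<in> ?r\<^sup>*"
    using separator_neighbour[OF graph sep least xy(1)] by blast
  obtain w where w: "w \<in> A" "adj y w" "(a, w) \<in> ?r\<^sup>*"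
    using separator_neighbour[OF graph sep least xy(2)] by blast
  have mono: "?r\<^sup>* \<subseteq> ?R\<^sup>*" by (rule rtrancl_mono) auto
  have "sym_on UNIV ?R" using sym by (auto simp: sym_on_def)
  then have "sym (?R\<^sup>*)" by (rule sym_rtrancl)
  then have "(u, a) \<in> ?R\<^sup>*" using u(3) mono by (meson subsetD symD)
  moreover have "(x, u) \<in> ?R" "(w, y) \<in> ?R" using u w sym by auto
  moreover have "(a, w) \<in> ?R\<^sup>*" using w(3) mono by blast
  ultimately have "(x, y) \<in> ?R\<^sup>*"
    by (meson converse_rtrancl_into_rtrancl rtrancl_into_rtrancl rtrancl_trans)
  then obtain p m where p: "induced_path adj p m" "p 0 = x" "p m = y" "\<And>i. i \<le> m \<Longrightarrow> p i \<in> ?W"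
    using induced_path_exists[of x y ?W adj] by blast
  have ne: "p i \<noteq> p j" "adj (p i) (p j) \<longleftrightarrow> j = Suc i" if "i < j" "j \<le> m" for i j
    using p(1) that unfolding induced_path_def by blast+
  have "m \<noteq> 0" using p(2,3) xy(3) by metis
  moreover have "m \<noteq> 1" using ne(2)[of 0 1] p(2,3) xy(4) by auto
  ultimately have "2 \<le> m" by simp
  moreover have "p i \<in> A" if "0 < i" "i < m" for i
    using p(4)[of i] ne(1)[of 0 i] ne(1)[of i m] p(2,3) that by auto
  ultimately show ?thesis using p(1,2,3) by (intro exI[of _ p] exI[of _ m]) simp
qed

text \<open>
  A separator of minimal size between two given vertices is a clique: two non-adjacent vertices of it
  would be joined by induced paths through both sides.
\<close>

lemma chordal_clique_separation:
  fixes Y :: "'x::finite set"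
  assumes graph: "simple_graph adj" and "chordal adj" and "\<not> clique adj Y"
  obtains A S B where "separation adj Y A S B" "clique adj S"
proof -
  have sym: "adj u v \<Longrightarrow> adj v u" for u v
    using graph by (auto simp: simple_graph_def symp_def)
  obtain a b where ab: "a \<in> Y" "b \<in> Y" "a \<noteq> b" "\<not> adj a b"
    using assms(3) unfolding clique_def by blast
  define good where "good S \<longleftrightarrow> (\<exists>A B. separation adj Y A S B \<and> a \<in> A \<and> b \<in> B)" for S
  have "separation adj Y {a} (Y - {a, b}) {b}"
    using ab sym unfolding separation_def by auto
  then have "good (Y - {a, b})" unfolding good_def by blast
  from ex_has_least_nat[of good, OF this, of card] obtain S
    where S: "good S" and least: "\<And>S'. good S' \<Longrightarrow> card S \<le> card S'"
    by blast
  obtain A B where sep: "separation adj Y A S B" "a \<in> A" "b \<in> B"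
    using S unfolding good_def by blast
  have least_ab: "\<forall>A' S' B'. separation adj Y A' S' B' \<longrightarrow> a \<in> A' \<longrightarrow> b \<in> B' \<longrightarrow> card S \<le> card S'"
    using least unfolding good_def by blast
  then have least_ba: "\<forall>A' S' B'. separation adj Y A' S' B' \<longrightarrow> b \<in> A' \<longrightarrow> a \<in> B' \<longrightarrow> card S \<le> card S'"
    using separation_sym by blast
  have "clique adj S"
  proof (rule ccontr)
    assume "\<not> clique adj S"
    then obtain x y where xy: "x \<in> S" "y \<in> S" "x \<noteq> y" "\<not> adj x y" unfolding clique_def by blast
    define joins where "joins Z p m \<longleftrightarrow> induced_path adj p m \<and> p 0 = x \<and> p m = y \<and> 2 \<le> m \<and>
      (\<forall>i. 0 < i \<longrightarrow> i < m \<longrightarrow> p i \<in> Z)" for Z p m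
    have "\<exists>p m. joins A p m"
      unfolding joins_def by (rule separator_path[OF graph sep least_ab xy])
    then obtain p m where p: "joins A p m" by blast
    have "\<exists>q l. joins B q l"
      unfolding joins_def
      by (rule separator_path[OF graph separation_sym[OF sep(1)] sep(3,2) least_ba xy])
    then obtain q l where q: "joins B q l" by blast
    note p = p[unfolded joins_def] and q = q[unfolded joins_def]
    have P: "induced_path adj p m" "p 0 = x" "p m = y" "2 \<le> m" using p by blast+
    have Q: "induced_path adj q l" "q 0 = x" "q l = y" "2 \<le> l" using q by blast+
    have AB: "A \<inter> B = {}" "\<forall>a\<in>A. \<forall>b\<in>B. \<not> adj a b"
      using sep(1) by (simp_all add: separation_def)
    have "\<exists>vs. 4 \<le> length vs \<and> induced_cycle adj vs"
    proof (rule induced_cycle_of_paths[OF graph P Q])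
      fix i j assume "0 < i" "i < m" "0 < j" "j < l"
      then have "p i \<in> A" "q j \<in> B" using p q by (simp only:)+
      then show "p i \<noteq> q j \<and> \<not> adj (p i) (q j)"
        using AB by (metis disjoint_iff)
    qed
    then show False using assms(2) by (simp add: chordal_def)
  qed
  with sep(1) show thesis by (rule that)
qed

section \<open>Simplicial vertices of chordal graphs\<close>

definition simplicial :: "('x \<Rightarrow> 'x \<Rightarrow> bool) \<Rightarrow> 'x set \<Rightarrow> 'x \<Rightarrow> bool" where
  "simplicial adj Y v \<longleftrightarrow> v \<in> Y \<and> clique adj {w\<in>Y. adj v w}"

text \<open>Dirac's theorem. Asking for two non-adjacent vertices makes the induction work: within
  one side together with the clique \<open>S\<close> they cannot both lie in \<open>S\<close>, and
  the neighbours of one in the side stay there or in \<open>S\<close>.\<close>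

lemma two_simplicial_vertices:
  fixes Y :: "'x::finite set"
  assumes graph: "simple_graph adj" and chordal: "chordal adj" and "\<not> clique adj Y"
  shows "\<exists>u v. u \<noteq> v \<and> \<not> adj u v \<and> simplicial adj Y u \<and> simplicial adj Y v"
  using assms(3)
proof (induction "card Y" arbitrary: Y rule: less_induct)
  case less
  obtain A S B where sep: "separation adj Y A S B" and S: "clique adj S"
    using chordal_clique_separation[OF graph chordal less.prems] by blast
  have side: "\<exists>a\<in>A. simplicial adj Y a" if sep: "separation adj Y A S B" for A B
  proof -
    have parts: "Y = A \<union> S \<union> B" "A \<inter> S = {}" "A \<inter> B = {}" "S \<inter> B = {}" "A \<noteq> {}" "B \<noteq> {}"
      and no_edge: "\<And>u v. u \<in> A \<Longrightarrow> v \<in> B \<Longrightarrow> \<not> adj u v"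
      using sep unfolding separation_def by auto
    have "\<exists>a\<in>A. simplicial adj (A \<union> S) a"
    proof (cases "clique adj (A \<union> S)")
      case True
      then have "simplicial adj (A \<union> S) a" if "a \<in> A" for a
        using that unfolding simplicial_def by (auto intro: clique_subset)
      then show ?thesis using parts(5) by blast
    next
      case False
      have "A \<union> S \<subset> Y" using parts by blast
      then have "card (A \<union> S) < card Y" by (intro psubset_card_mono) auto
      then obtain u v where uv: "u \<noteq> v" "\<not> adj u v" "simplicial adj (A \<union> S) u" "simplicial adj (A \<union> S) v"
        using less.hyps[of "A \<union> S"] False by blast
      then have "u \<in> A \<or> v \<in> A" using S unfolding simplicial_def clique_def by blast
      with uv show ?thesis by blast
    qed
    then obtain a where a: "a \<in> A" "simplicial adj (A \<union> S) a" by blast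
    have "{w\<in>Y. adj a w} \<subseteq> {w\<in>A \<union> S. adj a w}" using parts(1) no_edge[OF a(1)] by blast
    then have "simplicial adj Y a"
      using a parts(1) clique_subset unfolding simplicial_def by blast
    with a(1) show ?thesis by blast
  qed
  obtain a where a: "a \<in> A" "simplicial adj Y a" using side[OF sep] by blast
  obtain b where b: "b \<in> B" "simplicial adj Y b" using side[OF separation_sym[OF sep]] by blast
  have "a \<noteq> b" "\<not> adj a b" using sep a(1) b(1) unfolding separation_def by blast+
  with a(2) b(2) show ?case by blast
qed

lemma simplicial_vertex_exists:
  fixes Y :: "'x::finite set"
  assumes "simple_graph adj" "chordal adj" "\<not> clique adj Y"
  obtains v where "simplicial adj Y v"
  using two_simplicial_vertices[OF assms] by blast

section \<open>Depth of clique complexes of chordal graphs\<close>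

text \<open>A simplicial vertex \<open>v\<close> attaches the simplex on \<open>insert v N\<close>
  along the simplex on its neighbourhood \<open>N\<close>. As \<open>N\<close> separates
  \<open>v\<close> from the rest, \<open>d \<le> card N + 1\<close>, which is what both simplices
  must satisfy.\<close>

lemma esym_regular_clique_complex:
  fixes Y :: "'x::finite set"
  assumes graph: "simple_graph adj" and chordal: "chordal adj"
    and "d \<le> card Y" "\<forall>A S B. separation adj Y A S B \<longrightarrow> d \<le> Suc (card S)"
  shows "esym_regular K {F. clique adj F \<and> F \<subseteq> Y} d"
  using assms(3,4)
proof (induction "card Y" arbitrary: Y rule: less_induct)
  case less
  have sym: "adj u v \<Longrightarrow> adj v u" for u v
    using graph by (auto simp: simple_graph_def symp_def)
  show ?case
  proof (cases "clique adj Y")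
    case True
    then have "{F. clique adj F \<and> F \<subseteq> Y} = Pow Y" using clique_subset[of adj Y] by blast
    then show ?thesis using esym_regular_mono[OF esym_regular_Pow less.prems(1)] by simp
  next
    case False
    obtain v where v: "simplicial adj Y v"
      using simplicial_vertex_exists[OF graph chordal False] by blast
    define N where "N = {w\<in>Y. adj v w}"
    have vY: "v \<in> Y" and N: "clique adj N" using v by (simp_all add: simplicial_def N_def)
    have vN: "v \<notin> N" using graph by (simp add: N_def simple_graph_def irreflp_def)
    have clique_vN: "clique adj (insert v N)"
      using N sym unfolding clique_def N_def by blast
    define B where "B = Y - insert v N"
    have NY: "N \<subseteq> Y" by (auto simp: N_def)
    have not_adj: "\<not> adj v w \<and> \<not> adj w v" if "w \<in> Y" "w \<notin> N" for w
      using that sym by (auto simp: N_def)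
    have "B \<noteq> {}"
    proof
      assume "B = {}"
      then have "Y \<subseteq> insert v N" by (auto simp: B_def)
      then show False using clique_subset[OF clique_vN] False by blast
    qed
    have "separation adj Y {v} N B"
      unfolding separation_def
    proof (intro conjI)
      show "Y = {v} \<union> N \<union> B" using vY NY by (auto simp: B_def)
      show "\<forall>a\<in>{v}. \<forall>b\<in>B. \<not> adj a b \<and> \<not> adj b a" using not_adj by (auto simp: B_def)
    qed (use vN \<open>B \<noteq> {}\<close> in \<open>auto simp: B_def\<close>)
    then have cardN: "d \<le> Suc (card N)" using less.prems(2) by blast
    have "card (Y - {v}) < card Y" using vY by (intro card_Diff1_less) auto
    have "N \<subset> Y - {v}" using vN NY \<open>B \<noteq> {}\<close> by (auto simp: B_def)
    then have "card N < card (Y - {v})" by (intro psubset_card_mono) auto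
    then have "d \<le> card (Y - {v})" using cardN by simp
    moreover have "\<forall>A S B. separation adj (Y - {v}) A S B \<longrightarrow> d \<le> Suc (card S)"
    proof (intro allI impI)
      fix A S B assume sep: "separation adj (Y - {v}) A S B"
      \<comment> \<open>The separator bound must descend to \<open>Y - {v}\<close>. The clique
        \<open>N\<close> meets at most one side, so \<open>v\<close> can join that side without
        changing \<open>S\<close>.\<close>
      have extend: "d \<le> Suc (card S)" if sep: "separation adj (Y - {v}) A S B" and "N \<inter> B = {}" for A B
      proof -
        have parts: "Y - {v} = A \<union> S \<union> B" "A \<inter> S = {}" "A \<inter> B = {}" "S \<inter> B = {}" "B \<noteq> {}"
          and no_edge: "\<forall>a\<in>A. \<forall>b\<in>B. \<not> adj a b \<and> \<not> adj b a"
          using sep unfolding separation_def by simp_all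
        have v: "v \<notin> A" "v \<notin> S" "v \<notin> B" using parts(1) by auto
        have "separation adj Y (insert v A) S B"
          unfolding separation_def
        proof (intro conjI)
          show "Y = insert v A \<union> S \<union> B" using parts(1) vY by auto
          have "\<not> adj v b \<and> \<not> adj b v" if "b \<in> B" for b
          proof (rule not_adj)
            show "b \<in> Y" using parts(1) that by auto
            show "b \<notin> N" using \<open>N \<inter> B = {}\<close> that by auto
          qed
          with no_edge show "\<forall>a\<in>insert v A. \<forall>b\<in>B. \<not> adj a b \<and> \<not> adj b a" by simp
        qed (use parts v in auto)
        then show ?thesis using less.prems(2) by blast
      qed
      show "d \<le> Suc (card S)"
      proof (cases "N \<inter> B = {}")
        case True
        then show ?thesis by (rule extend[OF sep])
      next
        case False
        have disj: "A \<inter> B = {}" and no_edge: "\<forall>a\<in>A. \<forall>b\<in>B. \<not> adj a b"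
          using sep by (simp_all add: separation_def)
        obtain b where b: "b \<in> N" "b \<in> B" using False by blast
        have "a \<notin> N" if a: "a \<in> A" for a
        proof
          assume "a \<in> N"
          moreover have "a \<noteq> b" using disj a b(2) by blast
          ultimately have "adj a b" using N b(1) by (simp add: clique_def)
          then show False using no_edge a b(2) by blast
        qed
        then have "N \<inter> A = {}" by blast
        then show ?thesis by (rule extend[OF separation_sym[OF sep]])
      qed
    qed
    ultimately have IH: "esym_regular K {F. clique adj F \<and> F \<subseteq> Y - {v}} d"
      by (rule less.hyps[OF \<open>card (Y - {v}) < card Y\<close>])
    have union: "{F. clique adj F \<and> F \<subseteq> Y} = {F. clique adj F \<and> F \<subseteq> Y - {v}} \<union> Pow (insert v N)"
    proof (rule set_eqI)
      fix F
      have 1: "F \<subseteq> insert v N" if F: "clique adj F" "F \<subseteq> Y" "v \<in> F"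
      proof
        fix w assume "w \<in> F"
        moreover from this have "adj v w" if "w \<noteq> v" using F(1,3) that by (simp add: clique_def)
        ultimately show "w \<in> insert v N" using F(2) by (auto simp: N_def)
      qed
      have 2: "clique adj F" "F \<subseteq> Y" if F: "F \<subseteq> insert v N"
        by (rule clique_subset[OF clique_vN F]) (use F vY NY in blast)
      have "clique adj F \<and> F \<subseteq> Y \<longleftrightarrow> clique adj F \<and> F \<subseteq> Y - {v} \<or> F \<subseteq> insert v N"
      proof (cases "v \<in> F")
        case True
        then show ?thesis using 1 2 by blast
      next
        case False
        then show ?thesis using 2 by blast
      qed
      then show "F \<in> {F. clique adj F \<and> F \<subseteq> Y} \<longleftrightarrow>
          F \<in> {F. clique adj F \<and> F \<subseteq> Y - {v}} \<union> Pow (insert v N)" by simp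
    qed
    have inter: "{F. clique adj F \<and> F \<subseteq> Y - {v}} \<inter> Pow (insert v N) = Pow N"
    proof (rule set_eqI)
      fix F
      have "clique adj F" if "F \<subseteq> N" using clique_subset[OF N that] .
      then show "F \<in> {F. clique adj F \<and> F \<subseteq> Y - {v}} \<inter> Pow (insert v N) \<longleftrightarrow> F \<in> Pow N"
        using vN NY by blast
    qed
    show ?thesis
      unfolding union
    proof (rule esym_regular_Un)
      show "simplicial_complex {F. clique adj F \<and> F \<subseteq> Y - {v}}"
        unfolding simplicial_complex_def
      proof (intro ballI allI impI)
        fix F H assume F: "F \<in> {F. clique adj F \<and> F \<subseteq> Y - {v}}" and H: "H \<subseteq> F"
        have "clique adj H" using clique_subset[OF _ H] F by simp
        then show "H \<in> {F. clique adj F \<and> F \<subseteq> Y - {v}}" using F H by blast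
      qed
      show "simplicial_complex (Pow (insert v N))"
        unfolding simplicial_complex_def by blast
      show "esym_regular K (Pow (insert v N)) d"
        by (rule esym_regular_mono[OF esym_regular_Pow]) (use cardN vN in simp)
      show "esym_regular K ({F. clique adj F \<and> F \<subseteq> Y - {v}} \<inter> Pow (insert v N)) (d - 1)"
        unfolding inter by (rule esym_regular_mono[OF esym_regular_Pow]) (use cardN in simp)
    qed (rule IH)
  qed
qed

text \<open>\<open>A\<close> holds the vertices removed from the ambient simplex, \<open>Y\<close>
  the part of the graph still tested. The first piece drops a simplicial \<open>v\<close> from
  \<open>Y\<close> only, the intersection drops it from both. The second piece is a simplex on one
  vertex fewer, punctured at the non-neighbours \<open>W\<close> of \<open>v\<close>; these two
  losses are the 2 in the index.\<close>

lemma esym_regular_dual: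
  fixes A Y :: "'x::finite set"
  assumes graph: "simple_graph adj" and chordal: "chordal adj" and "Y \<inter> A = {}"
  shows "esym_regular K {H. H \<subseteq> - A \<and> \<not> clique adj (Y - H)} (card (UNIV :: 'x set) - card A - 2)"
  using assms(3)
proof (induction "card Y" arbitrary: A Y rule: less_induct)
  case less
  let ?n = "card (UNIV :: 'x set)"
  have sym: "adj u v \<Longrightarrow> adj v u" for u v
    using graph by (auto simp: simple_graph_def symp_def)
  show ?case
  proof (cases "clique adj Y")
    case True
    then have empty: "{H. H \<subseteq> - A \<and> \<not> clique adj (Y - H)} = {}"
      using clique_subset[of adj Y] by blast
    show ?thesis unfolding empty by (rule esym_regular_empty)
  next
    case False
    obtain v where v: "simplicial adj Y v"
      using simplicial_vertex_exists[OF graph chordal False] by blast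
    then have vY: "v \<in> Y" and N: "clique adj {w\<in>Y. adj v w}" by (simp_all add: simplicial_def)
    then have vA: "v \<notin> A" using less.prems by blast
    define W where "W = {w\<in>Y. w \<noteq> v \<and> \<not> adj v w}"
    let ?G1 = "{H. H \<subseteq> - A \<and> \<not> clique adj (Y - {v} - H)}"
    let ?G2 = "{H. H \<subseteq> - A - {v} \<and> \<not> W \<subseteq> H}"
    have union: "{H. H \<subseteq> - A \<and> \<not> clique adj (Y - H)} = ?G1 \<union> ?G2"
    proof (rule set_eqI)
      fix H
      have 1: "clique adj (Y - {v} - H)" if "clique adj (Y - H)"
        by (rule clique_subset[OF that]) blast
      have 2: "W \<subseteq> H" if "clique adj (Y - H)" "v \<notin> H"
      proof
        fix w assume "w \<in> W"
        then have w: "w \<in> Y" "w \<noteq> v" "\<not> adj v w" by (simp_all add: W_def)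
        show "w \<in> H"
        proof (rule ccontr)
          assume "w \<notin> H"
          with that vY w have "adj v w" by (simp add: clique_def)
          with w(3) show False by simp
        qed
      qed
      have 3: "clique adj (Y - H)" if "clique adj (Y - {v} - H)" "v \<in> H \<or> W \<subseteq> H"
        unfolding clique_def
      proof (intro ballI impI)
        fix x y assume xy: "x \<in> Y - H" "y \<in> Y - H" "x \<noteq> y"
        have nbr: "adj v w" if "w \<in> Y - H" "w \<noteq> v" "v \<notin> H" for w
          using that \<open>v \<in> H \<or> W \<subseteq> H\<close> by (auto simp: W_def)
        show "adj x y"
        proof (cases "x = v")
          case True
          then show ?thesis using nbr[of y] xy by simp
        next
          case x: False
          show ?thesis
          proof (cases "y = v")
            case True
            then have "adj v x" using nbr[of x] xy by simp
            then show ?thesis unfolding True by (rule sym)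
          next
            case False
            then show ?thesis using that(1) x xy by (simp add: clique_def)
          qed
        qed
      qed
      show "H \<in> {H. H \<subseteq> - A \<and> \<not> clique adj (Y - H)} \<longleftrightarrow> H \<in> ?G1 \<union> ?G2"
      proof (cases "clique adj (Y - H)")
        case True
        then show ?thesis using 1 2 by auto
      next
        case False
        then show ?thesis using 3 by auto
      qed
    qed
    have inter: "?G1 \<inter> ?G2 = {H. H \<subseteq> - insert v A \<and> \<not> clique adj (Y - {v} - H)}"
    proof -
      \<comment> \<open>Simpliciality of \<open>v\<close> enters here: if \<open>H\<close> contains
        all non-neighbours of \<open>v\<close>, what remains of \<open>Y - {v}\<close> lies in its
        neighbourhood, a clique.\<close>
      have "\<not> W \<subseteq> H" if "\<not> clique adj (Y - {v} - H)" for H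
      proof
        assume "W \<subseteq> H"
        then have "Y - {v} - H \<subseteq> {w\<in>Y. adj v w}" by (auto simp: W_def)
        then have "clique adj (Y - {v} - H)" by (rule clique_subset[OF N])
        with that show False by simp
      qed
      then show ?thesis by auto
    qed
    have smaller: "card (Y - {v}) < card Y" using vY by (intro card_Diff1_less) auto
    have G1: "esym_regular K ?G1 (?n - card A - 2)"
      by (rule less.hyps[OF smaller]) (use less.prems in blast)
    have "W \<subseteq> - A - {v}" using less.prems by (auto simp: W_def)
    moreover have "card (- A - {v}) - 1 = ?n - card A - 2"
      using vA by (simp add: Compl_eq_Diff_UNIV card_Diff_subset)
    ultimately have G2: "esym_regular K ?G2 (?n - card A - 2)"
      using esym_regular_punctured[of W "- A - {v}" K] by simp
    have "(Y - {v}) \<inter> insert v A = {}" using less.prems by auto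
    then have "esym_regular K (?G1 \<inter> ?G2) (?n - card (insert v A) - 2)"
      unfolding inter by (rule less.hyps[OF smaller])
    then have G12: "esym_regular K (?G1 \<inter> ?G2) (?n - card A - 2 - 1)"
      using vA by simp
    have sc1: "simplicial_complex ?G1"
      unfolding simplicial_complex_def
    proof (intro ballI allI impI)
      fix F H assume F: "F \<in> ?G1" and H: "H \<subseteq> F"
      have "Y - {v} - F \<subseteq> Y - {v} - H" using H by blast
      then have "\<not> clique adj (Y - {v} - H)" using F clique_subset[of adj "Y - {v} - H"] by auto
      then show "H \<in> ?G1" using F H by blast
    qed
    have sc2: "simplicial_complex ?G2"
      unfolding simplicial_complex_def by blast
    show ?thesis
      unfolding union by (rule esym_regular_Un[OF sc1 sc2 G1 G2 G12])
  qed
qed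

lemma alexander_dual_clique_complex:
  "alexander_dual (clique_complex adj) = {H. H \<subseteq> - {} \<and> \<not> clique adj (UNIV - H)}"
  by (auto simp: alexander_dual_iff mem_clique_complex Compl_eq_Diff_UNIV)

text \<open>A non-clique contains a non-adjacent pair, so the minimal non-faces of a clique complex
  have two vertices, and the facets of the dual are their complements.\<close>

lemma card_facet_alexander_dual:
  fixes adj :: "'x::finite \<Rightarrow> 'x \<Rightarrow> bool"
  assumes F: "F \<in> facets (alexander_dual (clique_complex adj))"
  shows "card F = card (UNIV :: 'x set) - 2"
proof -
  have "\<not> clique adj (- F)"
    using F by (simp add: facets_def alexander_dual_iff mem_clique_complex)
  then obtain x y where xy: "x \<notin> F" "y \<notin> F" "x \<noteq> y" "\<not> adj x y"
    unfolding clique_def by blast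
  have "- {x, y} \<in> alexander_dual (clique_complex adj)"
    using xy(3,4) by (simp add: alexander_dual_iff mem_clique_complex clique_def)
  moreover have "F \<subseteq> - {x, y}" using xy by blast
  ultimately have "- {x, y} = F" using F unfolding facets_def by blast
  moreover have "card (- {x, y}) = card (UNIV :: 'x set) - 2"
    using xy(3) by (simp add: Compl_eq_Diff_UNIV card_Diff_subset)
  ultimately show ?thesis by simp
qed

lemma minimal_facet_exists:
  fixes \<Gamma> :: "'x::finite set set"
  assumes "\<Gamma> \<noteq> {}"
  obtains F where "F \<in> facets \<Gamma>" "\<forall>H\<in>facets \<Gamma>. card F \<le> card H"
proof -
  obtain F0 where "F0 \<in> facets \<Gamma>" using assms facet_superset by blast
  from ex_has_least_nat[of "\<lambda>F. F \<in> facets \<Gamma>", OF this, of card] show thesis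
    using that by blast
qed

text \<open>No clique meets both sides. A walk of faces from one side to the other therefore has a
  step where contact with \<open>A\<close> is lost, and the \<open>d - 1\<close> common vertices of
  that step lie in \<open>S\<close>.\<close>

lemma separation_card_ge:
  fixes adj :: "'x::finite \<Rightarrow> 'x \<Rightarrow> bool"
  assumes conn: "\<forall>G\<in>clique_complex adj. \<forall>G'\<in>clique_complex adj. card G = d \<longrightarrow> card G' = d \<longrightarrow>
      (G, G') \<in> (ridge_steps (clique_complex adj) d)\<^sup>*"
    and large: "\<forall>H\<in>facets (clique_complex adj). d \<le> card H"
    and sep: "separation adj UNIV A S B"
  shows "d \<le> Suc (card S)"
proof (rule ccontr)
  assume small: "\<not> ?thesis"
  have parts: "UNIV = A \<union> S \<union> B" and ne: "A \<noteq> {}" "B \<noteq> {}"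
    and no_edge: "\<And>a b. a \<in> A \<Longrightarrow> b \<in> B \<Longrightarrow> \<not> adj a b" and disj: "A \<inter> B = {}"
    using sep unfolding separation_def by simp_all
  \<comment> \<open>The negated claim gives \<open>d \<ge> 2\<close>, so a single vertex can be
    extended to a face of size \<open>d\<close>.\<close>
  have large_face: "\<exists>G\<in>clique_complex adj. v \<in> G \<and> card G = d" for v
  proof -
    have "{v} \<in> clique_complex adj" by (simp add: mem_clique_complex clique_def)
    then show ?thesis
      using face_extends[OF simplicial_complex_clique_complex large, of "{v}"] small by auto
  qed
  obtain a b where "a \<in> A" "b \<in> B" using ne by blast
  obtain G where G: "G \<in> clique_complex adj" "a \<in> G" "card G = d" using large_face by blast
  obtain G' where G': "G' \<in> clique_complex adj" "b \<in> G'" "card G' = d" using large_face by blast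
  have one_side: "H \<inter> A = {} \<or> H \<inter> B = {}" if "H \<in> clique_complex adj" for H
    using that no_edge disj unfolding mem_clique_complex clique_def by (metis disjoint_iff)
  have "(G, G') \<in> (ridge_steps (clique_complex adj) d)\<^sup>*" using conn G G' by blast
  then have "G' \<inter> A \<noteq> {}"
  proof (induction rule: rtrancl_induct)
    case base
    then show ?case using \<open>a \<in> A\<close> G(2) by blast
  next
    case (step H H')
    have H: "H \<in> clique_complex adj" "H' \<in> clique_complex adj" "card H' = d" "Suc (card (H \<inter> H')) = d"
      using step.hyps(2) by (simp_all add: ridge_steps_def)
    show ?case
    proof
      assume "H' \<inter> A = {}"
      moreover have "H \<inter> B = {}" using one_side[OF H(1)] step.IH by blast
      ultimately have "H \<inter> H' \<subseteq> S" using parts by blast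
      then have "card (H \<inter> H') \<le> card S" by (intro card_mono) auto
      then show False using H(4) small by simp
    qed
  qed
  moreover have "G' \<inter> B \<noteq> {}" using \<open>b \<in> B\<close> G'(2) by blast
  ultimately show False using one_side[OF G'(1)] by blast
qed

theorem proposition5p8:
  fixes adj :: "'x::finite \<Rightarrow> 'x \<Rightarrow> bool"
  assumes "simple_graph adj"
  shows "bi_initially_CM TYPE('k::field) (clique_complex adj) \<longleftrightarrow>
         chordal adj \<and> weakly_connected (clique_complex adj)"
proof -
  let ?\<Delta> = "clique_complex adj"
  let ?n = "card (UNIV :: 'x set)"
  have sc: "simplicial_complex ?\<Delta>" by (rule simplicial_complex_clique_complex)
  have sc': "simplicial_complex (alexander_dual ?\<Delta>)" by (rule simplicial_complex_alexander_dual[OF sc])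
  have "{} \<in> ?\<Delta>" by (simp add: clique_complex_def)
  then obtain F where F: "F \<in> facets ?\<Delta>" "\<forall>H\<in>facets ?\<Delta>. card F \<le> card H"
    using minimal_facet_exists by blast
  show ?thesis
  proof
    assume "bi_initially_CM TYPE('k) ?\<Delta>"
    then have CM: "initially_CM TYPE('k) ?\<Delta>" "initially_CM TYPE('k) (alexander_dual ?\<Delta>)"
      by (simp_all add: bi_initially_CM_def)
    have "chordal adj"
    proof (rule ccontr)
      assume "\<not> chordal adj"
      then obtain vs where vs: "4 \<le> length vs" "induced_cycle adj vs" by (auto simp: chordal_def)
      have "card (set vs) \<le> ?n" by (intro card_mono) auto
      moreover have "card (set vs) = length vs"
        using vs(2) by (simp add: induced_cycle_def distinct_card)
      ultimately have n: "4 \<le> ?n" using vs(1) by simp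
      have cyc: "\<forall>i<length vs. \<forall>j<length vs. adj (vs ! i) (vs ! j) \<longleftrightarrow>
          j = Suc i mod length vs \<or> i = Suc j mod length vs"
        using vs(2) unfolding induced_cycle_def by blast
      have len: "0 < length vs" "2 < length vs" using vs(1) by linarith+
      \<comment> \<open>A non-adjacent pair on the cycle shows that the dual is not void, so its
        initial Cohen-Macaulayness has content.\<close>
      have "2 \<noteq> Suc 0 mod length vs" "0 \<noteq> Suc 2 mod length vs" using vs(1) by simp_all
      then have "\<not> adj (vs ! 0) (vs ! 2)" using cyc len by metis
      moreover have "vs ! 0 \<noteq> vs ! 2"
        using vs(2) len by (simp add: induced_cycle_def nth_eq_iff_index_eq del: length_greater_0_conv)
      ultimately have "UNIV \<notin> ?\<Delta>" by (auto simp: clique_complex_def)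
      then have "{} \<in> alexander_dual ?\<Delta>" by (simp add: alexander_dual_iff)
      then obtain F' where F': "F' \<in> facets (alexander_dual ?\<Delta>)"
        "\<forall>H\<in>facets (alexander_dual ?\<Delta>). card F' \<le> card H"
        using minimal_facet_exists by blast
      obtain fs :: "('x, 'k) mpoly list" where fs: "set fs \<subseteq> irrelevant_ideal" "length fs = card F'"
        "regular_seq (face_ideal (alexander_dual ?\<Delta>)) fs"
        using CM(2) unfolding initially_CM_iff_regular_seq[OF sc' F'] by blast
      have "length fs \<le> ?n - 3"
        by (rule regular_seq_length_le_induced_cycle[OF vs(2,1) assms fs(3,1)])
      \<comment> \<open>The bound \<open>4 \<le> ?n\<close> keeps the truncated differences
        \<open>?n - 3\<close> and \<open>?n - 2\<close> distinct.\<close>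
      then show False using fs(2) card_facet_alexander_dual[OF F'(1)] n by simp
    qed
    then show "chordal adj \<and> weakly_connected ?\<Delta>"
      using initially_CM_imp_weakly_connected[OF sc F CM(1)] by simp
  next
    assume hyp: "chordal adj \<and> weakly_connected ?\<Delta>"
    have "\<forall>A S B. separation adj UNIV A S B \<longrightarrow> card F \<le> Suc (card S)"
    proof (intro allI impI)
      fix A S B assume "separation adj UNIV A S B"
      then show "card F \<le> Suc (card S)"
        using hyp F(2) unfolding weakly_connected_iff[OF sc F]
        by (intro separation_card_ge[of adj "card F" A S B]) auto
    qed
    moreover have "card F \<le> ?n" by (intro card_mono) auto
    ultimately have "esym_regular TYPE('k) {F. clique adj F \<and> F \<subseteq> UNIV} (card F)"
      using hyp by (intro esym_regular_clique_complex[OF assms]) auto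
    moreover have "{F. clique adj F \<and> F \<subseteq> UNIV} = ?\<Delta>"
      by (auto simp: mem_clique_complex)
    ultimately have CM: "initially_CM TYPE('k) ?\<Delta>"
      by (intro initially_CM_of_esym_regular[OF sc F]) simp
    have "initially_CM TYPE('k) (alexander_dual ?\<Delta>)"
    proof (cases "alexander_dual ?\<Delta> = {}")
      \<comment> \<open>For a complete graph the dual is void and its face ring is 0, which counts
        as initially Cohen-Macaulay by convention.\<close>
      case True
      show ?thesis unfolding True by (rule initially_CM_void)
    next
      case False
      obtain F' where F': "F' \<in> facets (alexander_dual ?\<Delta>)"
        "\<forall>H\<in>facets (alexander_dual ?\<Delta>). card F' \<le> card H"
        using minimal_facet_exists[OF False] by blast
      have "esym_regular TYPE('k) (alexander_dual ?\<Delta>) (?n - card ({} :: 'x set) - 2)"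
        unfolding alexander_dual_clique_complex using hyp
        by (intro esym_regular_dual[OF assms]) auto
      then have "esym_regular TYPE('k) (alexander_dual ?\<Delta>) (card F')"
        by (simp add: card_facet_alexander_dual[OF F'(1)])
      then show ?thesis by (rule initially_CM_of_esym_regular[OF sc' F'])
    qed
    with CM show "bi_initially_CM TYPE('k) ?\<Delta>" by (simp add: bi_initially_CM_def)
  qed
qed

end
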